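(* Let $S\subset\mathbb{R}^3$ be a regular surface with Gauss curvature $K$, and let $k_1(x)$ and $k_2(x)$ denote the two principal curvatures at $x\in S$. Define $p,q:S\to\mathbb{R}^+$ by $$p(x)=1+\bigl|K(x)\,(k_1(x)+k_2(x))\bigr|,\qquad q(x)=1+|K(x)|\,\bigl(|k_1(x)|+|k_2(x)|\bigr).$$ For a small geodesic triangle $\triangle VAB$ on $S$ with angle $\angle AVB=\mu<\pi$ at $V$, let $\{\alpha_n\}_{n\ge1}$ and $\{\beta_n\}_{n\ge1}$ be the sequences of angles produced from $\triangle VAB$, $p$ and $q$ by the recursive construction described in the context. Then the pairs $(\lim_{n\to\infty}\alpha_n,\ \lim_{n\to\infty}\beta_n)$ are different for different types of the point $V$ (elliptic, hyperbolic, parabolic). That is, if $\triangle VAB$ and $\triangle V'A'B'$ are two small geodesic triangles on $S$ with the same angle $\mu<\pi$ at $V$ and at $V'$ respectively, and the points $V$ and $V'$ are of different types, then the corresponding pairs of limits are different.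
   Context: A point $x\in S$ is called elliptic if $K(x)>0$, hyperbolic if $K(x)<0$, and parabolic if $K(x)=0$. A geodesic on a regular (smooth) surface $S\subset\mathbb{R}^3$ is a unit speed curve $\mathbf c(s)$ on $S$ whose second derivative $\mathbf c''(s)$ is zero or perpendicular to $S$. If two geodesics start at a point $P$ with initial velocities $v$ and $w$ and pass through points $X$ and $Y$ respectively, then the angle $\angle XPY=\angle YPX$ is the angle between $v$ and $w$. Small triangle: a geodesic triangle $\triangle VAB$ on $S$ is formed by two geodesics intersecting at $V$ and a third geodesic intersecting the first two transversally at $A$ and $B$. It is called small if it (the closed region bounded by its three sides) is contained in an open set $W\subset S$ that is a normal neighborhood of all its points, i.e. there is $\delta>0$ such that for every $x\in W$ the exponential map $\exp_x$ is a diffeomorphism of the ball $B_\delta(0)\subset T_xS$ onto its image and this image contains $W$. For points $P,Q$ of the triangle, $PQ$ denotes the geodesic segment joining them (the unique geodesic of length less than $\delta$ joining them). Recursive construction: put $A_1=A$, $B_1=B$, $\alpha_1=\angle VA_1B_1$. Given $A_k$ on the side $VA$ and $B_k$ on the side $VB$ ($k\ge 1$), set $$\beta_k=\frac{\angle VB_kA_k}{1+q(B_k)}.$$ Consider the geodesic starting at $B_k$ into the triangle $\triangle VA_kB_k$, dividing the angle $\angle VB_kA_k$ so that it makes angle $\beta_k$ with the segment $B_kV$ (and hence angle $q(B_k)\beta_k$ with the segment $B_kA_k$). Let $A_{k+1}$ be the point where this geodesic meets the segment $VA_k$, so that $\beta_k=\angle VB_kA_{k+1}$. Next set $$\alpha_{k+1}=\frac{\angle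 VA_{k+1}B_k}{1+p(A_{k+1})}.$$ Consider the geodesic starting at $A_{k+1}$ into the triangle $\triangle VA_{k+1}B_k$, dividing the angle $\angle VA_{k+1}B_k$ so that it makes angle $\alpha_{k+1}$ with the segment $A_{k+1}V$ (and hence angle $p(A_{k+1})\alpha_{k+1}$ with the segment $A_{k+1}B_k$). Let $B_{k+1}$ be the point where this geodesic meets the segment $VB_k$, so that $\alpha_{k+1}=\angle VA_{k+1}B_{k+1}$. Iterating gives sequences of points $\{A_k\}$, $\{B_k\}$ and angles $\{\alpha_k\}$, $\{\beta_k\}$. *)

theory Defs
  imports "HOL-Analysis.Analysis"
begin

section \<open>Smooth maps\<close>

primrec Ck_on :: "nat \<Rightarrow> 'a::euclidean_space set \<Rightarrow> ('a \<Rightarrow> 'b::euclidean_space) \<Rightarrow> bool" where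
  "Ck_on 0 U f \<longleftrightarrow> continuous_on U f"
| "Ck_on (Suc k) U f \<longleftrightarrow>
     (\<forall>x\<in>U. f differentiable (at x)) \<and> (\<forall>v. Ck_on k U (\<lambda>x. frechet_derivative f (at x) v))"

text \<open>Only meaningful for open \<open>U\<close>.\<close>

definition smooth_on :: "'a::euclidean_space set \<Rightarrow> ('a \<Rightarrow> 'b::euclidean_space) \<Rightarrow> bool" where
  "smooth_on U f \<longleftrightarrow> (\<forall>k. Ck_on k U f)"

text \<open>
  On subsets that need not be open (surfaces, discs in tangent planes) a map is smooth if it has
  smooth extensions to open sets of the ambient space around each point.
\<close>

definition smooth_map_on :: "'a::euclidean_space set \<Rightarrow> ('a \<Rightarrow> 'b::euclidean_space) \<Rightarrow> bool" where
  "smooth_map_on X f \<longleftrightarrow>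
     (\<forall>x\<in>X. \<exists>U F. open U \<and> x \<in> U \<and> smooth_on U F \<and> (\<forall>y\<in>X \<inter> U. F y = f y))"

definition diffeomorphic_onto_image :: "'a::euclidean_space set \<Rightarrow> ('a \<Rightarrow> 'b::euclidean_space) \<Rightarrow> bool" where
  "diffeomorphic_onto_image X f \<longleftrightarrow>
     inj_on f X \<and> smooth_map_on X f \<and> smooth_map_on (f ` X) (inv_into X f)"


section \<open>Regular surfaces and their curvatures\<close>

definition regular_surface :: "(real^3) set \<Rightarrow> bool" where
  "regular_surface S \<longleftrightarrow>
     (\<forall>x\<in>S. \<exists>O' (U :: (real^2) set) \<phi>.
        open O' \<and> x \<in> O' \<and> open U \<and> smooth_on U \<phi> \<and>
        (\<exists>\<psi>. homeomorphism U (S \<inter> O') \<phi> \<psi>) \<and>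
        (\<forall>u\<in>U. inj (frechet_derivative \<phi> (at u))))"

definition tangent_space :: "(real^3) set \<Rightarrow> real^3 \<Rightarrow> (real^3) set" where
  "tangent_space S x =
     {v. \<exists>e>0. \<exists>\<gamma>. smooth_on {-e<..<e} \<gamma> \<and> \<gamma> ` {-e<..<e} \<subseteq> S \<and> \<gamma> 0 = x \<and>
                    (\<gamma> has_vector_derivative v) (at 0)}"

text \<open>
  A local unit normal field is given as a smooth map on an open set of the ambient space. The
  shape operator is only applied to tangent vectors, where it does not depend on the values of
  \<open>N\<close> off the surface.
\<close>

definition unit_normal_near :: "(real^3) set \<Rightarrow> real^3 \<Rightarrow> (real^3 \<Rightarrow> real^3) \<Rightarrow> bool" where
  "unit_normal_near S x N \<longleftrightarrow>
     (\<exists>U. open U \<and> x \<in> U \<and> smooth_on U N \<and>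
          (\<forall>y\<in>S \<inter> U. norm (N y) = 1 \<and> (\<forall>v\<in>tangent_space S y. N y \<bullet> v = 0)))"

definition shape_operator :: "(real^3 \<Rightarrow> real^3) \<Rightarrow> real^3 \<Rightarrow> real^3 \<Rightarrow> real^3" where
  "shape_operator N x v = - frechet_derivative N (at x) v"

definition orthonormal_tangent_basis :: "(real^3) set \<Rightarrow> real^3 \<Rightarrow> real^3 \<Rightarrow> real^3 \<Rightarrow> bool" where
  "orthonormal_tangent_basis S x e1 e2 \<longleftrightarrow>
     e1 \<in> tangent_space S x \<and> e2 \<in> tangent_space S x \<and> norm e1 = 1 \<and> norm e2 = 1 \<and> e1 \<bullet> e2 = 0"

text \<open>
  The Gauss curvature is the determinant of the shape operator on the tangent plane; it does not
  depend on the choice of the unit normal and of the basis.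
\<close>

definition gauss_curvature :: "(real^3) set \<Rightarrow> real^3 \<Rightarrow> real" where
  "gauss_curvature S x =
     (THE K. \<exists>N e1 e2. unit_normal_near S x N \<and> orthonormal_tangent_basis S x e1 e2 \<and>
        K = (shape_operator N x e1 \<bullet> e1) * (shape_operator N x e2 \<bullet> e2)
          - (shape_operator N x e1 \<bullet> e2) * (shape_operator N x e2 \<bullet> e1))"

text \<open>
  The principal curvatures are the two eigenvalues of the shape operator, with multiplicity. They
  are determined up to order and, since the unit normal may be reversed, up to a common sign;
  hence a relation.
\<close>

definition principal_curvatures :: "(real^3) set \<Rightarrow> real^3 \<Rightarrow> real \<Rightarrow> real \<Rightarrow> bool" where
  "principal_curvatures S x k1 k2 \<longleftrightarrow>
     (\<exists>N e1 e2. unit_normal_near S x N \<and> orthonormal_tangent_basis S x e1 e2 \<and>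
        shape_operator N x e1 = k1 *\<^sub>R e1 \<and> shape_operator N x e2 = k2 *\<^sub>R e2)"

datatype point_type = Elliptic | Hyperbolic | Parabolic

definition type_of_point :: "(real^3) set \<Rightarrow> real^3 \<Rightarrow> point_type" where
  "type_of_point S x =
     (if gauss_curvature S x > 0 then Elliptic
      else if gauss_curvature S x < 0 then Hyperbolic
      else Parabolic)"


section \<open>Geodesics and the exponential map\<close>

text \<open>Intended for nondegenerate intervals \<open>I\<close>; derivatives at end points are one-sided.\<close>

definition geodesic_on :: "(real^3) set \<Rightarrow> real set \<Rightarrow> (real \<Rightarrow> real^3) \<Rightarrow> bool" where
  "geodesic_on S I c \<longleftrightarrow>
     c ` I \<subseteq> S \<and>
     (\<exists>c' c''. \<forall>s\<in>I.
        (c has_vector_derivative c' s) (at s within I) \<and>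
        (c' has_vector_derivative c'' s) (at s within I) \<and>
        norm (c' s) = 1 \<and>
        (\<forall>v\<in>tangent_space S (c s). c'' s \<bullet> v = 0))"

definition geodesic_arc :: "(real^3) set \<Rightarrow> (real \<Rightarrow> real^3) \<Rightarrow> real \<Rightarrow> real^3 \<Rightarrow> real^3 \<Rightarrow> bool" where
  "geodesic_arc S c l P Q \<longleftrightarrow> 0 < l \<and> geodesic_on S {0..l} c \<and> c 0 = P \<and> c l = Q"

definition initial_velocity :: "(real \<Rightarrow> real^3) \<Rightarrow> real \<Rightarrow> real^3" where
  "initial_velocity c l = vector_derivative c (at 0 within {0..l})"

text \<open>\<open>exp_rel S x v y\<close>: the exponential map at \<open>x\<close> is defined at \<open>v\<close> with value \<open>y\<close>.\<close>

definition exp_rel :: "(real^3) set \<Rightarrow> real^3 \<Rightarrow> real^3 \<Rightarrow> real^3 \<Rightarrow> bool" where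
  "exp_rel S x v y \<longleftrightarrow>
     (if v = 0 then y = x
      else \<exists>c. geodesic_arc S c (norm v) x y \<and> initial_velocity c (norm v) = v /\<^sub>R norm v)"

definition exp_map :: "(real^3) set \<Rightarrow> real^3 \<Rightarrow> real^3 \<Rightarrow> real^3" where
  "exp_map S x v = (THE y. exp_rel S x v y)"

definition normal_neighborhood_of_all_points :: "(real^3) set \<Rightarrow> (real^3) set \<Rightarrow> real \<Rightarrow> bool" where
  "normal_neighborhood_of_all_points S W \<delta> \<longleftrightarrow>
     openin (top_of_set S) W \<and> 0 < \<delta> \<and>
     (\<forall>x\<in>W.
        (\<forall>v\<in>tangent_space S x \<inter> ball 0 \<delta>. \<exists>y. exp_rel S x v y) \<and>
        diffeomorphic_onto_image (tangent_space S x \<inter> ball 0 \<delta>) (exp_map S x) \<and>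
        W \<subseteq> exp_map S x ` (tangent_space S x \<inter> ball 0 \<delta>))"


section \<open>Segments, angles and small triangles\<close>

text \<open>
  In the following \<open>\<delta>\<close> is the radius of a normal neighborhood containing the points involved, so
  that for distinct points the geodesic of length less than \<open>\<delta>\<close> exists and is unique.
\<close>

definition geo_segment :: "(real^3) set \<Rightarrow> real \<Rightarrow> real^3 \<Rightarrow> real^3 \<Rightarrow> (real^3) set" where
  "geo_segment S \<delta> P Q = \<Union> {c ` {0..l} | c l. geodesic_arc S c l P Q \<and> l < \<delta>}"

definition geo_direction :: "(real^3) set \<Rightarrow> real \<Rightarrow> real^3 \<Rightarrow> real^3 \<Rightarrow> real^3" where
  "geo_direction S \<delta> P Q =
     (THE v. \<exists>c l. geodesic_arc S c l P Q \<and> l < \<delta> \<and> initial_velocity c l = v)"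

definition vec_angle :: "real^3 \<Rightarrow> real^3 \<Rightarrow> real" where
  "vec_angle v w = arccos (v \<bullet> w / (norm v * norm w))"

text \<open>\<open>geo_angle S \<delta> X P Y\<close> is the angle \<open>XPY\<close>, with vertex \<open>P\<close>.\<close>

definition geo_angle :: "(real^3) set \<Rightarrow> real \<Rightarrow> real^3 \<Rightarrow> real^3 \<Rightarrow> real^3 \<Rightarrow> real" where
  "geo_angle S \<delta> X P Y = vec_angle (geo_direction S \<delta> P X) (geo_direction S \<delta> P Y)"

text \<open>
  The closed region bounded by the sides is a closed topological disc \<open>D\<close> whose boundary circle is
  the union of the three sides.
\<close>

definition small_triangle ::
    "(real^3) set \<Rightarrow> (real^3) set \<Rightarrow> real \<Rightarrow> real^3 \<Rightarrow> real^3 \<Rightarrow> real^3 \<Rightarrow> bool" where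
  "small_triangle S W \<delta> V A B \<longleftrightarrow>
     normal_neighborhood_of_all_points S W \<delta> \<and>
     V \<in> W \<and> A \<in> W \<and> B \<in> W \<and> V \<noteq> A \<and> V \<noteq> B \<and> A \<noteq> B \<and>
     span {geo_direction S \<delta> A V, geo_direction S \<delta> A B} = tangent_space S A \<and>
     span {geo_direction S \<delta> B V, geo_direction S \<delta> B A} = tangent_space S B \<and>
     (\<exists>D h g. D \<subseteq> W \<and> homeomorphism (cball (0 :: real^2) 1) D h g \<and>
        h ` sphere 0 1 = geo_segment S \<delta> V A \<union> geo_segment S \<delta> V B \<union> geo_segment S \<delta> A B)"


section \<open>The recursive construction\<close>

text \<open>
  Sequences are indexed from \<open>1\<close>; the values at \<open>0\<close> are irrelevant. That the geodesic from
  \<open>B\<^sub>k\<close> enters the triangle, dividing the angle \<open>V B\<^sub>k A\<^sub>k\<close>, is expressed by the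
  angles it makes with both sides of that angle: \<open>\<beta>\<^sub>k\<close> and \<open>q(B\<^sub>k) \<beta>\<^sub>k\<close>, which add up to it;
  likewise at \<open>A\<^sub>k\<^sub>+\<^sub>1\<close>.
\<close>

definition recursive_construction ::
    "(real^3) set \<Rightarrow> real \<Rightarrow> (real^3 \<Rightarrow> real) \<Rightarrow> (real^3 \<Rightarrow> real) \<Rightarrow> real^3 \<Rightarrow> real^3 \<Rightarrow> real^3 \<Rightarrow>
     (nat \<Rightarrow> real^3) \<Rightarrow> (nat \<Rightarrow> real^3) \<Rightarrow> (nat \<Rightarrow> real) \<Rightarrow> (nat \<Rightarrow> real) \<Rightarrow> bool" where
  "recursive_construction S \<delta> p q V A B As Bs \<alpha> \<beta> \<longleftrightarrow>
     As 1 = A \<and> Bs 1 = B \<and> \<alpha> 1 = geo_angle S \<delta> V (As 1) (Bs 1) \<and>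
     (\<forall>k\<ge>1.
        \<beta> k = geo_angle S \<delta> V (Bs k) (As k) / (1 + q (Bs k)) \<and>
        As (k+1) \<in> geo_segment S \<delta> V (As k) \<and>
        geo_angle S \<delta> V (Bs k) (As (k+1)) = \<beta> k \<and>
        geo_angle S \<delta> (As (k+1)) (Bs k) (As k) = q (Bs k) * \<beta> k \<and>
        \<alpha> (k+1) = geo_angle S \<delta> V (As (k+1)) (Bs k) / (1 + p (As (k+1))) \<and>
        Bs (k+1) \<in> geo_segment S \<delta> V (Bs k) \<and>
        geo_angle S \<delta> V (As (k+1)) (Bs (k+1)) = \<alpha> (k+1) \<and>
        geo_angle S \<delta> (Bs (k+1)) (As (k+1)) (Bs k) = p (As (k+1)) * \<alpha> (k+1))"

end

theory Submission
  imports Defs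
begin

text \<open>
  The geodesic from \<open>P\<close> to \<open>Q\<close> has bounded acceleration, so as \<open>P\<close> and \<open>Q\<close> tend to \<open>V\<close> its initial
  direction approaches that of the chord \<open>Q - P\<close> in space; hence the angle sums of triangles shrinking
  to \<open>V\<close> tend to \<open>\<pi>\<close>, and no Gauss-Bonnet theorem is needed. The points \<open>A\<^sub>k\<close>, \<open>B\<^sub>k\<close> tend to \<open>V\<close>, so the
  limits \<open>l\<close> of \<open>\<alpha>\<close> and \<open>m\<close> of \<open>\<beta>\<close> satisfy \<open>(1 + p(V)) l + m = \<pi> - \<mu> = l + (1 + q(V)) m\<close>. They determine
  \<open>p(V)\<close> and \<open>q(V)\<close>, where \<open>p = q = 1\<close>, \<open>p = q > 1\<close> or \<open>p < q\<close> according to whether \<open>V\<close> is parabolic,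
  elliptic or hyperbolic.
\<close>

section \<open>Smooth maps\<close>

text \<open>Two obstacles shape the proof. A normal neighborhood provides one diffeomorphism for
  each base point, with no relation between different base points, while the angles of the
  construction have moving vertices. Joint continuity of short geodesics in both end points
  therefore has to be extracted from the geodesic equation, read as a differential equation in
  space, by a Gronwall estimate and compactness. Moreover \<open>k1\<close> and \<open>k2\<close>
  are chosen at each point separately, so neither need be continuous; only expressions insensitive
  to their order and common sign are, and \<open>p\<close> and \<open>q\<close> are of this kind.

  The weights make the defect in the triangle inequality for \<open>k1\<close> and \<open>k2\<close>
  visible: it is strict exactly where \<open>K < 0\<close>, and the factor \<open>K\<close> makes
  both weights 1 exactly where \<open>K = 0\<close>. As they are at least 1, a divided angle is at
  most half of the undivided one. This drives the points to the vertex, and it also makes the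
  recursion for the angles a contraction up to vanishing errors, so that the limits exist.\<close>

lemma smooth_on_differentiable: "smooth_on U f \<Longrightarrow> x \<in> U \<Longrightarrow> f differentiable (at x)"
  unfolding smooth_on_def using Ck_on.simps(2) by blast

lemma smooth_on_has_derivative:
  "smooth_on U f \<Longrightarrow> x \<in> U \<Longrightarrow> (f has_derivative frechet_derivative f (at x)) (at x)"
  using smooth_on_differentiable frechet_derivative_works by blast

lemma smooth_on_linear:
  "smooth_on U f \<Longrightarrow> x \<in> U \<Longrightarrow> linear (frechet_derivative f (at x))"
  using smooth_on_has_derivative has_derivative_linear by blast

lemma smooth_on_continuous: "smooth_on U f \<Longrightarrow> continuous_on U f"
  unfolding smooth_on_def using Ck_on.simps(1) by blast

lemma smooth_on_frechet: "smooth_on U f \<Longrightarrow> smooth_on U (\<lambda>x. frechet_derivative f (at x) v)"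
  unfolding smooth_on_def using Ck_on.simps(2) by blast

text \<open>\<open>Ck_on\<close> speaks of derivatives \<open>at x\<close>, not within
  \<open>U\<close>; openness of \<open>U\<close> is what makes it depend only on the values on
  \<open>U\<close>.\<close>

lemma Ck_on_cong:
  assumes "open U" "Ck_on k U f" "\<And>x. x \<in> U \<Longrightarrow> f x = g x"
  shows "Ck_on k U g"
  using assms(2,3)
proof (induction k arbitrary: f g)
  case 0
  then show ?case by (auto cong: continuous_on_cong)
next
  case (Suc k)
  have D: "frechet_derivative f (at x) = frechet_derivative g (at x) \<and> g differentiable (at x)"
    if "x \<in> U" for x
  proof -
    have 1: "(f has_derivative frechet_derivative f (at x)) (at x)"
      using Suc.prems(1) that frechet_derivative_works by auto
    have "(g has_derivative frechet_derivative f (at x)) (at x)"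
      by (rule has_derivative_transform_within_open[OF 1 \<open>open U\<close> that]) (use Suc.prems in auto)
    then show ?thesis
      using frechet_derivative_at differentiable_def by blast
  qed
  have "Ck_on k U (\<lambda>x. frechet_derivative g (at x) v)" for v
    by (rule Suc.IH[of "\<lambda>x. frechet_derivative f (at x) v"]) (use Suc.prems D in auto)
  then show ?case using D by simp
qed

text \<open>Charts restricted to lines yield the smooth curves that \<open>tangent_space\<close>
  asks for. The induction closes because the derivative along a fixed line is again a function on
  \<open>U\<close>, a directional derivative, composed with the same line.\<close>

lemma Ck_on_line:
  fixes \<phi> :: "'a::euclidean_space \<Rightarrow> 'b::euclidean_space"
  assumes "open I" "Ck_on k U \<phi>" "\<And>t. t \<in> I \<Longrightarrow> u + t *\<^sub>R w \<in> U"
  shows "Ck_on k I (\<lambda>t::real. \<phi> (u + t *\<^sub>R w))"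
  using assms(2)
proof (induction k arbitrary: \<phi>)
  case 0
  have "(\<lambda>t. u + t *\<^sub>R w) ` I \<subseteq> U" using assms(3) by auto
  then show ?case using 0
    by (auto intro!: continuous_on_compose2[of U \<phi>] continuous_intros)
next
  case (Suc k)
  have D: "((\<lambda>t. \<phi> (u + t *\<^sub>R w)) has_derivative (\<lambda>s. frechet_derivative \<phi> (at (u + t *\<^sub>R w)) (s *\<^sub>R w))) (at t)"
    if "t \<in> I" for t
  proof -
    have "(\<phi> has_derivative frechet_derivative \<phi> (at (u + t *\<^sub>R w))) (at (u + t *\<^sub>R w))"
      using Suc.prems assms(3)[OF that] frechet_derivative_works by auto
    then show ?thesis
      by (auto intro!: derivative_eq_intros has_derivative_compose[of "\<lambda>t. u + t *\<^sub>R w" _ _ _ \<phi>])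
  qed
  have "Ck_on k I (\<lambda>t. frechet_derivative (\<lambda>t. \<phi> (u + t *\<^sub>R w)) (at t) s)" for s
  proof (rule Ck_on_cong[OF assms(1)])
    show "Ck_on k I (\<lambda>t. frechet_derivative \<phi> (at (u + t *\<^sub>R w)) (s *\<^sub>R w))"
      by (rule Suc.IH[of "\<lambda>x. frechet_derivative \<phi> (at x) (s *\<^sub>R w)"]) (use Suc.prems in simp)
    show "frechet_derivative \<phi> (at (u + x *\<^sub>R w)) (s *\<^sub>R w)
        = frechet_derivative (\<lambda>t. \<phi> (u + t *\<^sub>R w)) (at x) s" if "x \<in> I" for x
      using frechet_derivative_at[OF D[OF that]] by metis
  qed
  then show ?case using D differentiable_def by (metis Ck_on.simps(2))
qed

lemma smooth_map_on_continuous: "smooth_map_on X f \<Longrightarrow> continuous_on X f"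
proof -
  assume *: "smooth_map_on X f"
  show "continuous_on X f"
  proof (clarsimp simp: continuous_on_eq_continuous_within)
    fix x assume "x \<in> X"
    then obtain U F where U: "open U" "x \<in> U" "smooth_on U F" "\<forall>y\<in>X \<inter> U. F y = f y"
      using * unfolding smooth_map_on_def by blast
    then have "continuous (at x) F"
      using smooth_on_continuous continuous_on_eq_continuous_at by blast
    then have "continuous (at x within X) F"
      using continuous_at_imp_continuous_at_within by blast
    moreover have "\<forall>\<^sub>F y in at x within X. F y = f y"
      unfolding eventually_at_topological using U by blast
    ultimately show "continuous (at x within X) f"
      using U(2,4) \<open>x \<in> X\<close> by (auto simp: continuous_within intro: Lim_transform_eventually)
  qed
qed

text \<open>\<open>Ck_on\<close> yields continuity of the derivative one direction at a time.
  Bounding it on each basis vector over the compact ball bounds its operator norm by the sum, and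
  convexity of the ball turns this into a Lipschitz constant.\<close>

lemma smooth_on_local_bound:
  fixes f :: "'a::euclidean_space \<Rightarrow> 'b::euclidean_space"
  assumes "open U" "smooth_on U f" "cball x r \<subseteq> U"
  obtains L where "L \<ge> 0" "\<And>y. y \<in> cball x r \<Longrightarrow> norm (f y) \<le> L"
    "\<And>y z. y \<in> cball x r \<Longrightarrow> z \<in> cball x r \<Longrightarrow> norm (f y - f z) \<le> L * norm (y - z)"
proof -
  have bd: "\<exists>B. B \<ge> 0 \<and> (\<forall>y\<in>cball x r. norm (g y) \<le> B)" if "continuous_on U g" for g :: "'a \<Rightarrow> 'b"
  proof -
    have "compact (g ` cball x r)"
      using that assms(3) compact_continuous_image continuous_on_subset compact_cball by metis
    then obtain B where "B > 0" "\<forall>z\<in>g ` cball x r. norm z \<le> B"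
      using compact_imp_bounded bounded_pos by metis
    then show ?thesis by (intro exI[of _ B]) auto
  qed
  have "\<exists>B. B \<ge> 0 \<and> (\<forall>y\<in>cball x r. norm (frechet_derivative f (at y) b) \<le> B)" for b
    by (intro bd smooth_on_continuous smooth_on_frechet assms)
  then obtain B where B: "\<And>b. B b \<ge> 0" "\<And>b y. y \<in> cball x r \<Longrightarrow> norm (frechet_derivative f (at y) b) \<le> B b"
    by metis
  obtain B0 where B0: "B0 \<ge> 0" "\<And>y. y \<in> cball x r \<Longrightarrow> norm (f y) \<le> B0"
    using bd[OF smooth_on_continuous[OF assms(2)]] by auto
  define L where "L = B0 + sum B Basis"
  have L1: "sum B Basis \<ge> 0" using B by (simp add: sum_nonneg)
  have "norm (f y - f z) \<le> sum B Basis * norm (y - z)" if "y \<in> cball x r" "z \<in> cball x r" for y z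
  proof (rule differentiable_bound[of "cball x r" f "\<lambda>y. frechet_derivative f (at y)"])
    fix w assume w: "w \<in> cball x r"
    then have lin: "linear (frechet_derivative f (at w))" and
      hd: "(f has_derivative frechet_derivative f (at w)) (at w)"
      using assms smooth_on_linear smooth_on_has_derivative by blast+
    show "(f has_derivative frechet_derivative f (at w)) (at w within cball x r)"
      using hd has_derivative_at_withinI by blast
    show "onorm (frechet_derivative f (at w)) \<le> sum B Basis"
    proof (rule onorm_le)
      fix h
      have "frechet_derivative f (at w) h = (\<Sum>b\<in>Basis. (h \<bullet> b) *\<^sub>R frechet_derivative f (at w) b)"
        by (subst euclidean_representation[symmetric, of h])
           (simp add: linear_sum[OF lin] linear_cmul[OF lin])
      also have "norm \<dots> \<le> (\<Sum>b\<in>Basis. norm ((h \<bullet> b) *\<^sub>R frechet_derivative f (at w) b))"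
        by (rule norm_sum)
      also have "\<dots> \<le> (\<Sum>b\<in>Basis. norm h * B b)"
        by (intro sum_mono) (auto intro!: mult_mono simp: Basis_le_norm B(2)[OF w])
      finally show "norm (frechet_derivative f (at w) h) \<le> sum B Basis * norm h"
        by (simp add: sum_distrib_left mult.commute)
    qed
  qed (use that in auto)
  moreover have "sum B Basis * norm (y - z) \<le> L * norm (y - z)" for y z :: 'a
    unfolding L_def using B0(1) by (intro mult_right_mono) auto
  ultimately show ?thesis
    using that[of L] L1 B0 unfolding L_def by (smt (verit))
qed

section \<open>Tangent planes\<close>

text \<open>Normals are assumed instead of being built from charts: a witness for
  \<open>principal_curvatures\<close> at a point contains one.\<close>

locale surface_with_normals =
  fixes S :: "(real^3) set"
  assumes regular: "regular_surface S"
    and unit_normal_exists: "x \<in> S \<Longrightarrow> \<exists>N. unit_normal_near S x N"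

text \<open>
  The inverse of a chart is only known to be continuous; injectivity of the derivative of the chart
  makes it Lipschitz at the point, which is enough.
\<close>

lemma velocity_in_range_of_chart:
  fixes \<phi> :: "real^2 \<Rightarrow> real^3" and c :: "real \<Rightarrow> real^3"
  assumes hom: "homeomorphism U (S \<inter> O') \<phi> \<psi>" and O': "open O'" "c t \<in> O'"
    and der: "(\<phi> has_derivative L) (at (\<psi> (c t)))" and inj: "inj L"
    and c: "c ` I \<subseteq> S" "t \<in> I" "at t within I \<noteq> bot" "(c has_vector_derivative v) (at t within I)"
  shows "v \<in> range L"
proof -
  have lin: "linear L" using der has_derivative_linear by blast
  obtain m where m: "m > 0" "\<And>h. m * norm h \<le> norm (L h)"
    using linear_inj_bounded_below_pos[OF lin inj] by (metis mult.commute)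
  define f where "f s = \<psi> (c s)" for s
  have cont: "(c \<longlongrightarrow> c t) (at t within I)"
    using c(4) has_vector_derivative_continuous continuous_within by blast
  have ev: "\<forall>\<^sub>F s in at t within I. c s \<in> S \<inter> O'"
    using topological_tendstoD[OF cont O'] eventually_at_topological c(1)
    by (auto simp: eventually_at_filter elim!: eventually_mono)
  have flim: "(f \<longlongrightarrow> f t) (at t within I)"
    unfolding f_def using hom c(1,2) O' ev cont
    by (intro continuous_on_tendsto_compose[of "S \<inter> O'" \<psi>]) (auto simp: homeomorphism_def)
  have chart_back: "\<phi> (f s) = c s" if "c s \<in> S \<inter> O'" for s
    using that hom unfolding f_def homeomorphism_def by auto
  have ct: "c t \<in> S \<inter> O'" using c(1,2) O' by auto
  \<comment> \<open>The coordinate curve \<open>f\<close> is not claimed to be differentiable: only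
    the images under \<open>L\<close> of its difference quotients are shown to come close to
    \<open>v\<close>. The range of \<open>L\<close>, a finite-dimensional subspace, is
    closed.\<close>
  have "v \<in> closure (range L)"
    unfolding closure_approachable
  proof (intro allI impI)
    fix e :: real assume "e > 0"
    \<comment> \<open>The bound \<open>m / 2\<close> lets the remainder of the chart be absorbed
      into \<open>m * norm (f s - f t)\<close>, which makes \<open>f\<close> Lipschitz at
      \<open>t\<close>; the other bounds then keep each of the two remainders below
      \<open>e / 4 * norm (s - t)\<close>.\<close>
    define n1 where "n1 = min (m / 2) (e / 4 * (m / (2 * (norm v + 1))))"
    define n2 where "n2 = min 1 (e/4)"
    have np: "norm v + 1 > 0" by (smt (verit) norm_ge_zero)
    have n12: "n1 > 0" "n2 > 0"
      using m \<open>e > 0\<close> np by (auto simp: n1_def n2_def)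
    have n12': "n1 \<le> m / 2" "n2 \<le> 1" "n2 \<le> e / 4"
      unfolding n1_def n2_def by (rule min.cobounded1 min.cobounded2)+
    have n1b: "n1 * (2 / m * (norm v + 1)) \<le> e / 4"
    proof -
      have "n1 * (2 / m * (norm v + 1)) \<le> (e / 4 * (m / (2 * (norm v + 1)))) * (2 / m * (norm v + 1))"
        by (rule mult_right_mono) (use m np in \<open>auto simp: n1_def\<close>)
      also have "\<dots> = e / 4"
      proof -
        have "e / 4 * (m / (2 * K)) * (2 / m * K) = e / 4" if "K > 0" for K
          using that m by simp
        then show ?thesis using np .
      qed
      finally show ?thesis .
    qed
    obtain d1 where d1: "d1 > 0"
      "\<And>u. norm (u - f t) < d1 \<Longrightarrow> norm (\<phi> u - \<phi> (f t) - L (u - f t)) \<le> n1 * norm (u - f t)"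
      using der n12 unfolding has_derivative_at_alt f_def by metis
    obtain d2 where d2: "d2 > 0" "\<And>s. s \<in> I \<Longrightarrow> norm (s - t) < d2 \<Longrightarrow>
        norm (c s - c t - (s - t) *\<^sub>R v) \<le> n2 * norm (s - t)"
      using c(4) n12 unfolding has_vector_derivative_def has_derivative_within_alt by metis
    have "\<forall>\<^sub>F s in at t within I. s \<in> I \<and> s \<noteq> t \<and> dist s t < d2 \<and> dist (f s) (f t) < d1 \<and> c s \<in> S \<inter> O'"
    proof -
      have "\<forall>\<^sub>F s in at t within I. s \<in> I \<and> s \<noteq> t" by (simp add: eventually_at_filter)
      moreover have "\<forall>\<^sub>F s in at t within I. dist s t < d2" by (rule tendstoD[OF tendsto_ident_at d2(1)])
      ultimately show ?thesis using ev tendstoD[OF flim d1(1)] by eventually_elim simp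
    qed
    from eventually_happens'[OF c(3) this] obtain s where s: "s \<in> I" "s \<noteq> t" "norm (s - t) < d2" "norm (f s - f t) < d1" "c s \<in> S \<inter> O'"
      by (auto simp: dist_norm)
    have b1: "norm (c s - c t - L (f s - f t)) \<le> n1 * norm (f s - f t)"
      using d1(2)[OF s(4)] chart_back[OF s(5)] chart_back[OF ct] by simp
    have b2: "norm (c s - c t - (s - t) *\<^sub>R v) \<le> n2 * norm (s - t)" by (rule d2) (use s in auto)
    have "norm (c s - c t) \<le> norm ((s - t) *\<^sub>R v) + n2 * norm (s - t)"
      using b2 norm_triangle_ineq2[of "c s - c t" "(s - t) *\<^sub>R v"] by linarith
    also have "\<dots> \<le> norm (s - t) * norm v + 1 * norm (s - t)"
      using n12 n12' by (intro add_mono mult_right_mono) auto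
    finally have b3: "norm (c s - c t) \<le> (norm v + 1) * norm (s - t)" by (simp add: algebra_simps)
    have "m * norm (f s - f t) \<le> norm (c s - c t) + n1 * norm (f s - f t)"
      using m(2)[of "f s - f t"] b1 norm_triangle_ineq2[of "L (f s - f t)" "c s - c t"]
      by (smt (verit) norm_minus_commute)
    also have "\<dots> \<le> norm (c s - c t) + m / 2 * norm (f s - f t)"
      using n12 n12' by (intro add_mono mult_right_mono) auto
    finally have "norm (f s - f t) \<le> 2 / m * norm (c s - c t)"
      using m(1) by (simp add: field_simps)
    also have "\<dots> \<le> 2 / m * ((norm v + 1) * norm (s - t))"
      using b3 m(1) by (intro mult_left_mono) auto
    finally have "n1 * norm (f s - f t) \<le> n1 * (2 / m * ((norm v + 1) * norm (s - t)))"
      using n12 n12' by (intro mult_left_mono) auto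
    also have "\<dots> = n1 * (2 / m * (norm v + 1)) * norm (s - t)" by simp
    also have "\<dots> \<le> e / 4 * norm (s - t)" using n1b by (intro mult_right_mono) auto
    finally have b4: "n1 * norm (f s - f t) \<le> e / 4 * norm (s - t)" .
    have b5: "n2 * norm (s - t) \<le> e / 4 * norm (s - t)" using n12 n12' by (intro mult_right_mono) auto
    have "norm (L (f s - f t) - (s - t) *\<^sub>R v) \<le> e / 2 * norm (s - t)"
      using b1 b2 b4 b5 norm_triangle_ineq4[of "c s - c t - (s - t) *\<^sub>R v" "c s - c t - L (f s - f t)"]
      by (simp add: algebra_simps)
    moreover have "L (f s - f t) - (s - t) *\<^sub>R v = (s - t) *\<^sub>R (L ((1 / (s - t)) *\<^sub>R (f s - f t)) - v)"
    proof -
      have "(s - t) *\<^sub>R L ((1 / (s - t)) *\<^sub>R h) = L h" for h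
        using s(2) by (simp add: linear_cmul[OF lin])
      then show ?thesis by (simp only: scaleR_diff_right[of _ "L _"])
    qed
    ultimately have "\<bar>s - t\<bar> * norm (L ((1 / (s - t)) *\<^sub>R (f s - f t)) - v) \<le> \<bar>s - t\<bar> * (e / 2)"
      by (simp only: norm_scaleR real_norm_def mult.commute[of "e / 2"])
    then have "norm (L ((1 / (s - t)) *\<^sub>R (f s - f t)) - v) \<le> e / 2"
      by (rule mult_left_le_imp_le) (use s(2) in simp)
    then show "\<exists>y\<in>range L. dist y v < e"
      using \<open>e > 0\<close> by (intro bexI[of _ "L ((1 / (s - t)) *\<^sub>R (f s - f t))"]) (auto simp: dist_norm)
  qed
  moreover have "closed (range L)"
    by (intro closed_subspace linear_subspace_image lin subspace_UNIV)
  ultimately show ?thesis by (metis closure_closed)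
qed

context surface_with_normals
begin

text \<open>All that is used of a chart is its derivative \<open>L\<close> at one point. The range
  consists of velocities of smooth curves, and it captures every velocity, including one-sided
  velocities of curves that are merely differentiable.\<close>

lemma chart_at:
  assumes "x \<in> S"
  obtains L :: "real^2 \<Rightarrow> real^3" where "linear L" "inj L" "range L \<subseteq> tangent_space S x"
    "\<And>(c :: real \<Rightarrow> real^3) I t v. c ` I \<subseteq> S \<Longrightarrow> t \<in> I \<Longrightarrow> c t = x \<Longrightarrow> at t within I \<noteq> bot \<Longrightarrow>
      (c has_vector_derivative v) (at t within I) \<Longrightarrow> v \<in> range L"
proof -
  obtain O' and U :: "(real^2) set" and \<phi> \<psi> where ch: "open O'" "x \<in> O'" "open U" "smooth_on U \<phi>"
    "homeomorphism U (S \<inter> O') \<phi> \<psi>" "\<And>u. u \<in> U \<Longrightarrow> inj (frechet_derivative \<phi> (at u))"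
    using regular[unfolded regular_surface_def, rule_format, OF assms]
    by (elim exE conjE) (rule that, assumption+, erule bspec, assumption)
  define u where "u = \<psi> x"
  have u: "u \<in> U" "\<phi> u = x"
    using ch(2,5) assms unfolding u_def homeomorphism_def by auto
  define L where "L = frechet_derivative \<phi> (at u)"
  have der: "(\<phi> has_derivative L) (at u)"
    unfolding L_def using smooth_on_has_derivative ch(4) u by blast
  have "L w \<in> tangent_space S x" for w
  proof -
    have "open ((\<lambda>t::real. u + t *\<^sub>R w) -` U)"
      by (rule open_vimage[OF ch(3)]) (intro continuous_intros)
    moreover have "(0::real) \<in> (\<lambda>t. u + t *\<^sub>R w) -` U" using u by simp
    ultimately obtain e where e: "e > 0" "cball 0 e \<subseteq> (\<lambda>t::real. u + t *\<^sub>R w) -` U"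
      using open_contains_cball by blast
    have I: "u + t *\<^sub>R w \<in> U" if "t \<in> {-e<..<e}" for t
      using e(2) that by (auto simp: dist_real_def subset_iff)
    define \<gamma> where "\<gamma> t = \<phi> (u + t *\<^sub>R w)" for t :: real
    have "smooth_on {-e<..<e} \<gamma>"
      using ch(4) I unfolding smooth_on_def \<gamma>_def by (auto intro!: Ck_on_line[of _ _ U])
    moreover have "\<gamma> ` {-e<..<e} \<subseteq> S"
      using I ch(5) unfolding \<gamma>_def homeomorphism_def by auto
    moreover have "(\<gamma> has_vector_derivative L w) (at 0)"
    proof -
      have "((\<lambda>t::real. u + t *\<^sub>R w) has_derivative (\<lambda>t. t *\<^sub>R w)) (at 0)"
        by (auto intro!: derivative_eq_intros)
      then have "(\<gamma> has_derivative (\<lambda>t. L (t *\<^sub>R w))) (at 0)"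
        unfolding \<gamma>_def by (rule has_derivative_compose) (use der in simp)
      then show ?thesis
        unfolding has_vector_derivative_def
        using linear_cmul[OF has_derivative_linear[OF der]] by simp
    qed
    ultimately show ?thesis
      unfolding tangent_space_def using e(1) u(2) \<gamma>_def by force
  qed
  moreover have "v \<in> range L" if "c ` I \<subseteq> S" "t \<in> I" "c t = x" "at t within I \<noteq> bot"
    "(c has_vector_derivative v) (at t within I)" for c :: "real \<Rightarrow> real^3" and I t v
    by (rule velocity_in_range_of_chart[OF ch(5,1), of c t L I])
       (use that ch(2,6) der u in \<open>auto simp: u_def L_def\<close>)
  ultimately show ?thesis
    using that[of L] has_derivative_linear[OF der] ch(6)[OF u(1)] unfolding L_def by blast
qed

text \<open>The tangent space lies between the range of \<open>L\<close> and the orthogonal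
  complement of the normal, and both of these are planes.\<close>

lemma range_chart_eq_tangent_space:
  fixes L :: "real^2 \<Rightarrow> real^3"
  assumes "x \<in> S" "unit_normal_near S x N" "linear L" "inj L" "range L \<subseteq> tangent_space S x"
  shows "range L = {v. N x \<bullet> v = 0}" "tangent_space S x = {v. N x \<bullet> v = 0}"
proof -
  have N: "norm (N x) = 1" "\<And>v. v \<in> tangent_space S x \<Longrightarrow> N x \<bullet> v = 0"
    using assms(1,2) unfolding unit_normal_near_def by auto
  have "dim (range L) = 2"
    using dim_image_eq[OF assms(3), of UNIV] assms(4) by simp
  moreover have "dim {v. N x \<bullet> v = 0} = 2"
    using dim_hyperplane[of "N x"] N(1) by fastforce
  ultimately show *: "range L = {v. N x \<bullet> v = 0}"
    using subspace_dim_equal[of "range L" "{v. N x \<bullet> v = 0}"] assms(3,5) N(2)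
    by (auto simp: linear_subspace_image subspace_hyperplane)
  then show "tangent_space S x = {v. N x \<bullet> v = 0}" using assms(5) N(2) by blast
qed

lemma tangent_space_eq:
  assumes "x \<in> S" "unit_normal_near S x N"
  shows "tangent_space S x = {v. N x \<bullet> v = 0}"
  by (rule chart_at[OF assms(1)], rule range_chart_eq_tangent_space(2)[OF assms])

text \<open>Geodesics are only assumed twice differentiable, one-sidedly at end points, whereas
  \<open>tangent_space\<close> requires smooth curves on an open interval. The chart bridges the
  two.\<close>

lemma velocity_tangent:
  fixes c :: "real \<Rightarrow> real^3"
  assumes "c ` I \<subseteq> S" "t \<in> I" "at t within I \<noteq> bot" "(c has_vector_derivative v) (at t within I)"
  shows "v \<in> tangent_space S (c t)"
proof -
  have "c t \<in> S" using assms by auto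
  then show ?thesis by (rule chart_at) (use assms in blast)
qed

lemma tangent_space_scaleR: "x \<in> S \<Longrightarrow> v \<in> tangent_space S x \<Longrightarrow> a *\<^sub>R v \<in> tangent_space S x"
  using unit_normal_exists tangent_space_eq by fastforce

lemma dim_tangent_space: "x \<in> S \<Longrightarrow> dim (tangent_space S x) = 2"
proof -
  assume x: "x \<in> S"
  then obtain N where N: "unit_normal_near S x N" using unit_normal_exists by blast
  then have "norm (N x) = 1" using x unfolding unit_normal_near_def by auto
  then show ?thesis using dim_hyperplane[of "N x"] tangent_space_eq[OF x N] by fastforce
qed

end

section \<open>The geodesic equation\<close>

text \<open>The velocity is an explicit argument because position and velocity together form the
  state of the differential equation.\<close>

definition unit_geodesic :: "(real^3) set \<Rightarrow> real set \<Rightarrow> (real \<Rightarrow> real^3) \<Rightarrow> (real \<Rightarrow> real^3) \<Rightarrow> bool" where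
  "unit_geodesic S I c c' \<longleftrightarrow> c ` I \<subseteq> S \<and> (\<exists>c''. \<forall>s\<in>I.
        (c has_vector_derivative c' s) (at s within I) \<and>
        (c' has_vector_derivative c'' s) (at s within I) \<and>
        norm (c' s) = 1 \<and>
        (\<forall>v\<in>tangent_space S (c s). c'' s \<bullet> v = 0))"

lemma geodesic_on_iff: "geodesic_on S I c \<longleftrightarrow> (\<exists>c'. unit_geodesic S I c c')"
  unfolding geodesic_on_def unit_geodesic_def by blast

lemma unit_geodesicD:
  assumes "unit_geodesic S I c c'" "s \<in> I"
  shows "c s \<in> S" "(c has_vector_derivative c' s) (at s within I)" "norm (c' s) = 1"
  using assms unfolding unit_geodesic_def by auto

lemma unit_geodesic_subset: "unit_geodesic S I c c' \<Longrightarrow> J \<subseteq> I \<Longrightarrow> unit_geodesic S J c c'"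
  unfolding unit_geodesic_def
  by (meson has_vector_derivative_within_subset image_mono subset_iff order_trans)

section \<open>Calculus on closed intervals and local bounds for derivatives\<close>

lemma at_within_Icc_nontrivial: "a < b \<Longrightarrow> s \<in> {a..b} \<Longrightarrow> at s within {a..b::real} \<noteq> bot"
  by (simp add: trivial_limit_within islimpt_Icc)

lemma has_vector_derivative_bound:
  fixes f :: "real \<Rightarrow> 'a::real_normed_vector"
  assumes "\<And>u. u \<in> {a..b} \<Longrightarrow> (f has_vector_derivative f' u) (at u within {a..b})"
    "\<And>u. u \<in> {a..b} \<Longrightarrow> norm (f' u) \<le> B" "s \<in> {a..b}" "t \<in> {a..b}"
  shows "norm (f t - f s) \<le> B * \<bar>t - s\<bar>"
proof -
  have "norm (f t - f s) \<le> B * norm (t - s)"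
  proof (rule differentiable_bound[of "{a..b}" f "\<lambda>u h. h *\<^sub>R f' u"])
    show "onorm (\<lambda>h. h *\<^sub>R f' u) \<le> B" if "u \<in> {a..b}" for u
      by (rule onorm_le) (use assms(2)[OF that] in \<open>simp add: mult.commute[of B] mult_left_mono\<close>)
  qed (use assms in \<open>auto simp: has_vector_derivative_def\<close>)
  then show ?thesis by simp
qed

lemma unit_geodesic_dist_le:
  assumes "unit_geodesic S {a..b} c c'" "s \<in> {a..b}" "t \<in> {a..b}"
  shows "norm (c t - c s) \<le> \<bar>t - s\<bar>"
  using has_vector_derivative_bound[of a b c c' 1 s t] assms unit_geodesicD[OF assms(1)] by simp

lemma has_real_derivative_nonneg_mono:
  fixes f :: "real \<Rightarrow> real"
  assumes "\<And>u. u \<in> {a..b} \<Longrightarrow> (f has_real_derivative f' u) (at u within {a..b})"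
    "\<And>u. u \<in> {a..b} \<Longrightarrow> 0 \<le> f' u" "s \<in> {a..b}" "t \<in> {a..b}" "s \<le> t"
  shows "f s \<le> f t"
proof (rule DERIV_nonneg_imp_increasing_open[OF assms(5)])
  have "continuous_on {a..b} f" using assms(1) DERIV_continuous_on by blast
  then show "continuous_on {s..t} f" by (rule continuous_on_subset) (use assms in auto)
  show "\<exists>y. (f has_real_derivative y) (at w) \<and> 0 \<le> y" if "s < w" "w < t" for w
    using assms(1,2)[of w] that assms(3,4) by (auto simp: at_within_Icc_at)
qed

text \<open>Multiplied by a suitable exponential, \<open>E\<close> becomes monotone. Both time
  directions are required: the connectedness argument for continuous dependence transfers
  convergence between any two nearby times.\<close>

lemma gronwall_two_sided:
  fixes E :: "real \<Rightarrow> real"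
  assumes der: "\<And>u. u \<in> {a..b} \<Longrightarrow> (E has_real_derivative E' u) (at u within {a..b})"
    and bd: "\<And>u. u \<in> {a..b} \<Longrightarrow> \<bar>E' u\<bar> \<le> M * E u"
    and st: "s \<in> {a..b}" "t \<in> {a..b}"
  shows "E t \<le> exp (M * \<bar>t - s\<bar>) * E s"
proof (cases "s \<le> t")
  case True
  have "- (exp (- M * s) * E s) \<le> - (exp (- M * t) * E t)"
  proof (rule has_real_derivative_nonneg_mono[OF _ _ st True])
    show "((\<lambda>u. - (exp (- M * u) * E u)) has_real_derivative exp (- M * u) * (M * E u - E' u))
        (at u within {a..b})" if "u \<in> {a..b}" for u
      by (rule derivative_eq_intros der[OF that] refl)+ (simp add: algebra_simps)
    show "0 \<le> exp (- M * u) * (M * E u - E' u)" if "u \<in> {a..b}" for u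
      using bd[OF that] by (simp add: abs_le_iff)
  qed
  then have "exp (M * t) * (exp (- M * t) * E t) \<le> exp (M * t) * (exp (- M * s) * E s)"
    by (intro mult_left_mono) auto
  moreover have "exp (M * t) * exp (- M * t) = 1" "exp (M * t) * exp (- M * s) = exp (M * \<bar>t - s\<bar>)"
    using True by (simp_all add: exp_minus right_diff_distrib exp_diff divide_inverse)
  ultimately show ?thesis by (simp only: mult.assoc[symmetric] mult_1)
next
  case False
  have "exp (M * t) * E t \<le> exp (M * s) * E s"
  proof (rule has_real_derivative_nonneg_mono[OF _ _ st(2,1)])
    show "((\<lambda>u. exp (M * u) * E u) has_real_derivative exp (M * u) * (M * E u + E' u))
        (at u within {a..b})" if "u \<in> {a..b}" for u
      by (rule derivative_eq_intros der[OF that] refl)+ (simp add: algebra_simps)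
    show "0 \<le> exp (M * u) * (M * E u + E' u)" if "u \<in> {a..b}" for u
      using bd[OF that] by (simp add: abs_le_iff)
  qed (use False in simp)
  then have "exp (- M * t) * (exp (M * t) * E t) \<le> exp (- M * t) * (exp (M * s) * E s)"
    by (intro mult_left_mono) auto
  moreover have "exp (- M * t) * exp (M * t) = 1" "exp (- M * t) * exp (M * s) = exp (M * \<bar>t - s\<bar>)"
    using False by (simp_all add: exp_minus right_diff_distrib exp_diff divide_inverse)
  ultimately show ?thesis by (simp only: mult.assoc[symmetric] mult_1)
qed

lemma smooth_on_local_derivative_bound:
  fixes f :: "'a::euclidean_space \<Rightarrow> 'b::euclidean_space"
  assumes "open U" "smooth_on U f" "cball x r \<subseteq> U"
  obtains L where "L \<ge> 0"
    "\<And>y v. y \<in> cball x r \<Longrightarrow> norm (frechet_derivative f (at y) v) \<le> L * norm v"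
    "\<And>y z v. y \<in> cball x r \<Longrightarrow> z \<in> cball x r \<Longrightarrow>
      norm (frechet_derivative f (at y) v - frechet_derivative f (at z) v) \<le> L * norm (y - z) * norm v"
proof -
  let ?D = "\<lambda>y. frechet_derivative f (at y)"
  have "\<exists>L. L \<ge> 0 \<and> (\<forall>y\<in>cball x r. norm (?D y b) \<le> L) \<and>
    (\<forall>y\<in>cball x r. \<forall>z\<in>cball x r. norm (?D y b - ?D z b) \<le> L * norm (y - z))" for b
    by (rule smooth_on_local_bound[OF assms(1) smooth_on_frechet[OF assms(2), of b] assms(3)]) blast
  then obtain B where B: "\<And>b. B b \<ge> 0" "\<And>b y. y \<in> cball x r \<Longrightarrow> norm (?D y b) \<le> B b"
    "\<And>b y z. y \<in> cball x r \<Longrightarrow> z \<in> cball x r \<Longrightarrow> norm (?D y b - ?D z b) \<le> B b * norm (y - z)"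
    by metis
  have expand: "?D y v = (\<Sum>b\<in>Basis. (v \<bullet> b) *\<^sub>R ?D y b)" if "y \<in> cball x r" for y v
  proof -
    have lin: "linear (?D y)" using smooth_on_linear assms that by blast
    show ?thesis
      by (subst euclidean_representation[symmetric, of v])
         (simp add: linear_sum[OF lin] linear_cmul[OF lin])
  qed
  show ?thesis
  proof (rule that[of "sum B Basis"])
    show "sum B Basis \<ge> 0" using B(1) by (simp add: sum_nonneg)
    show "norm (?D y v) \<le> sum B Basis * norm v" if "y \<in> cball x r" for y v
    proof -
      have "norm (?D y v) \<le> (\<Sum>b\<in>Basis. norm ((v \<bullet> b) *\<^sub>R ?D y b))"
        by (subst expand[OF that]) (rule norm_sum)
      also have "\<dots> \<le> (\<Sum>b\<in>Basis. norm v * B b)"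
        by (intro sum_mono) (auto intro!: mult_mono simp: Basis_le_norm B(2)[OF that])
      finally show ?thesis by (simp add: sum_distrib_left mult.commute)
    qed
    show "norm (?D y v - ?D z v) \<le> sum B Basis * norm (y - z) * norm v"
      if "y \<in> cball x r" "z \<in> cball x r" for y z v
    proof -
      have "?D y v - ?D z v = (\<Sum>b\<in>Basis. (v \<bullet> b) *\<^sub>R (?D y b - ?D z b))"
        by (subst expand[OF that(1)], subst expand[OF that(2)])
           (simp add: sum_subtractf scaleR_diff_right)
      also have "norm \<dots> \<le> (\<Sum>b\<in>Basis. norm ((v \<bullet> b) *\<^sub>R (?D y b - ?D z b)))"
        by (rule norm_sum)
      also have "\<dots> \<le> (\<Sum>b\<in>Basis. norm v * (B b * norm (y - z)))"
        by (intro sum_mono) (auto intro!: mult_mono simp: Basis_le_norm B(3)[OF that])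
      finally show ?thesis
        by (simp add: sum_distrib_left sum_distrib_right mult.commute mult.left_commute)
    qed
  qed
qed

text \<open>The acceleration of a geodesic with velocity \<open>v\<close>: the second fundamental
  form at \<open>v\<close> times the normal. Written with the ambient field \<open>N\<close>, it
  makes geodesics solutions of a differential equation in space rather than in coordinates.\<close>

definition geodesic_spray :: "(real^3 \<Rightarrow> real^3) \<Rightarrow> real^3 \<Rightarrow> real^3 \<Rightarrow> real^3" where
  "geodesic_spray N x v = - (frechet_derivative N (at x) v \<bullet> v) *\<^sub>R N x"

text \<open>The spray is quadratic in the velocity, hence Lipschitz only for bounded velocities; for
  unit-speed geodesics the unit sphere suffices. The points need not lie on the surface, so
  \<open>N\<close> is bounded by \<open>L1\<close> instead of 1.\<close>

lemma geodesic_spray_local_lipschitz: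
  assumes "open U" "smooth_on U N" "cball x r \<subseteq> U"
  obtains L where "L \<ge> 0"
    "\<And>y v. y \<in> cball x r \<Longrightarrow> norm v = 1 \<Longrightarrow> norm (geodesic_spray N y v) \<le> L"
    "\<And>y z v w. y \<in> cball x r \<Longrightarrow> z \<in> cball x r \<Longrightarrow> norm v = 1 \<Longrightarrow> norm w = 1 \<Longrightarrow>
      norm (geodesic_spray N y v - geodesic_spray N z w) \<le> L * (norm (y - z) + norm (v - w))"
proof -
  obtain L1 where L1: "L1 \<ge> 0" "\<And>y. y \<in> cball x r \<Longrightarrow> norm (N y) \<le> L1"
    "\<And>y z. y \<in> cball x r \<Longrightarrow> z \<in> cball x r \<Longrightarrow> norm (N y - N z) \<le> L1 * norm (y - z)"
    using smooth_on_local_bound[OF assms] by blast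
  let ?D = "\<lambda>y. frechet_derivative N (at y)"
  obtain L2 where L2: "L2 \<ge> 0" "\<And>y v. y \<in> cball x r \<Longrightarrow> norm (?D y v) \<le> L2 * norm v"
    "\<And>y z v. y \<in> cball x r \<Longrightarrow> z \<in> cball x r \<Longrightarrow> norm (?D y v - ?D z v) \<le> L2 * norm (y - z) * norm v"
    using smooth_on_local_derivative_bound[OF assms] by blast
  let ?g = "\<lambda>y v. ?D y v \<bullet> v"
  have g1: "\<bar>?g y v\<bar> \<le> L2" if "y \<in> cball x r" "norm v = 1" for y v
    using Cauchy_Schwarz_ineq2[of "?D y v" v] L2(2)[OF that(1), of v] that(2) by simp
  have g2: "\<bar>?g y v - ?g z w\<bar> \<le> L2 * norm (y - z) + 2 * L2 * norm (v - w)"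
    if "y \<in> cball x r" "z \<in> cball x r" "norm v = 1" "norm w = 1" for y z v w
  proof -
    have lin: "linear (?D z)" using smooth_on_linear assms that(2) by blast
    have "?g y v - ?g z w = (?D y v - ?D z v) \<bullet> v + ?D z (v - w) \<bullet> v + ?D z w \<bullet> (v - w)"
      by (simp add: linear_diff[OF lin] inner_diff_left inner_diff_right)
    moreover have "\<bar>(?D y v - ?D z v) \<bullet> v\<bar> \<le> L2 * norm (y - z)"
      using Cauchy_Schwarz_ineq2[of "?D y v - ?D z v" v] L2(3)[OF that(1,2), of v] that(3) by simp
    moreover have "\<bar>?D z (v - w) \<bullet> v\<bar> \<le> L2 * norm (v - w)"
      using Cauchy_Schwarz_ineq2[of "?D z (v - w)" v] L2(2)[OF that(2), of "v - w"] that(3) by simp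
    moreover have "\<bar>?D z w \<bullet> (v - w)\<bar> \<le> L2 * norm (v - w)"
      using Cauchy_Schwarz_ineq2[of "?D z w" "v - w"]
        mult_right_mono[OF L2(2)[OF that(2), of w], of "norm (v - w)"] that(4) by simp
    ultimately show ?thesis by (simp add: algebra_simps)
  qed
  show ?thesis
  proof (rule that[of "2 * L1 * L2"])
    show "2 * L1 * L2 \<ge> 0" using L1 L2 by simp
    fix y v assume y: "y \<in> cball x r" and v: "norm (v :: real^3) = 1"
    have "norm (geodesic_spray N y v) = \<bar>?g y v\<bar> * norm (N y)" by (simp add: geodesic_spray_def)
    also have "\<dots> \<le> L2 * L1" using g1[OF y v] L1(2)[OF y] L2(1) by (intro mult_mono) auto
    also have "\<dots> \<le> 2 * L1 * L2" using L1 L2 by (simp add: mult.commute)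
    finally show "norm (geodesic_spray N y v) \<le> 2 * L1 * L2" .
    fix z w assume z: "z \<in> cball x r" and w: "norm (w :: real^3) = 1"
    have "geodesic_spray N y v - geodesic_spray N z w
        = - ((?g y v - ?g z w) *\<^sub>R N y + ?g z w *\<^sub>R (N y - N z))"
      by (simp add: geodesic_spray_def algebra_simps)
    also have "norm \<dots> \<le> \<bar>?g y v - ?g z w\<bar> * norm (N y) + \<bar>?g z w\<bar> * norm (N y - N z)"
      by (simp only: norm_minus_cancel) (rule order.trans[OF norm_triangle_ineq], simp)
    also have "\<dots> \<le> (L2 * norm (y - z) + 2 * L2 * norm (v - w)) * L1 + L2 * (L1 * norm (y - z))"
      using g2[OF y z v w] g1[OF z w] L1 L2 y z by (intro add_mono mult_mono) auto
    also have "\<dots> = 2 * L1 * L2 * (norm (y - z) + norm (v - w))" by (simp add: algebra_simps)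
    finally show "norm (geodesic_spray N y v - geodesic_spray N z w)
        \<le> 2 * L1 * L2 * (norm (y - z) + norm (v - w))" .
  qed
qed

context surface_with_normals
begin

lemma normal_and_spray_near:
  assumes "x \<in> S"
  obtains N r L where "r > 0" "L \<ge> 0" "\<And>y. y \<in> S \<Longrightarrow> y \<in> cball x r \<Longrightarrow> unit_normal_near S y N"
    "\<And>y. y \<in> cball x r \<Longrightarrow> (N has_derivative frechet_derivative N (at y)) (at y)"
    "\<And>y v. y \<in> cball x r \<Longrightarrow> norm v = 1 \<Longrightarrow> norm (geodesic_spray N y v) \<le> L"
    "\<And>y z v w. y \<in> cball x r \<Longrightarrow> z \<in> cball x r \<Longrightarrow> norm v = 1 \<Longrightarrow> norm w = 1 \<Longrightarrow>
      norm (geodesic_spray N y v - geodesic_spray N z w) \<le> L * (norm (y - z) + norm (v - w))"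
proof -
  obtain N U where U: "open U" "x \<in> U" "smooth_on U N"
    and n: "\<forall>y\<in>S \<inter> U. norm (N y) = 1 \<and> (\<forall>v\<in>tangent_space S y. N y \<bullet> v = 0)"
    using unit_normal_exists[OF assms] unfolding unit_normal_near_def by blast
  obtain r where r: "r > 0" "cball x r \<subseteq> U" using U open_contains_cball by blast
  have nn: "unit_normal_near S y N" if "y \<in> S" "y \<in> cball x r" for y
    unfolding unit_normal_near_def using U n r that by blast
  have nd: "(N has_derivative frechet_derivative N (at y)) (at y)" if "y \<in> cball x r" for y
    using smooth_on_has_derivative[OF U(3)] r that by blast
  show ?thesis
    by (rule geodesic_spray_local_lipschitz[OF U(1,3) r(2)], rule that[OF r(1) _ nn nd])
qed

text \<open>The acceleration is normal to the surface, and its normal component is found by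
  differentiating the identity \<open>N (c u) \<bullet> c' u = 0\<close>.\<close>

lemma geodesic_equation:
  assumes g: "unit_geodesic S {a..b} c c'" and ab: "a < b" and s: "s \<in> {a..b}"
    and N: "\<And>u. u \<in> {a..b} \<Longrightarrow> unit_normal_near S (c u) N"
    and der: "(N has_derivative frechet_derivative N (at (c s))) (at (c s))"
  shows "(c' has_vector_derivative geodesic_spray N (c s) (c' s)) (at s within {a..b})"
proof -
  obtain c'' where c: "\<And>u. u \<in> {a..b} \<Longrightarrow> (c has_vector_derivative c' u) (at u within {a..b})"
    "(c' has_vector_derivative c'' s) (at s within {a..b})"
    "\<And>v. v \<in> tangent_space S (c s) \<Longrightarrow> c'' s \<bullet> v = 0" and cS: "c ` {a..b} \<subseteq> S"
    using g s unfolding unit_geodesic_def by blast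
  let ?D = "frechet_derivative N (at (c s))"
  have cu: "c u \<in> S" if "u \<in> {a..b}" for u using that cS by blast
  have orth: "N (c u) \<bullet> c' u = 0" if "u \<in> {a..b}" for u
    using velocity_tangent[OF cS that at_within_Icc_nontrivial[OF ab that] c(1)[OF that]]
      tangent_space_eq[OF cu[OF that] N[OF that]] by simp
  have n1: "norm (N (c s)) = 1" using N[OF s] cu[OF s] unfolding unit_normal_near_def by auto
  have "((\<lambda>u. N (c u)) has_vector_derivative ?D (c' s)) (at s within {a..b})"
    using vector_derivative_diff_chain_within[of c "c' s" s "{a..b}" N ?D] c(1)[OF s] der
    by (auto simp: o_def has_derivative_at_withinI)
  then have "((\<lambda>u. N (c u) \<bullet> c' u) has_vector_derivative N (c s) \<bullet> c'' s + ?D (c' s) \<bullet> c' s)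
      (at s within {a..b})"
    using bounded_bilinear.has_vector_derivative[OF bounded_bilinear_inner] c(2) by blast
  moreover have "((\<lambda>u. N (c u) \<bullet> c' u) has_vector_derivative 0) (at s within {a..b})"
    by (rule has_vector_derivative_transform[OF s _ has_vector_derivative_const[of 0]]) (simp add: orth)
  ultimately have e: "N (c s) \<bullet> c'' s = - (?D (c' s) \<bullet> c' s)"
    using vector_derivative_unique_within[OF at_within_Icc_nontrivial[OF ab s]] by fastforce
  \<comment> \<open>The tangential part of the acceleration. Being tangent, it is orthogonal to
    \<open>c'' s\<close> and to the normal, hence to itself.\<close>
  define w where "w = c'' s - (N (c s) \<bullet> c'' s) *\<^sub>R N (c s)"
  have "N (c s) \<bullet> N (c s) = 1" using n1 by (simp add: dot_square_norm)
  then have w: "N (c s) \<bullet> w = 0" by (simp add: w_def inner_diff_right)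
  then have "c'' s \<bullet> w = 0" using tangent_space_eq[OF cu[OF s] N[OF s]] c(3) by simp
  then have "w \<bullet> w = 0" using w by (subst w_def) (simp add: inner_diff_left)
  then have "c'' s = geodesic_spray N (c s) (c' s)" using e by (simp add: w_def geodesic_spray_def eq_neg_iff_add_eq_0)
  then show ?thesis using c(2) by simp
qed

text \<open>The radius and the constant depend only on \<open>x\<close>, not on the geodesics. The
  first estimate, from bounded acceleration, compares arcs with chords; the second, Gronwall applied
  to the squared distance of the states, yields continuous dependence.\<close>

lemma geodesic_local_estimates:
  assumes "x \<in> S"
  obtains r M where "r > 0" "M \<ge> 0"
    "\<And>a b c c' s t. unit_geodesic S {a..b} c c' \<Longrightarrow> c ` {a..b} \<subseteq> cball x r \<Longrightarrow> s \<in> {a..b} \<Longrightarrow> t \<in> {a..b} \<Longrightarrow>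
      norm (c t - c s - (t - s) *\<^sub>R c' s) \<le> M * (t - s)\<^sup>2"
    "\<And>a b c c' d d' s t. unit_geodesic S {a..b} c c' \<Longrightarrow> c ` {a..b} \<subseteq> cball x r \<Longrightarrow>
      unit_geodesic S {a..b} d d' \<Longrightarrow> d ` {a..b} \<subseteq> cball x r \<Longrightarrow> s \<in> {a..b} \<Longrightarrow> t \<in> {a..b} \<Longrightarrow>
      (norm (c t - d t))\<^sup>2 + (norm (c' t - d' t))\<^sup>2
        \<le> exp (M * \<bar>t - s\<bar>) * ((norm (c s - d s))\<^sup>2 + (norm (c' s - d' s))\<^sup>2)"
proof -
  obtain N r L where r: "r > 0" "L \<ge> 0" and N: "\<And>y. y \<in> S \<Longrightarrow> y \<in> cball x r \<Longrightarrow> unit_normal_near S y N"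
    "\<And>y. y \<in> cball x r \<Longrightarrow> (N has_derivative frechet_derivative N (at y)) (at y)"
    and F: "\<And>y v. y \<in> cball x r \<Longrightarrow> norm v = 1 \<Longrightarrow> norm (geodesic_spray N y v) \<le> L"
    "\<And>y z v w. y \<in> cball x r \<Longrightarrow> z \<in> cball x r \<Longrightarrow> norm v = 1 \<Longrightarrow> norm w = 1 \<Longrightarrow>
      norm (geodesic_spray N y v - geodesic_spray N z w) \<le> L * (norm (y - z) + norm (v - w))"
    by (rule normal_and_spray_near[OF assms]) (rule that)
  let ?F = "geodesic_spray N"
  have eq: "(c' has_vector_derivative ?F (c s) (c' s)) (at s within {a..b})"
    if "unit_geodesic S {a..b} c c'" "c ` {a..b} \<subseteq> cball x r" "a < b" "s \<in> {a..b}" for a b c c' s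
    by (rule geodesic_equation[OF that(1,3,4)])
       (use that unit_geodesicD[OF that(1)] in \<open>blast intro: N\<close>)+
  \<comment> \<open>With \<open>?p\<close> and \<open>?q\<close> the distances of positions and
    velocities, the derivative of \<open>?E\<close> is at most
    \<open>2 * (1 + L) * ?p * ?q + 2 * L * ?q\<^sup>2\<close>; here \<open>2 * ?p * ?q\<close> is at
    most \<open>?p\<^sup>2 + ?q\<^sup>2\<close>, and \<open>(1 + L) + 2 * L\<close> is this
    constant.\<close>
  define M where "M = 3 * L + 1"
  have "M \<ge> 0" "L \<le> M" using r by (auto simp: M_def)
  show ?thesis
  proof (rule that[OF r(1) \<open>M \<ge> 0\<close>])
    fix a b s t :: real and c c'
    assume g: "unit_geodesic S {a..b} c c'" "c ` {a..b} \<subseteq> cball x r" and st: "s \<in> {a..b}" "t \<in> {a..b}"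
    show "norm (c t - c s - (t - s) *\<^sub>R c' s) \<le> M * (t - s)\<^sup>2"
    proof (cases "a < b")
      case True
      note cd = unit_geodesicD[OF g(1)]
      define A B where "A = min s t" and "B = max s t"
      have AB: "{A..B} \<subseteq> {a..b}" "s \<in> {A..B}" "t \<in> {A..B}" using st by (auto simp: A_def B_def)
      have Lip: "norm (c' u - c' s) \<le> L * \<bar>u - s\<bar>" if "u \<in> {a..b}" for u
      proof (rule has_vector_derivative_bound[OF eq[OF g True] _ st(1) that])
        show "norm (?F (c w) (c' w)) \<le> L" if "w \<in> {a..b}" for w
          using F(1) cd(3)[OF that] g(2) that by (meson image_subset_iff)
      qed
      have "norm ((c t - t *\<^sub>R c' s) - (c s - s *\<^sub>R c' s)) \<le> (L * \<bar>t - s\<bar>) * \<bar>t - s\<bar>"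
      proof (rule has_vector_derivative_bound[OF _ _ AB(2,3)])
        show "((\<lambda>u. c u - u *\<^sub>R c' s) has_vector_derivative c' u - c' s) (at u within {A..B})"
          if "u \<in> {A..B}" for u
        proof -
          have "(c has_vector_derivative c' u) (at u within {A..B})"
            by (rule has_vector_derivative_within_subset[OF cd(2)]) (use AB that in auto)
          then show ?thesis by (auto intro!: derivative_eq_intros)
        qed
        show "norm (c' u - c' s) \<le> L * \<bar>t - s\<bar>" if "u \<in> {A..B}" for u
        proof -
          have "\<bar>u - s\<bar> \<le> \<bar>t - s\<bar>" using that by (auto simp: A_def B_def min_def max_def split: if_splits)
          then have "L * \<bar>u - s\<bar> \<le> L * \<bar>t - s\<bar>" using r(2) by (rule mult_left_mono)
          then show ?thesis using Lip[of u] that AB(1) by force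
        qed
      qed
      also have "\<dots> = L * (t - s)\<^sup>2" by (simp add: power2_eq_square abs_mult_self_eq mult.assoc)
      also have "\<dots> \<le> M * (t - s)\<^sup>2" using \<open>L \<le> M\<close> by (intro mult_right_mono) auto
      finally show ?thesis by (simp add: algebra_simps)
    next
      case False
      then have "s = t" using st by auto
      then show ?thesis by simp
    qed
  next
    fix a b s t :: real and c c' d d'
    assume g: "unit_geodesic S {a..b} c c'" "c ` {a..b} \<subseteq> cball x r" "unit_geodesic S {a..b} d d'"
      "d ` {a..b} \<subseteq> cball x r" and st: "s \<in> {a..b}" "t \<in> {a..b}"
    let ?E = "\<lambda>u. (norm (c u - d u))\<^sup>2 + (norm (c' u - d' u))\<^sup>2"
    show "?E t \<le> exp (M * \<bar>t - s\<bar>) * ?E s"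
    proof (cases "a < b")
      case True
      let ?E' = "\<lambda>u. 2 * ((c u - d u) \<bullet> (c' u - d' u)) + 2 * ((c' u - d' u) \<bullet> (?F (c u) (c' u) - ?F (d u) (d' u)))"
      show ?thesis
      proof (rule gronwall_two_sided[OF _ _ st])
        fix u assume u: "u \<in> {a..b}"
        note cd = unit_geodesicD[OF g(1) u] unit_geodesicD[OF g(3) u] eq[OF g(1,2) True u] eq[OF g(3,4) True u]
        have sq: "((\<lambda>u. (f u \<bullet> f u)) has_real_derivative 2 * (f u \<bullet> f')) (at u within {a..b})"
          if "(f has_vector_derivative f') (at u within {a..b})" for f :: "real \<Rightarrow> real^3" and f'
          using bounded_bilinear.has_vector_derivative[OF bounded_bilinear_inner that that]
          by (simp add: has_real_derivative_iff_has_vector_derivative inner_commute)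
        show "(?E has_real_derivative ?E' u) (at u within {a..b})"
          unfolding dot_square_norm[symmetric]
          by (intro DERIV_add sq has_vector_derivative_diff cd)
        let ?p = "norm (c u - d u)" and ?q = "norm (c' u - d' u)"
        have 1: "\<bar>(c u - d u) \<bullet> (c' u - d' u)\<bar> \<le> ?p * ?q" by (rule Cauchy_Schwarz_ineq2)
        have "\<bar>(c' u - d' u) \<bullet> (?F (c u) (c' u) - ?F (d u) (d' u))\<bar>
            \<le> ?q * norm (?F (c u) (c' u) - ?F (d u) (d' u))"
          by (rule Cauchy_Schwarz_ineq2)
        also have "\<dots> \<le> ?q * (L * (?p + ?q))"
          using subsetD[OF g(2) imageI[OF u]] subsetD[OF g(4) imageI[OF u]] cd
          by (intro mult_left_mono F) auto
        finally have 2: "\<bar>(c' u - d' u) \<bullet> (?F (c u) (c' u) - ?F (d u) (d' u))\<bar> \<le> L * (?p * ?q) + L * ?q\<^sup>2"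
          by (simp add: algebra_simps power2_eq_square)
        have 3: "2 * (?p * ?q) \<le> ?p\<^sup>2 + ?q\<^sup>2" using sum_squares_bound[of ?p ?q] by simp
        then have "L * (2 * (?p * ?q)) \<le> L * (?p\<^sup>2 + ?q\<^sup>2)" using r(2) by (rule mult_left_mono)
        moreover have "0 \<le> L * ?p\<^sup>2" "0 \<le> L * ?q\<^sup>2" using r by auto
        ultimately show "\<bar>?E' u\<bar> \<le> M * ?E u"
          using 1 2 3 unfolding M_def by (simp add: algebra_simps abs_le_iff)
      qed
    next
      case False
      then have "s = t" using st by auto
      then show ?thesis by simp
    qed
  qed
qed

text \<open>The Gronwall estimate holds only inside small balls. Convergence of the states is thus a
  property that spreads between nearby times, and connectedness of the interval carries it from time
  0 to \<open>t\<close>.\<close>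

lemma geodesic_continuous_dependence:
  assumes d: "unit_geodesic S {0..T} d d'"
    and ev: "\<forall>\<^sub>F k in sequentially. unit_geodesic S {0..T} (c k) (c' k)"
    and init: "(\<lambda>k. c k 0) \<longlonglongrightarrow> d 0" "(\<lambda>k. c' k 0) \<longlonglongrightarrow> d' 0"
    and t: "t \<in> {0..T}"
  shows "(\<lambda>k. c k t) \<longlonglongrightarrow> d t \<and> (\<lambda>k. c' k t) \<longlonglongrightarrow> d' t"
proof -
  define P where "P t \<longleftrightarrow> (\<lambda>k. c k t) \<longlonglongrightarrow> d t \<and> (\<lambda>k. c' k t) \<longlonglongrightarrow> d' t" for t
  have loc: "\<exists>e>0. \<forall>u\<in>{0..T}. \<forall>v\<in>{0..T}. \<bar>u - t\<bar> < e \<longrightarrow> \<bar>v - t\<bar> < e \<longrightarrow> P u \<longrightarrow> P v" if t: "t \<in> {0..T}" for t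
  proof -
    define x where "x = d t"
    have "x \<in> S" using unit_geodesicD[OF d t] by (simp add: x_def)
    then obtain r M where r: "r > 0" "M \<ge> 0" and est:
      "\<And>a b c c' d d' s u. unit_geodesic S {a..b} c c' \<Longrightarrow> c ` {a..b} \<subseteq> cball x r \<Longrightarrow>
      unit_geodesic S {a..b} d d' \<Longrightarrow> d ` {a..b} \<subseteq> cball x r \<Longrightarrow> s \<in> {a..b} \<Longrightarrow> u \<in> {a..b} \<Longrightarrow>
      (norm (c u - d u))\<^sup>2 + (norm (c' u - d' u))\<^sup>2
        \<le> exp (M * \<bar>u - s\<bar>) * ((norm (c s - d s))\<^sup>2 + (norm (c' s - d' s))\<^sup>2)"
      by (rule geodesic_local_estimates) (rule that)
    \<comment> \<open>Unit speed confines the curves \<open>c k\<close> to the ball: at time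
      \<open>w\<close> the distance to \<open>d t\<close> is at most
      \<open>\<bar>w - u\<bar>\<close>, plus that of \<open>c k u\<close> from \<open>d u\<close>,
      plus \<open>\<bar>u - t\<bar>\<close>, which is below
      \<open>r / 2 + r / 4 + r / 4\<close>.\<close>
    have step: "P v" if uv: "u \<in> {0..T}" "v \<in> {0..T}" "\<bar>u - t\<bar> < r / 4" "\<bar>v - t\<bar> < r / 4" and "P u" for u v
    proof -
      define A B where "A = min u v" and "B = max u v"
      have AB: "{A..B} \<subseteq> {0..T}" "u \<in> {A..B}" "v \<in> {A..B}" using uv by (auto simp: A_def B_def)
      have near: "\<bar>w - t\<bar> < r / 4" "\<bar>w - u\<bar> < r / 2" if "w \<in> {A..B}" for w
        using that uv unfolding A_def B_def atLeastAtMost_iff by linarith+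
      have dw: "dist (d w) (d t) \<le> \<bar>w - t\<bar>" if "w \<in> {A..B}" for w
        using unit_geodesic_dist_le[OF d t] that AB(1) by (auto simp: dist_norm)
      have d_in: "d ` {A..B} \<subseteq> cball x r"
        using dw near r by (force simp: dist_commute x_def)
      have "\<forall>\<^sub>F k in sequentially. dist (c k u) (d u) < r / 4"
        using \<open>P u\<close> r unfolding P_def by (intro tendstoD) auto
      with ev have bound: "\<forall>\<^sub>F k in sequentially. (norm (c k v - d v))\<^sup>2 + (norm (c' k v - d' v))\<^sup>2
          \<le> exp (M * \<bar>v - u\<bar>) * ((norm (c k u - d u))\<^sup>2 + (norm (c' k u - d' u))\<^sup>2)"
      proof eventually_elim
        case (elim k)
        have "dist (c k w) (d t) \<le> r" if w: "w \<in> {A..B}" for w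
        proof -
          have "dist (c k w) (c k u) \<le> \<bar>w - u\<bar>"
            using unit_geodesic_dist_le[OF elim(1) uv(1)] w AB(1) by (auto simp: dist_norm)
          moreover have "dist (d u) (d t) \<le> \<bar>u - t\<bar>" using dw AB(2) by blast
          ultimately show ?thesis
            using near[OF w] uv(3) elim(2) dist_triangle[of "c k w" "d t" "c k u"]
              dist_triangle[of "c k u" "d t" "d u"] by linarith
        qed
        then have "c k ` {A..B} \<subseteq> cball x r" by (auto simp: dist_commute x_def)
        then show ?case
          using est[of A B "c k" "c' k" d d' u v] unit_geodesic_subset[OF _ AB(1)] elim(1) d d_in AB(2,3)
          by blast
      qed
      have lim: "(\<lambda>k. exp (M * \<bar>v - u\<bar>) * ((norm (c k u - d u))\<^sup>2 + (norm (c' k u - d' u))\<^sup>2)) \<longlonglongrightarrow>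
          exp (M * \<bar>v - u\<bar>) * ((norm (d u - d u))\<^sup>2 + (norm (d' u - d' u))\<^sup>2)"
        using \<open>P u\<close> unfolding P_def by (intro tendsto_intros) auto
      have sq: "f \<longlonglongrightarrow> l" if "\<forall>\<^sub>F k in sequentially. (norm (f k - l))\<^sup>2
          \<le> exp (M * \<bar>v - u\<bar>) * ((norm (c k u - d u))\<^sup>2 + (norm (c' k u - d' u))\<^sup>2)" for f :: "nat \<Rightarrow> real^3" and l
      proof -
        have "(\<lambda>k. (norm (f k - l))\<^sup>2) \<longlonglongrightarrow> 0"
          by (rule tendsto_sandwich[OF _ that tendsto_const]) (use lim in auto)
        then have "(\<lambda>k. sqrt ((norm (f k - l))\<^sup>2)) \<longlonglongrightarrow> sqrt 0" by (rule tendsto_real_sqrt)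
        then show ?thesis by (simp add: LIM_zero_iff tendsto_norm_zero_iff)
      qed
      show "P v" unfolding P_def
        by (intro conjI sq; rule eventually_mono[OF bound])
           (erule order.trans[rotated], simp)+
    qed
    show ?thesis by (intro exI[of _ "r / 4"] conjI ballI impI; (rule step | use r in simp); assumption)
  qed
  have "0 \<in> {0..T}" using t by auto
  have "P t"
  proof (rule connected_induction_simple[of "{0..T}" 0 t P])
    show "P 0" using init by (simp add: P_def)
    fix a assume a: "a \<in> {0..T}"
    obtain e where e: "e > 0" "\<forall>u\<in>{0..T}. \<forall>v\<in>{0..T}. \<bar>u - a\<bar> < e \<longrightarrow> \<bar>v - a\<bar> < e \<longrightarrow> P u \<longrightarrow> P v"
      using loc[OF a] by blast
    have "openin (top_of_set {0..T}) ({0..T} \<inter> ball a e)" by (simp add: openin_open_Int)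
    then show "\<exists>Ta. openin (top_of_set {0..T}) Ta \<and> a \<in> Ta \<and> (\<forall>x\<in>Ta. \<forall>y\<in>Ta. P x \<longrightarrow> P y)"
      using e a by (intro exI[of _ "{0..T} \<inter> ball a e"]) (auto simp: dist_real_def abs_minus_commute)
  qed (use t \<open>0 \<in> {0..T}\<close> in auto)
  then show ?thesis by (simp add: P_def)
qed

lemma unit_geodesic_unique:
  assumes "unit_geodesic S {0..T} c c'" "unit_geodesic S {0..T} d d'" "c 0 = d 0" "c' 0 = d' 0" "t \<in> {0..T}"
  shows "c t = d t" "c' t = d' t"
  using geodesic_continuous_dependence[OF assms(2), of "\<lambda>_. c" "\<lambda>_. c'" t] assms
  by (auto simp: LIMSEQ_const_iff)

end

section \<open>The exponential map and its inverse\<close>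

text \<open>\<open>\<sigma> = 1\<close> restarts a geodesic at an interior point,
  \<open>\<sigma> = -1\<close> runs it backwards. The acceleration picks up the factor
  \<open>\<sigma> * \<sigma> = 1\<close>.\<close>

lemma unit_geodesic_reparametrize:
  assumes g: "unit_geodesic S I c c'" and \<sigma>: "\<bar>\<sigma>\<bar> = 1" and J: "\<And>u. u \<in> J \<Longrightarrow> p + \<sigma> * u \<in> I"
  shows "unit_geodesic S J (\<lambda>u. c (p + \<sigma> * u)) (\<lambda>u. \<sigma> *\<^sub>R c' (p + \<sigma> * u))"
proof -
  obtain c'' where c: "c ` I \<subseteq> S" "\<And>s. s \<in> I \<Longrightarrow> (c has_vector_derivative c' s) (at s within I)"
    "\<And>s. s \<in> I \<Longrightarrow> (c' has_vector_derivative c'' s) (at s within I)"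
    "\<And>s. s \<in> I \<Longrightarrow> norm (c' s) = 1"
    "\<And>s v. s \<in> I \<Longrightarrow> v \<in> tangent_space S (c s) \<Longrightarrow> c'' s \<bullet> v = 0"
    using g unfolding unit_geodesic_def by blast
  have ss: "\<sigma> * \<sigma> = 1" using \<sigma> by (metis abs_mult_self_eq mult_1)
  have chain: "((\<lambda>u. f (p + \<sigma> * u)) has_vector_derivative \<sigma> *\<^sub>R f') (at u within J)"
    if "(f has_vector_derivative f') (at (p + \<sigma> * u) within I)" "u \<in> J" for f :: "real \<Rightarrow> real^3" and f' u
  proof -
    have "((\<lambda>u. p + \<sigma> * u) has_vector_derivative \<sigma>) (at u within J)"
      by (auto intro!: derivative_eq_intros)
    moreover have "(f has_vector_derivative f') (at (p + \<sigma> * u) within (\<lambda>u. p + \<sigma> * u) ` J)"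
      by (rule has_vector_derivative_within_subset[OF that(1)]) (use J in auto)
    ultimately show ?thesis using vector_diff_chain_within by (fastforce simp: o_def)
  qed
  have "((\<lambda>u. \<sigma> *\<^sub>R c' (p + \<sigma> * u)) has_vector_derivative c'' (p + \<sigma> * u)) (at u within J)" if "u \<in> J" for u
  proof -
    have "((\<lambda>u. \<sigma> *\<^sub>R c' (p + \<sigma> * u)) has_vector_derivative \<sigma> *\<^sub>R \<sigma> *\<^sub>R c'' (p + \<sigma> * u)) (at u within J)"
      using chain[OF c(3)[OF J[OF that]] that]
      by (rule bounded_linear.has_vector_derivative[OF bounded_linear_scaleR_right])
    then show ?thesis by (simp add: ss)
  qed
  then show ?thesis
    unfolding unit_geodesic_def using c J chain \<sigma>
    by (intro conjI exI[of _ "\<lambda>u. c'' (p + \<sigma> * u)"]) auto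
qed

context surface_with_normals
begin

lemma unit_geodesic_velocity_tangent:
  assumes "unit_geodesic S {a..b} c c'" "a < b" "s \<in> {a..b}"
  shows "c' s \<in> tangent_space S (c s)"
proof (rule velocity_tangent)
  show "c ` {a..b} \<subseteq> S" using assms(1) unfolding unit_geodesic_def by blast
qed (use unit_geodesicD(2)[OF assms(1,3)] at_within_Icc_nontrivial[OF assms(2,3)] assms(3) in auto)

lemma initial_velocity_eq:
  assumes "unit_geodesic S {0..l} c c'" "0 < l"
  shows "initial_velocity c l = c' 0"
  unfolding initial_velocity_def
  by (rule vector_derivative_within[OF at_within_Icc_nontrivial])
     (use assms unit_geodesicD(2)[OF assms(1), of 0] in auto)

lemma exp_relE:
  assumes "exp_rel S x v y" "v \<noteq> 0"
  obtains c c' where "unit_geodesic S {0..norm v} c c'" "c 0 = x" "c (norm v) = y" "c' 0 = v /\<^sub>R norm v"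
proof -
  obtain c where c: "geodesic_arc S c (norm v) x y" "initial_velocity c (norm v) = v /\<^sub>R norm v"
    using assms unfolding exp_rel_def by auto
  then obtain c' where "unit_geodesic S {0..norm v} c c'"
    unfolding geodesic_arc_def geodesic_on_iff by blast
  then show ?thesis using that c initial_velocity_eq unfolding geodesic_arc_def by metis
qed

text \<open>Uniqueness of geodesics with given initial data is what makes the description in
  \<open>exp_map\<close> definite.\<close>

lemma exp_map_eqI:
  assumes "exp_rel S x v y"
  shows "exp_map S x v = y"
  unfolding exp_map_def
proof (rule the_equality)
  show "exp_rel S x v y" by (rule assms)
  fix z assume z: "exp_rel S x v z"
  show "z = y"
  proof (cases "v = 0")
    case True
    then show ?thesis using assms z unfolding exp_rel_def by simp
  next
    case False
    obtain c c' where c: "unit_geodesic S {0..norm v} c c'" "c 0 = x" "c (norm v) = y" "c' 0 = v /\<^sub>R norm v"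
      using exp_relE[OF assms False] by metis
    obtain d d' where d: "unit_geodesic S {0..norm v} d d'" "d 0 = x" "d (norm v) = z" "d' 0 = v /\<^sub>R norm v"
      using exp_relE[OF z False] by metis
    show ?thesis using unit_geodesic_unique(1)[OF c(1) d(1), of "norm v"] c d by simp
  qed
qed

lemma exp_map_0: "exp_map S x 0 = x"
  by (rule exp_map_eqI) (simp add: exp_rel_def)

lemma exp_map_geodesic:
  assumes "unit_geodesic S {0..l} c c'" "0 < l"
  shows "exp_map S (c 0) (l *\<^sub>R c' 0) = c l"
proof (rule exp_map_eqI)
  have n: "norm (c' 0) = 1" using unit_geodesicD(3)[OF assms(1), of 0] assms(2) by simp
  then have "c' 0 \<noteq> 0" by auto
  then show "exp_rel S (c 0) (l *\<^sub>R c' 0) (c l)"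
    using assms n initial_velocity_eq[OF assms]
    by (auto simp: exp_rel_def geodesic_arc_def geodesic_on_iff)
qed

end

locale normal_neighborhood = surface_with_normals +
  fixes W :: "(real^3) set" and \<delta> :: real
  assumes nn: "normal_neighborhood_of_all_points S W \<delta>"
begin

definition exp_dom :: "real^3 \<Rightarrow> (real^3) set" where
  "exp_dom P = tangent_space S P \<inter> ball 0 \<delta>"

text \<open>The Riemannian logarithm at \<open>P\<close>. It records length and initial direction of
  the short geodesic in one vector and, unlike directions, extends continuously to
  \<open>Q = P\<close>, with value 0.\<close>

definition lg :: "real^3 \<Rightarrow> real^3 \<Rightarrow> real^3" where
  "lg P = inv_into (exp_dom P) (exp_map S P)"

lemma W_subset: "P \<in> W \<Longrightarrow> P \<in> S"
  using nn openin_imp_subset unfolding normal_neighborhood_of_all_points_def by blast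

lemma \<delta>_pos: "\<delta> > 0"
  using nn unfolding normal_neighborhood_of_all_points_def by blast

lemma exp_rel_exists: "P \<in> W \<Longrightarrow> v \<in> exp_dom P \<Longrightarrow> \<exists>y. exp_rel S P v y"
  using nn unfolding normal_neighborhood_of_all_points_def exp_dom_def by blast

lemma exp_inj: "P \<in> W \<Longrightarrow> inj_on (exp_map S P) (exp_dom P)"
  using nn unfolding normal_neighborhood_of_all_points_def exp_dom_def diffeomorphic_onto_image_def by blast

lemma exp_covers: "P \<in> W \<Longrightarrow> W \<subseteq> exp_map S P ` exp_dom P"
  using nn unfolding normal_neighborhood_of_all_points_def exp_dom_def by blast

lemma lg_continuous: "P \<in> W \<Longrightarrow> continuous_on (exp_map S P ` exp_dom P) (lg P)"
  using nn smooth_map_on_continuous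
  unfolding normal_neighborhood_of_all_points_def exp_dom_def diffeomorphic_onto_image_def lg_def by blast

lemma lg_exp: "P \<in> W \<Longrightarrow> v \<in> exp_dom P \<Longrightarrow> lg P (exp_map S P v) = v"
  unfolding lg_def by (rule inv_into_f_f[OF exp_inj])

lemma lg_self:
  assumes "P \<in> W"
  shows "lg P P = 0"
proof -
  obtain N where "unit_normal_near S P N" using unit_normal_exists W_subset assms by blast
  then have "0 \<in> exp_dom P"
    using tangent_space_eq[OF W_subset[OF assms]] \<delta>_pos by (simp add: exp_dom_def)
  then show ?thesis using lg_exp[OF assms, of 0] by (simp add: exp_map_0)
qed

lemma exp_dom_geodesic:
  assumes "unit_geodesic S {0..l} c c'" "0 < l" "t \<in> {0..l}" "t < \<delta>"
  shows "t *\<^sub>R c' 0 \<in> exp_dom (c 0)"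
proof -
  have "c' 0 \<in> tangent_space S (c 0)" "c 0 \<in> S" "norm (c' 0) = 1"
    using unit_geodesic_velocity_tangent[OF assms(1,2), of 0] unit_geodesicD[OF assms(1), of 0] assms(2) by auto
  then show ?thesis using tangent_space_scaleR assms by (auto simp: exp_dom_def)
qed

lemma lg_geodesic:
  assumes "unit_geodesic S {0..l} c c'" "0 < l" "l < \<delta>" "c 0 \<in> W"
  shows "lg (c 0) (c l) = l *\<^sub>R c' 0"
  using lg_exp[OF assms(4) exp_dom_geodesic[OF assms(1,2), of l]] exp_map_geodesic[OF assms(1,2)] assms by simp

text \<open>Any two geodesics shorter than \<open>\<delta>\<close> with the same end points have the
  same logarithm, hence the same length and the same initial velocity.\<close>

lemma geo_direction_initial:
  assumes "unit_geodesic S {0..l} c c'" "0 < l" "l < \<delta>" "c 0 \<in> W"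
  shows "geo_direction S \<delta> (c 0) (c l) = c' 0"
  unfolding geo_direction_def
proof (rule the_equality)
  show "\<exists>d m. geodesic_arc S d m (c 0) (c l) \<and> m < \<delta> \<and> initial_velocity d m = c' 0"
    using assms initial_velocity_eq[OF assms(1,2)]
    by (intro exI[of _ c] exI[of _ l]) (auto simp: geodesic_arc_def geodesic_on_iff)
  fix v assume "\<exists>d m. geodesic_arc S d m (c 0) (c l) \<and> m < \<delta> \<and> initial_velocity d m = v"
  then obtain d m where d: "geodesic_arc S d m (c 0) (c l)" "m < \<delta>" "initial_velocity d m = v" by blast
  then obtain d' where d': "unit_geodesic S {0..m} d d'" "0 < m" "d 0 = c 0" "d m = c l"
    unfolding geodesic_arc_def geodesic_on_iff by blast
  have eq: "m *\<^sub>R d' 0 = l *\<^sub>R c' 0"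
    using lg_geodesic[OF d'(1,2) d(2)] lg_geodesic[OF assms] d' assms(4) by simp
  have n: "norm (d' 0) = 1" "norm (c' 0) = 1"
    using unit_geodesicD(3)[OF d'(1), of 0] unit_geodesicD(3)[OF assms(1), of 0] d'(2) assms(2) by auto
  have "m = l" using arg_cong[OF eq, of norm] n d'(2) assms(2) by simp
  then show "v = c' 0" using eq d initial_velocity_eq[OF d'(1,2)] d'(2) by simp
qed

lemma geo_direction_forward:
  assumes "unit_geodesic S {s..t} c c'" "s < t" "t - s < \<delta>" "c s \<in> W"
  shows "geo_direction S \<delta> (c s) (c t) = c' s"
proof -
  have "unit_geodesic S {0..t-s} (\<lambda>u. c (s + 1 * u)) (\<lambda>u. 1 *\<^sub>R c' (s + 1 * u))"
    by (rule unit_geodesic_reparametrize[OF assms(1)]) auto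
  from geo_direction_initial[OF this] show ?thesis using assms by simp
qed

lemma geo_direction_backward:
  assumes "unit_geodesic S {s..t} c c'" "s < t" "t - s < \<delta>" "c t \<in> W"
  shows "geo_direction S \<delta> (c t) (c s) = - c' t"
proof -
  have "unit_geodesic S {0..t-s} (\<lambda>u. c (t + -1 * u)) (\<lambda>u. -1 *\<^sub>R c' (t + -1 * u))"
    by (rule unit_geodesic_reparametrize[OF assms(1)]) auto
  from geo_direction_initial[OF this] show ?thesis using assms by simp
qed

lemma geodesic_from:
  assumes "P \<in> W" "v \<in> tangent_space S P" "norm v = 1" "0 < t" "t < \<delta>"
  obtains c c' where "unit_geodesic S {0..t} c c'" "c 0 = P" "c' 0 = v"
proof -
  have n: "norm (t *\<^sub>R v) = t" using assms by simp
  have "t *\<^sub>R v \<in> exp_dom P"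
    unfolding exp_dom_def using tangent_space_scaleR[OF W_subset[OF assms(1)] assms(2)] n assms(5) by simp
  then obtain y where "exp_rel S P (t *\<^sub>R v) y" using exp_rel_exists assms(1) by blast
  moreover have "t *\<^sub>R v \<noteq> 0" using n assms(4) by auto
  ultimately obtain c c' where "unit_geodesic S {0..t} c c'" "c 0 = P" "c' 0 = (t *\<^sub>R v) /\<^sub>R t"
    using exp_relE n by metis
  then show ?thesis using that assms(4) by simp
qed

lemma connecting_geodesic:
  assumes "P \<in> W" "Q \<in> W" "P \<noteq> Q"
  obtains c c' l where "0 < l" "l < \<delta>" "unit_geodesic S {0..l} c c'" "c 0 = P" "c l = Q"
proof -
  obtain v where v: "v \<in> exp_dom P" "exp_map S P v = Q" using exp_covers assms by blast
  then have v0: "v \<noteq> 0" using assms(3) exp_map_0 by auto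
  obtain y where y: "exp_rel S P v y" using exp_rel_exists assms(1) v(1) by blast
  then have "y = Q" using exp_map_eqI v(2) by blast
  then obtain c c' where "unit_geodesic S {0..norm v} c c'" "c 0 = P" "c (norm v) = Q"
    using exp_relE[OF y v0] by metis
  then show ?thesis using that[of "norm v" c c'] v0 v(1) by (auto simp: exp_dom_def)
qed

lemma geo_direction_lg:
  assumes "P \<in> W" "Q \<in> W" "P \<noteq> Q"
  shows "geo_direction S \<delta> P Q = sgn (lg P Q)" "norm (geo_direction S \<delta> P Q) = 1" "lg P Q \<noteq> 0"
proof -
  obtain c c' l where c: "0 < l" "l < \<delta>" "unit_geodesic S {0..l} c c'" "c 0 = P" "c l = Q"
    using connecting_geodesic[OF assms] .
  have d: "geo_direction S \<delta> P Q = c' 0" "lg P Q = l *\<^sub>R c' 0"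
    using geo_direction_initial[OF c(3,1,2)] lg_geodesic[OF c(3,1,2)] c(4,5) assms(1) by auto
  have n: "norm (c' 0) = 1" using unit_geodesicD(3)[OF c(3), of 0] c(1) by simp
  show "geo_direction S \<delta> P Q = sgn (lg P Q)" "norm (geo_direction S \<delta> P Q) = 1"
    using d n c(1) by (auto simp: sgn_scaleR sgn_div_norm)
  have "norm (lg P Q) = l" using d n c(1) by simp
  then show "lg P Q \<noteq> 0" using c(1) by auto
qed

text \<open>
  Along a convergent subsequence the initial velocities converge, and so do the geodesics, by
  continuous dependence, as long as they stay strictly inside the ball of radius \<open>\<delta>\<close>. The end point
  is reached in the limit from below; this is where continuity of the inverse of the exponential map
  at the limit point is needed.
\<close>

lemma lg_tendsto:
  assumes W: "\<And>k. Ps k \<in> W" "\<And>k. Qs k \<in> W" "\<And>k. Ps k \<noteq> Qs k" "P \<in> W" "Q \<in> W"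
    and lim: "Ps \<longlonglongrightarrow> P" "Qs \<longlonglongrightarrow> Q"
  shows "(\<lambda>k. lg (Ps k) (Qs k)) \<longlonglongrightarrow> lg P Q"
proof (rule ccontr)
  assume "\<not> ?thesis"
  then obtain e r where e: "e > 0" "strict_mono (r :: nat \<Rightarrow> nat)"
    "\<And>k. dist (lg (Ps (r k)) (Qs (r k))) (lg P Q) \<ge> e"
  proof -
    assume "\<not> (\<lambda>k. lg (Ps k) (Qs k)) \<longlonglongrightarrow> lg P Q"
      and *: "\<And>e r. 0 < e \<Longrightarrow> strict_mono (r :: nat \<Rightarrow> nat) \<Longrightarrow>
        (\<And>k. e \<le> dist (lg (Ps (r k)) (Qs (r k))) (lg P Q)) \<Longrightarrow> thesis"
    then obtain e where e: "e > 0" "\<And>n. \<exists>k\<ge>n. dist (lg (Ps k) (Qs k)) (lg P Q) \<ge> e"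
      unfolding lim_sequentially by (meson not_less)
    then have inf: "infinite {k. dist (lg (Ps k) (Qs k)) (lg P Q) \<ge> e}"
      by (auto simp: infinite_nat_iff_unbounded_le)
    show thesis
      using *[OF e(1) strict_mono_enumerate[OF inf]] enumerate_in_set[OF inf] by blast
  qed
  have "\<forall>k. \<exists>c c' l. 0 < l \<and> l < \<delta> \<and> unit_geodesic S {0..l} c c' \<and> c 0 = Ps k \<and> c l = Qs k"
    using connecting_geodesic[OF W(1,2,3)] by metis
  then obtain c c' l where c: "\<And>k. 0 < l k" "\<And>k. l k < \<delta>" "\<And>k. unit_geodesic S {0..l k} (c k) (c' k)"
    "\<And>k. c k 0 = Ps k" "\<And>k. c k (l k) = Qs k"
    by metis
  have n1: "norm (c' k 0) = 1" for k using unit_geodesicD(3)[OF c(3), of 0 k] c(1)[of k] by simp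
  have lgk: "lg (Ps k) (Qs k) = l k *\<^sub>R c' k 0" for k
    using lg_geodesic[OF c(3) c(1,2)] c(4,5) W(1) by metis
  have "compact ({0..\<delta>} \<times> sphere (0::real^3) 1)" by (intro compact_Times) auto
  moreover have "\<forall>k. (l (r k), c' (r k) 0) \<in> {0..\<delta>} \<times> sphere (0::real^3) 1"
    using c(1,2) n1 by (simp add: less_imp_le)
  ultimately obtain z r2 where z: "z \<in> {0..\<delta>} \<times> sphere (0::real^3) 1" "strict_mono r2"
    "((\<lambda>k. (l (r k), c' (r k) 0)) \<circ> r2) \<longlonglongrightarrow> z"
    unfolding compact_def by meson
  obtain L v where Lv: "z = (L, v)" by (cases z)
  define \<rho> where "\<rho> = r \<circ> r2"
  have \<rho>: "strict_mono \<rho>" unfolding \<rho>_def using e(2) z(2) by (rule strict_mono_o)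
  have v1: "norm v = 1" "0 \<le> L" "L \<le> \<delta>" using z(1) Lv by auto
  have lims: "(\<lambda>k. l (\<rho> k)) \<longlonglongrightarrow> L" "(\<lambda>k. c' (\<rho> k) 0) \<longlonglongrightarrow> v"
    using tendsto_fst[OF z(3)] tendsto_snd[OF z(3)] by (auto simp: Lv o_def \<rho>_def)
  have limP: "(\<lambda>k. Ps (\<rho> k)) \<longlonglongrightarrow> P" "(\<lambda>k. Qs (\<rho> k)) \<longlonglongrightarrow> Q"
    using LIMSEQ_subseq_LIMSEQ[OF lim(1) \<rho>] LIMSEQ_subseq_LIMSEQ[OF lim(2) \<rho>] by (auto simp: o_def)
  \<comment> \<open>Tangency survives the limit because the orthogonality to the continuous normal
    field does.\<close>
  have vT: "v \<in> tangent_space S P"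
  proof -
    obtain N where N: "unit_normal_near S P N" using unit_normal_exists W_subset W(4) by blast
    then obtain U where U: "open U" "P \<in> U" "smooth_on U N"
      "\<forall>y\<in>S \<inter> U. norm (N y) = 1 \<and> (\<forall>v\<in>tangent_space S y. N y \<bullet> v = 0)"
      unfolding unit_normal_near_def by blast
    have ev: "\<forall>\<^sub>F k in sequentially. Ps (\<rho> k) \<in> U" using topological_tendstoD[OF limP(1) U(1,2)] .
    have "(\<lambda>k. N (Ps (\<rho> k))) \<longlonglongrightarrow> N P"
      by (rule continuous_on_tendsto_compose[OF smooth_on_continuous[OF U(3)] limP(1) U(2) ev])
    then have lim1: "(\<lambda>k. N (Ps (\<rho> k)) \<bullet> c' (\<rho> k) 0) \<longlonglongrightarrow> N P \<bullet> v"
      using lims(2) by (rule tendsto_inner)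
    have "\<forall>\<^sub>F k in sequentially. N (Ps (\<rho> k)) \<bullet> c' (\<rho> k) 0 = 0"
      using ev
    proof eventually_elim
      case (elim k)
      have "c' (\<rho> k) 0 \<in> tangent_space S (Ps (\<rho> k))"
        using unit_geodesic_velocity_tangent[OF c(3) c(1), of 0 "\<rho> k"] c(1)[of "\<rho> k"] c(4) by simp
      then show ?case using U(4) elim W(1) W_subset by blast
    qed
    then have "N P \<bullet> v = 0"
      using tendsto_unique[OF trivial_limit_sequentially lim1 tendsto_eventually] by blast
    then show ?thesis using tangent_space_eq[OF W_subset[OF W(4)] N] by simp
  qed
  have "L *\<^sub>R v = lg P Q"
  proof (cases "L = 0")
    case True
    have "norm (Qs (\<rho> k) - Ps (\<rho> k)) \<le> l (\<rho> k)" for k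
      using unit_geodesic_dist_le[OF c(3)[of "\<rho> k"], of 0 "l (\<rho> k)"] c(1)[of "\<rho> k"] c(4,5) by simp
    then have "norm (Q - P) \<le> L"
      using LIMSEQ_le[OF tendsto_norm[OF tendsto_diff[OF limP(2,1)]] lims(1)] by blast
    then show ?thesis using True lg_self[OF W(4)] by simp
  next
    case False
    then have L0: "0 < L" using v1 by simp
    have in_dom: "t *\<^sub>R v \<in> exp_dom P" if "0 < t" "t < L" for t
      using tangent_space_scaleR[OF W_subset[OF W(4)] vT] that v1 by (simp add: exp_dom_def)
    \<comment> \<open>At time \<open>t\<close> the approximating geodesic has only
      \<open>l (\<rho> k) - t\<close> left to run, at unit speed, before it reaches
      \<open>Qs (\<rho> k)\<close>; the bound passes to the limit.\<close>
    have near: "norm (exp_map S P (t *\<^sub>R v) - Q) \<le> \<bar>L - t\<bar>" if t: "0 < t" "t < L" for t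
    proof -
      obtain d d' where d: "unit_geodesic S {0..t} d d'" "d 0 = P" "d' 0 = v"
        using t(2) v1(3) by (elim geodesic_from[OF W(4) vT v1(1) t(1), rotated]) linarith+
      have ev: "\<forall>\<^sub>F k in sequentially. t < l (\<rho> k)" using lims(1) t(2) by (rule order_tendstoD)
      have ev2: "\<forall>\<^sub>F k in sequentially. unit_geodesic S {0..t} (c (\<rho> k)) (c' (\<rho> k))"
        using ev by eventually_elim (rule unit_geodesic_subset[OF c(3)], simp)
      have "(\<lambda>k. c (\<rho> k) t) \<longlonglongrightarrow> d t"
        using geodesic_continuous_dependence[OF d(1) ev2, of t] lims limP d t c(4) by simp
      then have 1: "(\<lambda>k. norm (c (\<rho> k) t - Qs (\<rho> k))) \<longlonglongrightarrow> norm (d t - Q)"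
        by (intro tendsto_norm tendsto_diff limP)
      have 2: "(\<lambda>k. \<bar>l (\<rho> k) - t\<bar>) \<longlonglongrightarrow> \<bar>L - t\<bar>"
        using lims(1) by (intro tendsto_rabs tendsto_diff) auto
      have "\<forall>\<^sub>F k in sequentially. norm (c (\<rho> k) t - Qs (\<rho> k)) \<le> \<bar>l (\<rho> k) - t\<bar>"
        using ev
      proof eventually_elim
        case (elim k)
        then show ?case
          using unit_geodesic_dist_le[OF c(3)[of "\<rho> k"], of "l (\<rho> k)" t] c(5) t by (simp add: abs_minus_commute)
      qed
      then have "norm (d t - Q) \<le> \<bar>L - t\<bar>"
        by (rule tendsto_le[OF trivial_limit_sequentially 2 1])
      then show ?thesis using exp_map_geodesic[OF d(1) t(1)] d by simp
    qed
    have ev: "\<forall>\<^sub>F t in at_left L. 0 < t \<and> t < L"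
      using L0 by (auto intro: eventually_at_leftI[of 0])
    have "((\<lambda>t. exp_map S P (t *\<^sub>R v)) \<longlongrightarrow> Q) (at_left L)"
    proof (rule LIM_zero_cancel, rule Lim_null_comparison)
      show "\<forall>\<^sub>F t in at_left L. norm (exp_map S P (t *\<^sub>R v) - Q) \<le> \<bar>L - t\<bar>"
        using ev by eventually_elim (use near in blast)
      show "((\<lambda>t. \<bar>L - t\<bar>) \<longlongrightarrow> 0) (at_left L)"
        by (auto intro!: tendsto_eq_intros)
    qed
    then have "((\<lambda>t. lg P (exp_map S P (t *\<^sub>R v))) \<longlongrightarrow> lg P Q) (at_left L)"
    proof (rule continuous_on_tendsto_compose[OF lg_continuous[OF W(4)]])
      show "Q \<in> exp_map S P ` exp_dom P" using exp_covers W(4,5) by blast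
      show "\<forall>\<^sub>F t in at_left L. exp_map S P (t *\<^sub>R v) \<in> exp_map S P ` exp_dom P"
        using ev by eventually_elim (use in_dom in blast)
    qed
    moreover have "\<forall>\<^sub>F t in at_left L. lg P (exp_map S P (t *\<^sub>R v)) = t *\<^sub>R v"
      using ev by eventually_elim (use in_dom lg_exp[OF W(4)] in blast)
    ultimately have l1: "((\<lambda>t. t *\<^sub>R v) \<longlongrightarrow> lg P Q) (at_left L)"
      by (rule Lim_transform_eventually)
    have l2: "((\<lambda>t. t *\<^sub>R v) \<longlongrightarrow> L *\<^sub>R v) (at_left L)" by (auto intro!: tendsto_eq_intros)
    show ?thesis by (rule tendsto_unique[OF trivial_limit_at_left_real l2 l1])
  qed
  moreover have "(\<lambda>k. lg (Ps (\<rho> k)) (Qs (\<rho> k))) \<longlonglongrightarrow> L *\<^sub>R v"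
    unfolding lgk using lims by (rule tendsto_scaleR)
  ultimately have "(\<lambda>k. lg (Ps (\<rho> k)) (Qs (\<rho> k))) \<longlonglongrightarrow> lg P Q" by simp
  from eventually_happens'[OF trivial_limit_sequentially tendstoD[OF this e(1)]]
  obtain k where "dist (lg (Ps (\<rho> k)) (Qs (\<rho> k))) (lg P Q) < e" by blast
  then show False using e(3)[of "r2 k"] by (simp add: \<rho>_def)
qed

lemma geo_direction_tendsto:
  assumes "\<And>k. Ps k \<in> W" "\<And>k. Qs k \<in> W" "\<And>k. Ps k \<noteq> Qs k" "P \<in> W" "Q \<in> W" "P \<noteq> Q"
    and "Ps \<longlonglongrightarrow> P" "Qs \<longlonglongrightarrow> Q"
  shows "(\<lambda>k. geo_direction S \<delta> (Ps k) (Qs k)) \<longlonglongrightarrow> geo_direction S \<delta> P Q"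
  using tendsto_sgn[OF lg_tendsto[OF assms(1-5,7,8)] geo_direction_lg(3)[OF assms(4-6)]]
  by (simp add: geo_direction_lg(1) assms)

text \<open>Neither the directions nor the chord directions need converge when both end points tend
  to \<open>V\<close>; only their difference does. The error is quadratic in the length of the arc,
  hence linear after normalization.\<close>

lemma geo_direction_chord:
  assumes W: "\<And>k. Ps k \<in> W" "\<And>k. Qs k \<in> W" "\<And>k. Ps k \<noteq> Qs k" "V \<in> W"
    and lim: "Ps \<longlonglongrightarrow> V" "Qs \<longlonglongrightarrow> V"
  shows "(\<lambda>k. geo_direction S \<delta> (Ps k) (Qs k) - sgn (Qs k - Ps k)) \<longlonglongrightarrow> 0"
proof -
  obtain r M where r: "r > 0" "M \<ge> 0" and est:
    "\<And>a b c c' s t. unit_geodesic S {a..b} c c' \<Longrightarrow> c ` {a..b} \<subseteq> cball V r \<Longrightarrow> s \<in> {a..b} \<Longrightarrow> t \<in> {a..b} \<Longrightarrow>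
      norm (c t - c s - (t - s) *\<^sub>R c' s) \<le> M * (t - s)\<^sup>2"
    by (rule geodesic_local_estimates[OF W_subset[OF W(4)]]) (rule that)
  have len: "(\<lambda>k. norm (lg (Ps k) (Qs k))) \<longlonglongrightarrow> 0"
    using tendsto_norm[OF lg_tendsto[OF W(1-4,4) lim]] lg_self[OF W(4)] by simp
  have "\<forall>\<^sub>F k in sequentially. dist (Ps k) V < r / 2" using lim(1) r by (intro tendstoD) auto
  moreover have "\<forall>\<^sub>F k in sequentially. norm (lg (Ps k) (Qs k)) < r / 2"
    by (rule order_tendstoD(2)[OF len]) (use r in simp)
  ultimately have "\<forall>\<^sub>F k in sequentially.
      norm (geo_direction S \<delta> (Ps k) (Qs k) - sgn (Qs k - Ps k)) \<le> 2 * M * norm (lg (Ps k) (Qs k))"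
  proof eventually_elim
    case (elim k)
    obtain c c' l where c: "0 < l" "l < \<delta>" "unit_geodesic S {0..l} c c'" "c 0 = Ps k" "c l = Qs k"
      using connecting_geodesic[OF W(1,2,3)] .
    have n: "norm (c' 0) = 1" using unit_geodesicD(3)[OF c(3), of 0] c(1) by simp
    have d: "geo_direction S \<delta> (Ps k) (Qs k) = c' 0" "lg (Ps k) (Qs k) = l *\<^sub>R c' 0"
      using geo_direction_initial[OF c(3,1,2)] lg_geodesic[OF c(3,1,2)] c(4,5) W(1) by auto
    then have l: "norm (lg (Ps k) (Qs k)) = l" using n c(1) by simp
    have "dist (c s) V \<le> r" if "s \<in> {0..l}" for s
    proof -
      have "dist (c s) (Ps k) \<le> l"
        using unit_geodesic_dist_le[OF c(3), of 0 s] that c(1,4) by (auto simp: dist_norm)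
      then show ?thesis using elim l dist_triangle[of "c s" V "Ps k"] by linarith
    qed
    then have "c ` {0..l} \<subseteq> cball V r" by (auto simp: dist_commute)
    \<comment> \<open>The chord \<open>x\<close> differs from \<open>l *\<^sub>R c' 0\<close> by at
      most \<open>M * l\<^sup>2\<close>. Stretching it to length \<open>l\<close> costs no more than
      this again, whence the factor 2.\<close>
    define x where "x = Qs k - Ps k"
    have x: "norm (x - l *\<^sub>R c' 0) \<le> M * l\<^sup>2"
      using est[OF c(3) \<open>c ` {0..l} \<subseteq> cball V r\<close>, of 0 l] c by (simp add: x_def)
    have x0: "x \<noteq> 0" using W(3)[of k] by (simp add: x_def)
    have "norm (l *\<^sub>R sgn x - x) = \<bar>l - norm x\<bar>"
    proof -
      have "l *\<^sub>R sgn x - x = (l - norm x) *\<^sub>R sgn x"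
      proof -
        have "norm x *\<^sub>R sgn x = x" using x0 by (simp add: sgn_div_norm)
        then show ?thesis by (simp add: scaleR_diff_left)
      qed
      then show ?thesis using x0 by (simp add: norm_sgn)
    qed
    also have "\<dots> \<le> norm (x - l *\<^sub>R c' 0)"
      using norm_triangle_ineq3[of x "l *\<^sub>R c' 0"] n c(1) by (simp add: abs_minus_commute)
    finally have "norm (l *\<^sub>R sgn x - l *\<^sub>R c' 0) \<le> 2 * (M * l\<^sup>2)"
      using x norm_triangle_ineq[of "l *\<^sub>R sgn x - x" "x - l *\<^sub>R c' 0"] by simp
    then have "l * norm (c' 0 - sgn x) \<le> l * (2 * M * l)"
      using c(1) by (simp add: scaleR_diff_right[symmetric] norm_minus_commute power2_eq_square algebra_simps
          del: scaleR_diff_right)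
    then show ?case using c(1) d(1) l by (simp add: x_def)
  qed
  then show ?thesis
    by (rule Lim_null_comparison) (use tendsto_mult_left[OF len, of "2 * M"] in simp)
qed

end

section \<open>Angles\<close>

lemma inner_unit_bounds:
  assumes "norm u = 1" "norm w = 1"
  shows "u \<bullet> w \<in> {-1..1}"
  using Cauchy_Schwarz_ineq2[of u w] assms by auto

lemma arccos_inner_eq_0_iff:
  assumes "norm u = 1" "norm w = 1"
  shows "arccos (u \<bullet> w) = 0 \<longleftrightarrow> u = w"
proof
  assume "arccos (u \<bullet> w) = 0"
  then have "u \<bullet> w = 1"
    using inner_unit_bounds[OF assms] cos_arccos[of "u \<bullet> w"] by simp
  then have "(u - w) \<bullet> (u - w) = 0"
    using assms by (simp add: inner_diff_left inner_diff_right inner_commute norm_eq_1)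
  then show "u = w" by simp
next
  assume "u = w"
  then show "arccos (u \<bullet> w) = 0" using assms by (simp add: dot_square_norm)
qed

text \<open>The direction \<open>b\<close> lies between \<open>a\<close> and \<open>m\<close>.
  Taking inner products of the relation with the three vectors gives
  \<open>sin sin = cos cos - z\<close> for the two partial angles, that is, the addition formula,
  without choosing coordinates.\<close>

lemma arccos_inner_additive:
  fixes a b m :: "'a::real_inner"
  assumes n: "norm a = 1" "norm b = 1" "norm m = 1" and pos: "s > 0" "t > 0" "r > 0"
    and comb: "s *\<^sub>R b = t *\<^sub>R a + r *\<^sub>R m"
  shows "arccos (a \<bullet> b) + arccos (b \<bullet> m) = arccos (a \<bullet> m)"
proof -
  define x y z where "x = a \<bullet> b" and "y = b \<bullet> m" and "z = a \<bullet> m"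
  have u: "a \<bullet> a = 1" "b \<bullet> b = 1" "m \<bullet> m = 1" using n by (auto simp: dot_square_norm)
  have ia: "s * x = t + r * z" using arg_cong[OF comb, of "\<lambda>v. a \<bullet> v"] u
    by (simp add: x_def z_def inner_add_right)
  have ib: "s = t * x + r * y" using arg_cong[OF comb, of "\<lambda>v. b \<bullet> v"] u
    by (simp add: x_def y_def inner_add_right inner_commute)
  have im: "s * y = t * z + r" using arg_cong[OF comb, of "\<lambda>v. m \<bullet> v"] u
    by (simp add: y_def z_def inner_add_right inner_commute)
  have bd: "-1 \<le> x" "x \<le> 1" "-1 \<le> y" "y \<le> 1" "-1 \<le> z" "z \<le> 1"
    using inner_unit_bounds[OF n(1,2)] inner_unit_bounds[OF n(2,3)] inner_unit_bounds[OF n(1,3)]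
    by (auto simp: x_def y_def z_def)
  have e1: "t * (1 - x\<^sup>2) = r * (x * y - z)"
    using ia unfolding ib by (simp add: algebra_simps power2_eq_square)
  have e2: "r * (1 - y\<^sup>2) = t * (x * y - z)"
    using im unfolding ib by (simp add: algebra_simps power2_eq_square)
  have x2: "x\<^sup>2 \<le> 1" "y\<^sup>2 \<le> 1" using bd by (auto simp: abs_square_le_1 abs_le_iff)
  have "0 \<le> t * (1 - x\<^sup>2)" using x2 pos by simp
  then have nn: "0 \<le> x * y - z" unfolding e1 using pos by (simp add: zero_le_mult_iff)
  have "(t * r) * ((1 - x\<^sup>2) * (1 - y\<^sup>2)) = (t * (1 - x\<^sup>2)) * (r * (1 - y\<^sup>2))" by (simp add: ac_simps)
  also have "\<dots> = (t * r) * (x * y - z)\<^sup>2" unfolding e1 e2 by (simp add: power2_eq_square ac_simps)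
  finally have "(1 - x\<^sup>2) * (1 - y\<^sup>2) = (x * y - z)\<^sup>2" using pos by simp
  then have sq: "sqrt (1 - x\<^sup>2) * sqrt (1 - y\<^sup>2) = x * y - z"
    using nn by (simp add: real_sqrt_mult[symmetric])
  have cs: "cos (arccos x + arccos y) = z"
    using bd sq by (simp add: cos_add sin_arccos)
  \<comment> \<open>The cosine alone leaves open whether the sum of the partial angles exceeds
    \<open>pi\<close>; the sign of \<open>x + y\<close> excludes this.\<close>
  have "s * (x + y) = (t + r) * (1 + z)" using ia im by (simp add: algebra_simps)
  moreover have "0 \<le> (t + r) * (1 + z)" using pos bd by simp
  ultimately have "0 \<le> x + y" using pos by (metis zero_le_mult_iff not_less order_less_imp_le)
  then have "arccos x \<le> arccos (- y)" using bd by (intro arccos_le_arccos) auto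
  also have "\<dots> = pi - arccos y" using bd by (simp add: arccos_minus)
  finally have "arccos x + arccos y \<le> pi" by simp
  moreover have "0 \<le> arccos x + arccos y" using arccos_lbound bd by (simp add: add_nonneg_nonneg)
  ultimately have "arccos (cos (arccos x + arccos y)) = arccos x + arccos y" by (simp add: arccos_cos)
  then show ?thesis using cs by (simp add: x_def y_def z_def)
qed

text \<open>The side \<open>R - P\<close> is the sum of the other two, so its direction lies between
  theirs; the angle at \<open>Q\<close> is the supplement of the whole. Collinear points are
  included, as chords of small geodesic triangles may be degenerate.\<close>

lemma euclidean_angle_sum:
  fixes P Q R :: "'a::real_inner"
  assumes "P \<noteq> Q" "P \<noteq> R" "Q \<noteq> R"
  shows "arccos (sgn (Q - P) \<bullet> sgn (R - P)) + arccos (sgn (P - Q) \<bullet> sgn (R - Q))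
    + arccos (sgn (P - R) \<bullet> sgn (Q - R)) = pi"
proof -
  let ?a = "sgn (Q - P)" and ?b = "sgn (R - P)" and ?m = "sgn (R - Q)"
  have n: "norm ?a = 1" "norm ?b = 1" "norm ?m = 1" using assms by (auto simp: norm_sgn)
  have sg: "norm v *\<^sub>R sgn v = v" for v :: 'a by (cases "v = 0") (auto simp: sgn_div_norm)
  have neg: "sgn (u - v) = - sgn (v - u)" for u v :: 'a by (metis minus_diff_eq sgn_minus)
  have "arccos (?a \<bullet> ?b) + arccos (?b \<bullet> ?m) = arccos (?a \<bullet> ?m)"
    by (rule arccos_inner_additive[OF n, of "norm (R - P)" "norm (Q - P)" "norm (R - Q)"])
       (use assms in \<open>auto simp: sg\<close>)
  moreover have "arccos (sgn (P - Q) \<bullet> sgn (R - Q)) = pi - arccos (?a \<bullet> ?m)"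
    using inner_unit_bounds[OF n(1,3)] by (simp add: neg[of P Q] arccos_minus)
  moreover have "sgn (P - R) \<bullet> sgn (Q - R) = ?b \<bullet> ?m"
    by (simp add: neg[of P R] neg[of Q R])
  ultimately show ?thesis by simp
qed

lemma arccos_inner_diff_tendsto_0:
  fixes u u' w w' :: "nat \<Rightarrow> 'a::real_inner"
  assumes n: "\<And>k. norm (u k) = 1" "\<And>k. norm (u' k) = 1" "\<And>k. norm (w k) = 1" "\<And>k. norm (w' k) = 1"
    and lim: "(\<lambda>k. u k - u' k) \<longlonglongrightarrow> 0" "(\<lambda>k. w k - w' k) \<longlonglongrightarrow> 0"
  shows "(\<lambda>k. arccos (u k \<bullet> w k) - arccos (u' k \<bullet> w' k)) \<longlonglongrightarrow> 0"
proof -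
  have "(\<lambda>k. norm (u k - u' k) + norm (w k - w' k)) \<longlonglongrightarrow> 0"
    using tendsto_add[OF tendsto_norm[OF lim(1)] tendsto_norm[OF lim(2)]] by simp
  moreover have "norm (u k \<bullet> w k - u' k \<bullet> w' k) \<le> norm (u k - u' k) + norm (w k - w' k)" for k
  proof -
    have "u k \<bullet> w k - u' k \<bullet> w' k = (u k - u' k) \<bullet> w k + u' k \<bullet> (w k - w' k)"
      by (simp add: inner_diff_left inner_diff_right)
    then show ?thesis
      using Cauchy_Schwarz_ineq2[of "u k - u' k" "w k"] Cauchy_Schwarz_ineq2[of "u' k" "w k - w' k"] n
      by simp
  qed
  ultimately have "(\<lambda>k. u k \<bullet> w k - u' k \<bullet> w' k) \<longlonglongrightarrow> 0"
    by (intro Lim_null_comparison[of "\<lambda>k. u k \<bullet> w k - u' k \<bullet> w' k"]) auto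
  moreover have "uniformly_continuous_on {-1..1} arccos"
    by (intro compact_uniformly_continuous continuous_on_arccos') auto
  moreover have "u k \<bullet> w k \<in> {-1..1}" "u' k \<bullet> w' k \<in> {-1..1}" for k
    by (intro inner_unit_bounds n)+
  ultimately have "(\<lambda>k. dist (arccos (u k \<bullet> w k)) (arccos (u' k \<bullet> w' k))) \<longlonglongrightarrow> 0"
    unfolding uniformly_continuous_on_sequentially
    by (elim allE[of _ "\<lambda>k. u k \<bullet> w k"] allE[of _ "\<lambda>k. u' k \<bullet> w' k"])
       (simp add: dist_norm tendsto_rabs_zero)
  then show ?thesis by (simp add: dist_norm tendsto_rabs_zero_iff)
qed

context normal_neighborhood
begin

lemma geo_angle_eq:
  assumes "P \<in> W" "X \<in> W" "Y \<in> W" "P \<noteq> X" "P \<noteq> Y"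
  shows "geo_angle S \<delta> X P Y = arccos (geo_direction S \<delta> P X \<bullet> geo_direction S \<delta> P Y)"
  using geo_direction_lg(2)[of P X] geo_direction_lg(2)[of P Y] assms
  by (simp add: geo_angle_def vec_angle_def)

lemma geo_angle_nonneg:
  assumes "P \<in> W" "X \<in> W" "Y \<in> W" "P \<noteq> X" "P \<noteq> Y"
  shows "0 \<le> geo_angle S \<delta> X P Y"
  using inner_unit_bounds[OF geo_direction_lg(2)[of P X] geo_direction_lg(2)[of P Y]] assms
  by (simp add: geo_angle_eq arccos_lbound)

lemma geo_angle_tendsto:
  assumes "\<And>k. Ps k \<in> W" "\<And>k. Xs k \<in> W" "\<And>k. Ys k \<in> W" "\<And>k. Ps k \<noteq> Xs k" "\<And>k. Ps k \<noteq> Ys k"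
    and lim: "(\<lambda>k. geo_direction S \<delta> (Ps k) (Xs k)) \<longlonglongrightarrow> u" "(\<lambda>k. geo_direction S \<delta> (Ps k) (Ys k)) \<longlonglongrightarrow> w"
  shows "(\<lambda>k. geo_angle S \<delta> (Xs k) (Ps k) (Ys k)) \<longlonglongrightarrow> arccos (u \<bullet> w)"
proof -
  have n: "norm (geo_direction S \<delta> (Ps k) (Xs k)) = 1" "norm (geo_direction S \<delta> (Ps k) (Ys k)) = 1" for k
    using assms geo_direction_lg(2) by auto
  have "norm u = 1" "norm w = 1"
    using LIMSEQ_unique[OF tendsto_norm[OF lim(1)], of 1] LIMSEQ_unique[OF tendsto_norm[OF lim(2)], of 1] n by auto
  then have "(\<lambda>k. arccos (geo_direction S \<delta> (Ps k) (Xs k) \<bullet> geo_direction S \<delta> (Ps k) (Ys k))) \<longlonglongrightarrow> arccos (u \<bullet> w)"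
    using n inner_unit_bounds
    by (intro continuous_on_tendsto_compose[OF continuous_on_arccos' tendsto_inner[OF lim]] always_eventually allI) auto
  then show ?thesis by (simp add: geo_angle_eq assms)
qed

lemma geo_angle_sum_tendsto:
  assumes W: "\<And>k. Ps k \<in> W" "\<And>k. Qs k \<in> W" "\<And>k. Rs k \<in> W" "V \<in> W"
    and ne: "\<And>k. Ps k \<noteq> Qs k" "\<And>k. Ps k \<noteq> Rs k" "\<And>k. Qs k \<noteq> Rs k"
    and lim: "Ps \<longlonglongrightarrow> V" "Qs \<longlonglongrightarrow> V" "Rs \<longlonglongrightarrow> V"
  shows "(\<lambda>k. geo_angle S \<delta> (Qs k) (Ps k) (Rs k) + geo_angle S \<delta> (Ps k) (Qs k) (Rs k)
    + geo_angle S \<delta> (Ps k) (Rs k) (Qs k)) \<longlonglongrightarrow> pi"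
proof -
  have *: "(\<lambda>k. geo_angle S \<delta> (X k) (P k) (Y k) - arccos (sgn (X k - P k) \<bullet> sgn (Y k - P k))) \<longlonglongrightarrow> 0"
    if "\<And>k. P k \<in> W" "\<And>k. X k \<in> W" "\<And>k. Y k \<in> W" "\<And>k. P k \<noteq> X k" "\<And>k. P k \<noteq> Y k"
      "P \<longlonglongrightarrow> V" "X \<longlonglongrightarrow> V" "Y \<longlonglongrightarrow> V" for P X Y
  proof -
    have "X k - P k \<noteq> 0" "Y k - P k \<noteq> 0" for k using that(4,5) by (metis eq_iff_diff_eq_0)+
    then have "(\<lambda>k. arccos (geo_direction S \<delta> (P k) (X k) \<bullet> geo_direction S \<delta> (P k) (Y k))
        - arccos (sgn (X k - P k) \<bullet> sgn (Y k - P k))) \<longlonglongrightarrow> 0"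
      by (intro arccos_inner_diff_tendsto_0 geo_direction_chord[OF _ _ _ W(4)] geo_direction_lg(2) that)
         (simp_all add: norm_sgn)
    then show ?thesis by (simp add: geo_angle_eq that)
  qed
  have e: "arccos (sgn (Qs k - Ps k) \<bullet> sgn (Rs k - Ps k)) + arccos (sgn (Ps k - Qs k) \<bullet> sgn (Rs k - Qs k))
    + arccos (sgn (Ps k - Rs k) \<bullet> sgn (Qs k - Rs k)) = pi" for k
    by (rule euclidean_angle_sum[OF ne])
  note l = *[of Ps Qs Rs, OF W(1,2,3) ne(1,2) lim] *[of Qs Ps Rs, OF W(2,1,3) ne(1)[symmetric] ne(3) lim(2,1,3)]
    *[of Rs Ps Qs, OF W(3,1,2) ne(2)[symmetric] ne(3)[symmetric] lim(3,1,2)]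
  have "(\<lambda>k. (geo_angle S \<delta> (Qs k) (Ps k) (Rs k) + geo_angle S \<delta> (Ps k) (Qs k) (Rs k)
    + geo_angle S \<delta> (Ps k) (Rs k) (Qs k)) - pi) \<longlonglongrightarrow> 0 + 0 + 0"
  proof (rule Lim_transform_eventually[OF tendsto_add[OF tendsto_add[OF l(1,2)] l(3)]], intro always_eventually allI)
    fix k show "geo_angle S \<delta> (Qs k) (Ps k) (Rs k) - arccos (sgn (Qs k - Ps k) \<bullet> sgn (Rs k - Ps k)) +
        (geo_angle S \<delta> (Ps k) (Qs k) (Rs k) - arccos (sgn (Ps k - Qs k) \<bullet> sgn (Rs k - Qs k))) +
        (geo_angle S \<delta> (Ps k) (Rs k) (Qs k) - arccos (sgn (Ps k - Rs k) \<bullet> sgn (Qs k - Rs k)))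
      = geo_angle S \<delta> (Qs k) (Ps k) (Rs k) + geo_angle S \<delta> (Ps k) (Qs k) (Rs k)
        + geo_angle S \<delta> (Ps k) (Rs k) (Qs k) - pi"
      using e[of k] by linarith
  qed
  then show ?thesis by (simp add: LIM_zero_iff)
qed

end

section \<open>Two geodesics from a common vertex\<close>

text \<open>The two sides at the vertex, parametrized by the distance from \<open>V\<close>. The
  clauses of \<open>transversal\<close> exclude the two ways in which the rays could belong to one
  geodesic.\<close>

locale two_rays = normal_neighborhood +
  fixes V :: "real^3" and a a' b b' :: "real \<Rightarrow> real^3" and la lb :: real
  assumes a: "0 < la" "la < \<delta>" "unit_geodesic S {0..la} a a'" "a 0 = V" "a ` {0..la} \<subseteq> W"
    and b: "0 < lb" "lb < \<delta>" "unit_geodesic S {0..lb} b b'" "b 0 = V" "b ` {0..lb} \<subseteq> W"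
    and transversal: "a' 0 \<noteq> b' 0" "a' 0 \<noteq> - b' 0"
begin

text \<open>The construction alternates between the sides; exchanging the rays supplies the twin of
  each fact proved for one of them.\<close>

lemma swap: "two_rays S W \<delta> V b b' a a' lb la"
  by unfold_locales (use a b transversal in auto)

lemma a_W: "s \<in> {0..la} \<Longrightarrow> a s \<in> W"
  using a(5) by blast

lemma V_W: "V \<in> W"
  using a_W[of 0] a(1,4) by simp

lemma norm_a': "s \<in> {0..la} \<Longrightarrow> norm (a' s) = 1"
  using unit_geodesicD(3)[OF a(3)] by blast

lemma ray_from_V:
  assumes "0 < s" "s \<le> la"
  shows "lg V (a s) = s *\<^sub>R a' 0" "geo_direction S \<delta> V (a s) = a' 0" "geo_direction S \<delta> (a s) V = - a' s"
    "norm (lg V (a s)) = s" "a s \<noteq> V" "a s \<in> W"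
proof -
  have g: "unit_geodesic S {0..s} a a'" by (rule unit_geodesic_subset[OF a(3)]) (use assms in auto)
  have sd: "s < \<delta>" using assms a(2) by simp
  show *: "lg V (a s) = s *\<^sub>R a' 0" "geo_direction S \<delta> V (a s) = a' 0"
    using lg_geodesic[OF g assms(1) sd] geo_direction_initial[OF g assms(1) sd] V_W a(4) by auto
  show W: "a s \<in> W" using a_W assms by simp
  show "geo_direction S \<delta> (a s) V = - a' s"
    using geo_direction_backward[OF g assms(1)] sd W a(4) by simp
  show n: "norm (lg V (a s)) = s" using * norm_a'[of 0] assms by simp
  show "a s \<noteq> V" using n assms lg_self[OF V_W] by auto
qed

text \<open>\<open>geo_segment\<close> is a union over all short arcs; equality of logarithms and
  uniqueness of geodesics collapse it to one.\<close>

lemma geo_segment_ray: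
  assumes "0 < s" "s \<le> la"
  shows "geo_segment S \<delta> V (a s) = a ` {0..s}"
proof
  have g: "unit_geodesic S {0..s} a a'" by (rule unit_geodesic_subset[OF a(3)]) (use assms in auto)
  have sd: "s < \<delta>" using assms a(2) by simp
  show "a ` {0..s} \<subseteq> geo_segment S \<delta> V (a s)"
    unfolding geo_segment_def geodesic_arc_def geodesic_on_iff using g sd assms a(4) by blast
  show "geo_segment S \<delta> V (a s) \<subseteq> a ` {0..s}"
  proof
    fix z assume "z \<in> geo_segment S \<delta> V (a s)"
    then obtain c c' l where c: "z \<in> c ` {0..l}" "0 < l" "l < \<delta>" "unit_geodesic S {0..l} c c'" "c 0 = V" "c l = a s"
      unfolding geo_segment_def geodesic_arc_def geodesic_on_iff by blast
    have eq: "l *\<^sub>R c' 0 = s *\<^sub>R a' 0"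
      using lg_geodesic[OF c(4,2,3)] V_W c(5,6) ray_from_V(1)[OF assms] by simp
    have n: "norm (c' 0) = 1" using unit_geodesicD(3)[OF c(4), of 0] c(2) by simp
    have "l = s" using arg_cong[OF eq, of norm] n norm_a'[of 0] c(2) assms by simp
    then have "c' 0 = a' 0" using eq c(2) by simp
    then have "c t = a t" if "t \<in> {0..s}" for t
      using unit_geodesic_unique(1)[OF c(4)[unfolded \<open>l = s\<close>] g _ _ that] c(5) a(4) by simp
    then show "z \<in> a ` {0..s}" using c(1) \<open>l = s\<close> by auto
  qed
qed

lemma rays_disjoint:
  assumes "0 < s" "s \<le> la" "0 < t" "t \<le> lb"
  shows "a s \<noteq> b t"
proof
  interpret sw: two_rays S W \<delta> V b b' a a' lb la by (rule swap)
  assume "a s = b t"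
  then have "geo_direction S \<delta> V (a s) = geo_direction S \<delta> V (b t)" by simp
  then show False using ray_from_V(2) sw.ray_from_V(2) assms transversal by simp
qed

text \<open>With angle 0 the geodesics from \<open>b t\<close> to \<open>V\<close> and to
  \<open>a s\<close> start alike, so the longer contains the shorter. If \<open>V\<close> comes
  first the rays are opposite at \<open>V\<close>, if \<open>a s\<close> comes first they have the
  same direction; \<open>transversal\<close> excludes both.\<close>

lemma geo_angle_at_ray_nonzero:
  assumes s: "0 < s" "s \<le> la" and t: "0 < t" "t \<le> lb"
  shows "geo_angle S \<delta> V (b t) (a s) \<noteq> 0"
proof
  interpret sw: two_rays S W \<delta> V b b' a a' lb la by (rule swap)
  let ?P = "b t" and ?X = "a s"
  have W: "?P \<in> W" "?X \<in> W" "?P \<noteq> V" "?P \<noteq> ?X" "?X \<noteq> V"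
    using ray_from_V[OF s] sw.ray_from_V[OF t] rays_disjoint[OF s t] by auto
  assume "geo_angle S \<delta> V ?P ?X = 0"
  then have dir: "geo_direction S \<delta> ?P V = geo_direction S \<delta> ?P ?X"
    using geo_angle_eq[of ?P V ?X] arccos_inner_eq_0_iff[OF geo_direction_lg(2)[of ?P V] geo_direction_lg(2)[of ?P ?X]]
      W V_W by simp
  obtain c c' l where c: "0 < l" "l < \<delta>" "unit_geodesic S {0..l} c c'" "c 0 = ?P" "c l = V"
    using connecting_geodesic[OF W(1) V_W W(3)] .
  obtain d d' m where d: "0 < m" "m < \<delta>" "unit_geodesic S {0..m} d d'" "d 0 = ?P" "d m = ?X"
    using connecting_geodesic[OF W(1,2,4)] .
  have init: "c' 0 = d' 0"
    using geo_direction_initial[OF c(3,1,2)] geo_direction_initial[OF d(3,1,2)] c d W dir by simp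
  have dirs: "geo_direction S \<delta> V ?X = a' 0" "geo_direction S \<delta> V ?P = b' 0"
    using ray_from_V(2)[OF s] sw.ray_from_V(2)[OF t] .
  show False
  proof (cases "l \<le> m")
    case True
    have g: "unit_geodesic S {0..l} d d'" by (rule unit_geodesic_subset[OF d(3)]) (use True in auto)
    have dl: "d l = V" using unit_geodesic_unique(1)[OF g c(3), of l] init c d by simp
    then have "l \<noteq> m" using d(5) W(5) by auto
    have g2: "unit_geodesic S {l..m} d d'" by (rule unit_geodesic_subset[OF d(3)]) (use c(1) in auto)
    have "geo_direction S \<delta> V ?X = d' l"
      using geo_direction_forward[OF g2] True \<open>l \<noteq> m\<close> dl d V_W c(1) by simp
    moreover have "geo_direction S \<delta> V ?P = - d' l"
      using geo_direction_backward[OF g c(1)] c(2) dl d(4) V_W by simp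
    ultimately show False using dirs transversal(2) by simp
  next
    case False
    have g: "unit_geodesic S {0..m} c c'" by (rule unit_geodesic_subset[OF c(3)]) (use False in auto)
    have cm: "c m = ?X" using unit_geodesic_unique(1)[OF g d(3), of m] init c d by simp
    have g2: "unit_geodesic S {m..l} c c'" by (rule unit_geodesic_subset[OF c(3)]) (use d(1) in auto)
    have "geo_direction S \<delta> V ?X = - c' l"
      using geo_direction_backward[OF g2] False cm c d(1) V_W by simp
    moreover have "geo_direction S \<delta> V ?P = - c' l"
      using geo_direction_backward[OF c(3,1)] c V_W by simp
    ultimately show False using dirs transversal(1) by simp
  qed
qed

definition vertex_angle :: real where
  "vertex_angle = arccos (a' 0 \<bullet> b' 0)"

lemma geo_angle_V:
  assumes "0 < s" "s \<le> la" "0 < t" "t \<le> lb"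
  shows "geo_angle S \<delta> (a s) V (b t) = vertex_angle"
proof -
  interpret sw: two_rays S W \<delta> V b b' a a' lb la by (rule swap)
  show ?thesis
    using geo_angle_eq[of V "a s" "b t"] ray_from_V(2,5,6)[of s] sw.ray_from_V(2,5,6)[of t] V_W assms
    by (auto simp: vertex_angle_def)
qed

lemma vertex_angle_less_pi: "vertex_angle < pi"
proof -
  have n: "norm (a' 0) = 1" "norm (- b' 0) = 1"
    using norm_a'[of 0] a(1) unit_geodesicD(3)[OF b(3), of 0] b(1) by auto
  have bd: "-1 \<le> a' 0 \<bullet> b' 0" "a' 0 \<bullet> b' 0 \<le> 1" using inner_unit_bounds[OF n] by auto
  have "arccos (a' 0 \<bullet> - b' 0) \<noteq> 0" using arccos_inner_eq_0_iff[OF n] transversal by simp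
  moreover have "arccos (a' 0 \<bullet> - b' 0) = pi - vertex_angle"
    using bd by (simp add: arccos_minus vertex_angle_def)
  moreover have "vertex_angle \<le> pi" using arccos_ubound bd by (simp add: vertex_angle_def)
  ultimately show ?thesis by simp
qed

lemma ray_continuous: "continuous_on {0..la} a"
  unfolding continuous_on_eq_continuous_within
  by (intro ballI has_vector_derivative_continuous) (rule unit_geodesicD(2)[OF a(3)])

lemma ray_tendsto:
  assumes "\<And>k. x k \<in> {0..la}" "x \<longlonglongrightarrow> z"
  shows "(\<lambda>k. a (x k)) \<longlonglongrightarrow> a z" "z \<in> {0..la}"
proof -
  show z: "z \<in> {0..la}"
    using closed_sequentially[of "{0..la}" x z] assms by auto
  show "(\<lambda>k. a (x k)) \<longlonglongrightarrow> a z"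
    using continuous_on_tendsto_compose[OF ray_continuous assms(2) z] assms(1) by simp
qed

text \<open>The triangle becomes infinitely thin while the far corner stays away from
  \<open>V\<close>: the angle at the collapsing corner tends to the exterior angle at
  \<open>V\<close>.\<close>

lemma geo_angle_tendsto_near_vertex:
  assumes x: "\<And>k. 0 < x k" "\<And>k. x k \<le> la" "x \<longlonglongrightarrow> 0"
    and y: "\<And>k. 0 < y k" "\<And>k. y k \<le> lb" "y \<longlonglongrightarrow> z" "0 < z"
  shows "(\<lambda>k. geo_angle S \<delta> V (a (x k)) (b (y k))) \<longlonglongrightarrow> pi - vertex_angle"
proof -
  interpret sw: two_rays S W \<delta> V b b' a a' lb la by (rule swap)
  have ax: "a (x k) \<in> W" "a (x k) \<noteq> V" "b (y k) \<in> W" "a (x k) \<noteq> b (y k)" for k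
    using ray_from_V[of "x k"] sw.ray_from_V[of "y k"] rays_disjoint x(1,2) y(1,2) by auto
  have la: "(\<lambda>k. a (x k)) \<longlonglongrightarrow> V" using ray_tendsto[of x 0] x a(4) by (simp add: less_imp_le)
  have lb: "(\<lambda>k. b (y k)) \<longlonglongrightarrow> b z" "z \<in> {0..lb}" using sw.ray_tendsto[of y z] y by (auto simp: less_imp_le)
  have bz: "b z \<in> W" "b z \<noteq> V" "geo_direction S \<delta> V (b z) = b' 0"
    using sw.ray_from_V[of z] y(4) lb(2) by auto
  have d2: "(\<lambda>k. geo_direction S \<delta> (a (x k)) (b (y k))) \<longlonglongrightarrow> b' 0"
    using geo_direction_tendsto[of "\<lambda>k. a (x k)" "\<lambda>k. b (y k)" V "b z"] ax la lb bz V_W by auto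
  \<comment> \<open>The direction back to \<open>V\<close> is not covered by
    \<open>geo_direction_tendsto\<close>, since both end points tend to \<open>V\<close>; it is read
    off from the velocity of the ray.\<close>
  have "continuous_on {0..la} a'"
    using a(3) has_vector_derivative_continuous unfolding unit_geodesic_def
    by (metis continuous_on_eq_continuous_within)
  then have "(\<lambda>k. - a' (x k)) \<longlonglongrightarrow> - a' 0"
    by (intro tendsto_minus continuous_on_tendsto_compose[OF _ x(3)])
       (use a(1) x in \<open>auto simp: less_imp_le\<close>)
  then have d1: "(\<lambda>k. geo_direction S \<delta> (a (x k)) V) \<longlonglongrightarrow> - a' 0"
    using ray_from_V(3) x by simp
  have "(\<lambda>k. geo_angle S \<delta> V (a (x k)) (b (y k))) \<longlonglongrightarrow> arccos (- a' 0 \<bullet> b' 0)"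
    by (rule geo_angle_tendsto[OF _ _ _ _ _ d1 d2]) (use ax V_W in auto)
  moreover have "a' 0 \<bullet> b' 0 \<in> {-1..1}"
    using norm_a'[of 0] a(1) sw.norm_a'[of 0] b(1) by (intro inner_unit_bounds) auto
  ultimately show ?thesis by (simp add: arccos_minus vertex_angle_def)
qed

lemma geo_angle_tendsto_interior:
  assumes x: "\<And>k. 0 < x k" "\<And>k. x k \<le> la" "x \<longlonglongrightarrow> z" "0 < z"
    and y: "\<And>k. 0 < y k" "\<And>k. y k \<le> lb" "y \<longlonglongrightarrow> w" "0 < w"
  shows "(\<lambda>k. geo_angle S \<delta> V (b (y k)) (a (x k))) \<longlonglongrightarrow> geo_angle S \<delta> V (b w) (a z)"
proof -
  interpret sw: two_rays S W \<delta> V b b' a a' lb la by (rule swap)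
  have ax: "a (x k) \<in> W" "b (y k) \<noteq> V" "b (y k) \<in> W" "b (y k) \<noteq> a (x k)" for k
    using ray_from_V[of "x k"] sw.ray_from_V[of "y k"] rays_disjoint[of "x k" "y k"] x(1,2) y(1,2) by auto
  have la: "(\<lambda>k. a (x k)) \<longlonglongrightarrow> a z" "z \<in> {0..la}" using ray_tendsto[of x z] x by (auto simp: less_imp_le)
  have lb: "(\<lambda>k. b (y k)) \<longlonglongrightarrow> b w" "w \<in> {0..lb}" using sw.ray_tendsto[of y w] y by (auto simp: less_imp_le)
  have l: "a z \<in> W" "b w \<in> W" "b w \<noteq> V" "b w \<noteq> a z"
    using ray_from_V[of z] sw.ray_from_V[of w] rays_disjoint[of z w] x(4) y(4) la lb by auto
  have "(\<lambda>k. geo_direction S \<delta> (b (y k)) V) \<longlonglongrightarrow> geo_direction S \<delta> (b w) V"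
    by (rule geo_direction_tendsto) (use ax l lb V_W in auto)
  moreover have "(\<lambda>k. geo_direction S \<delta> (b (y k)) (a (x k))) \<longlonglongrightarrow> geo_direction S \<delta> (b w) (a z)"
    by (rule geo_direction_tendsto) (use ax l lb la in auto)
  ultimately show ?thesis
    by (subst geo_angle_eq[of "b w"]) (use ax l V_W in \<open>auto intro!: geo_angle_tendsto\<close>)
qed

end

section \<open>The limits of the recursive construction\<close>

lemma perturbed_contraction_tendsto_0:
  fixes u d :: "nat \<Rightarrow> real"
  assumes u: "\<And>k. 0 \<le> u k" "\<And>k. u (Suc k) \<le> u k / 4 + d k" and d: "d \<longlonglongrightarrow> 0"
  shows "u \<longlonglongrightarrow> 0"
proof (rule LIMSEQ_I)
  fix e :: real assume "0 < e"
  then obtain K where K: "\<And>k. k \<ge> K \<Longrightarrow> d k < e / 4"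
    using order_tendstoD(2)[OF d, of "e / 4"] by (auto simp: eventually_sequentially)
  have ind: "u (n + K) \<le> u K * (1/4) ^ n + e / 2" for n
  proof (induction n)
    case (Suc n)
    have "u (Suc n + K) \<le> u (n + K) / 4 + e / 4"
      using u(2)[of "n + K"] K[of "n + K"] by simp
    then show ?case using Suc.IH \<open>0 < e\<close> by simp
  qed (use \<open>0 < e\<close> in simp)
  have "(\<lambda>n. u K * (1/4) ^ n) \<longlonglongrightarrow> u K * 0"
    by (intro tendsto_mult tendsto_const LIMSEQ_power_zero) simp
  then obtain M where M: "\<And>n. n \<ge> M \<Longrightarrow> u K * (1/4) ^ n < e / 2"
    using order_tendstoD(2)[of "\<lambda>n. u K * (1/4) ^ n" 0 sequentially "e / 2"] \<open>0 < e\<close>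
    by (auto simp: eventually_sequentially)
  have "u k < e" if "k \<ge> M + K" for k
  proof -
    have "M \<le> k - K" "k - K + K = k" using that by auto
    then show ?thesis using ind[of "k - K"] M[of "k - K"] by simp
  qed
  then show "\<exists>no. \<forall>n\<ge>no. norm (u n - 0) < e" using u(1) by auto
qed

text \<open>Deviations from the solution of the limiting linear system are compared. Since the
  weights are at least 1, each half-step divides the deviation by \<open>1 + Q k\<close> or
  \<open>1 + P (Suc k)\<close>, at least 2, so a full round contracts by 4 up to vanishing
  errors.\<close>

lemma alternating_division_limits:
  fixes \<alpha> \<beta> P Q :: "nat \<Rightarrow> real"
  assumes P: "\<And>k. 1 \<le> P k" "P \<longlonglongrightarrow> p" and Q: "\<And>k. 1 \<le> Q k" "Q \<longlonglongrightarrow> q"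
    and r1: "(\<lambda>k. \<alpha> k + (1 + Q k) * \<beta> k) \<longlonglongrightarrow> c"
    and r2: "(\<lambda>k. (1 + P (Suc k)) * \<alpha> (Suc k) + \<beta> k) \<longlonglongrightarrow> c"
  shows "\<exists>a b. \<alpha> \<longlonglongrightarrow> a \<and> \<beta> \<longlonglongrightarrow> b \<and> (1 + p) * a + b = c \<and> a + (1 + q) * b = c"
proof -
  have pq: "1 \<le> p" "1 \<le> q"
    using LIMSEQ_le_const[OF P(2)] LIMSEQ_le_const[OF Q(2)] P(1) Q(1) by blast+
  \<comment> \<open>The determinant \<open>(1 + p) * (1 + q) - 1\<close> of the limiting system,
    which Cramer's rule then solves by \<open>a\<close> and \<open>b\<close>.\<close>
  define D where "D = p + q + p * q"
  have D: "D > 0" using pq by (simp add: D_def add_pos_pos)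
  define a b where "a = c * q / D" and "b = c * p / D"
  have s: "(1 + p) * a + b = c" "a + (1 + q) * b = c"
    using D by (simp_all add: a_def b_def field_simps) (simp_all add: D_def algebra_simps)
  \<comment> \<open>The size of
    \<open>(1 + P (Suc k)) * (\<alpha> (Suc k) - a) + (\<beta> k - b)\<close>, rewritten so that its
    convergence to 0 is visible; \<open>f\<close> is the analogue for the other half-step.\<close>
  define e where "e k = \<bar>\<alpha> (Suc k) + \<beta> k + P (Suc k) * \<alpha> (Suc k) - c - (P (Suc k) - p) * a\<bar>" for k
  define f where "f k = \<bar>\<alpha> k + \<beta> k + Q k * \<beta> k - c - (Q k - q) * b\<bar>" for k
  have Ps: "(\<lambda>k. P (Suc k)) \<longlonglongrightarrow> p" using P(2) by (rule LIMSEQ_Suc)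
  have "(\<lambda>k. \<bar>(1 + P (Suc k)) * \<alpha> (Suc k) + \<beta> k - c - (P (Suc k) - p) * a\<bar>) \<longlonglongrightarrow> \<bar>c - c - (p - p) * a\<bar>"
    by (intro tendsto_intros r2 Ps)
  then have e: "e \<longlonglongrightarrow> 0" unfolding e_def by (simp add: algebra_simps)
  have "(\<lambda>k. \<bar>\<alpha> k + (1 + Q k) * \<beta> k - c - (Q k - q) * b\<bar>) \<longlonglongrightarrow> \<bar>c - c - (q - q) * b\<bar>"
    by (intro tendsto_intros r1 Q(2))
  then have f: "f \<longlonglongrightarrow> 0" unfolding f_def by (simp add: algebra_simps)
  have half: "\<bar>x\<bar> \<le> (\<bar>y\<bar> + \<bar>(1 + w) * x + y\<bar>) / 2" if "1 \<le> w" for x y w :: real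
  proof -
    have "2 * \<bar>x\<bar> \<le> (1 + w) * \<bar>x\<bar>" using that by (intro mult_right_mono) auto
    also have "\<dots> = \<bar>(1 + w) * x\<bar>" using that by (simp add: abs_mult)
    also have "\<dots> \<le> \<bar>(1 + w) * x + y\<bar> + \<bar>y\<bar>"
      using abs_triangle_ineq4[of "(1 + w) * x + y" y] by (simp only: add_diff_cancel_right')
    finally show ?thesis by (simp only: le_divide_eq_numeral1 mult.commute[of _ 2] add.commute)
  qed
  have b1: "\<bar>\<beta> k - b\<bar> \<le> (\<bar>\<alpha> k - a\<bar> + f k) / 2" for k
  proof -
    have "(1 + Q k) * (\<beta> k - b) + (\<alpha> k - a) = \<alpha> k + \<beta> k + Q k * \<beta> k - c - (Q k - q) * b"
      unfolding s(2)[symmetric] by (simp add: algebra_simps)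
    then show ?thesis using half[OF Q(1)[of k], of "\<beta> k - b" "\<alpha> k - a"] by (simp add: f_def)
  qed
  have a1: "\<bar>\<alpha> (Suc k) - a\<bar> \<le> (\<bar>\<beta> k - b\<bar> + e k) / 2" for k
  proof -
    have "(1 + P (Suc k)) * (\<alpha> (Suc k) - a) + (\<beta> k - b)
        = \<alpha> (Suc k) + \<beta> k + P (Suc k) * \<alpha> (Suc k) - c - (P (Suc k) - p) * a"
      unfolding s(1)[symmetric] by (simp add: algebra_simps)
    then show ?thesis using half[OF P(1)[of "Suc k"], of "\<alpha> (Suc k) - a" "\<beta> k - b"] by (simp add: e_def)
  qed
  have "(\<lambda>k. \<bar>\<alpha> k - a\<bar>) \<longlonglongrightarrow> 0"
  proof (rule perturbed_contraction_tendsto_0)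
    show "\<bar>\<alpha> (Suc k) - a\<bar> \<le> \<bar>\<alpha> k - a\<bar> / 4 + (f k / 4 + e k / 2)" for k
    proof -
      have "x \<le> z / 4 + (v / 4 + u / 2)" if "x \<le> (y + u) / 2" "y \<le> (z + v) / 2" for x y z u v :: real
        using that by simp
      then show ?thesis using a1[of k] b1[of k] .
    qed
    show "(\<lambda>k. f k / 4 + e k / 2) \<longlonglongrightarrow> 0"
      using tendsto_add[OF tendsto_divide[OF f tendsto_const[of 4]] tendsto_divide[OF e tendsto_const[of 2]]] by simp
  qed simp
  moreover have "(\<lambda>k. (\<bar>\<alpha> k - a\<bar> + f k) / 2) \<longlonglongrightarrow> (0 + 0) / 2"
    by (intro tendsto_intros calculation f) simp
  then have "(\<lambda>k. \<beta> k - b) \<longlonglongrightarrow> 0"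
    by (intro Lim_null_comparison[of "\<lambda>k. \<beta> k - b" "\<lambda>k. (\<bar>\<alpha> k - a\<bar> + f k) / 2"]) (use b1 in auto)
  ultimately show ?thesis
    using s by (intro exI[of _ a] exI[of _ b]) (auto simp: LIM_zero_iff tendsto_rabs_zero_iff)
qed

lemma halving_limit_nonpos:
  fixes f g h :: "nat \<Rightarrow> real"
  assumes "f \<longlonglongrightarrow> L" "g \<longlonglongrightarrow> L" "\<And>k. g k = (1 + h k) * f k" "\<And>k. 1 \<le> h k" "\<And>k. 0 \<le> f k"
  shows "L \<le> 0"
proof -
  have "2 * f k \<le> g k" for k
    unfolding assms(3) using assms(4)[of k] assms(5)[of k] by (intro mult_right_mono) auto
  then have "2 * L \<le> L"
    using LIMSEQ_le[OF tendsto_mult_left[OF assms(1)] assms(2)] by blast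
  then show ?thesis by simp
qed

section \<open>Convergence of the construction along two rays\<close>

context two_rays
begin

text \<open>Each new point lies on the segment back to \<open>V\<close>, so the parameters decrease.
  The shift by \<open>Suc\<close> reconciles sequences starting at 1 with parameters starting at
  0.\<close>

lemma recursive_construction_parameters:
  assumes rc: "recursive_construction S \<delta> p q V (a la) (b lb) As Bs \<alpha> \<beta>"
    and p1: "\<And>x. x \<in> S \<Longrightarrow> 1 \<le> p x" and q1: "\<And>x. x \<in> S \<Longrightarrow> 1 \<le> q x"
  obtains x y where "\<And>k. 0 < x k" "\<And>k. x k \<le> la" "decseq x" "\<And>k. As (Suc k) = a (x k)"
    "\<And>k. 0 < y k" "\<And>k. y k \<le> lb" "decseq y" "\<And>k. Bs (Suc k) = b (y k)"
proof -
  interpret sw: two_rays S W \<delta> V b b' a a' lb la by (rule swap)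
  have rc1: "As 1 = a la" "Bs 1 = b lb" using rc by (auto simp: recursive_construction_def)
  note rck = rc[unfolded recursive_construction_def, THEN conjunct2, THEN conjunct2, THEN conjunct2, rule_format]
  have angle_self: "geo_angle S \<delta> V P V = 0" if "P \<in> W" "P \<noteq> V" for P
    using geo_angle_eq[of P V V] arccos_inner_eq_0_iff[of "geo_direction S \<delta> P V"] geo_direction_lg(2)[of P V] that V_W
    by simp
  have step: "\<exists>x'. 0 < x' \<and> x' \<le> x \<and> As (Suc k + 1) = a x' \<and> (\<exists>y'. 0 < y' \<and> y' \<le> y \<and> Bs (Suc k + 1) = b y')"
    if x: "0 < x" "x \<le> la" "As (Suc k) = a x" and y: "0 < y" "y \<le> lb" "Bs (Suc k) = b y" for k x y
  proof -
    have r: "\<beta> (Suc k) = geo_angle S \<delta> V (b y) (a x) / (1 + q (b y))"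
      "As (Suc k + 1) \<in> geo_segment S \<delta> V (a x)"
      "geo_angle S \<delta> V (b y) (As (Suc k + 1)) = \<beta> (Suc k)"
      "\<alpha> (Suc k + 1) = geo_angle S \<delta> V (As (Suc k + 1)) (b y) / (1 + p (As (Suc k + 1)))"
      "Bs (Suc k + 1) \<in> geo_segment S \<delta> V (b y)"
      "geo_angle S \<delta> V (As (Suc k + 1)) (Bs (Suc k + 1)) = \<alpha> (Suc k + 1)"
      using rck[of "Suc k"] x y by simp_all
    have by_W: "b y \<in> W" "b y \<noteq> V" using sw.ray_from_V[OF y(1,2)] by auto
    obtain x' where x': "0 \<le> x'" "x' \<le> x" "As (Suc k + 1) = a x'"
      using r(2) geo_segment_ray[OF x(1,2)] by auto
    \<comment> \<open>A new point equal to \<open>V\<close> would make the prescribed angle 0, but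
      that angle is a positive fraction of a nonzero one.\<close>
    have "x' \<noteq> 0"
    proof
      assume "x' = 0"
      then have "\<beta> (Suc k) = 0" using r(3) x' a(4) angle_self by_W by simp
      then show False
        using r(1) geo_angle_at_ray_nonzero[OF x(1,2) y(1,2)] q1[OF W_subset[OF by_W(1)]] by simp
    qed
    then have x'p: "0 < x'" "x' \<le> la" using x' x by auto
    have ax_W: "a x' \<in> W" "a x' \<noteq> V" using ray_from_V[OF x'p] by auto
    obtain y' where y': "0 \<le> y'" "y' \<le> y" "Bs (Suc k + 1) = b y'"
      using r(5) sw.geo_segment_ray[OF y(1,2)] by auto
    have "y' \<noteq> 0"
    proof
      assume "y' = 0"
      then have "\<alpha> (Suc k + 1) = 0" using r(6) x' y' b(4) angle_self ax_W by simp
      then show False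
        using r(4) sw.geo_angle_at_ray_nonzero[OF y(1,2) x'p] p1[OF W_subset[OF ax_W(1)]] x' by simp
    qed
    then have "0 < y'" using y' by simp
    then show ?thesis using x' x'p y' by blast
  qed
  have inv: "\<exists>x y. 0 < x \<and> x \<le> la \<and> As (Suc k) = a x \<and> 0 < y \<and> y \<le> lb \<and> Bs (Suc k) = b y" for k
  proof (induction k)
    case 0
    then show ?case using rc1 a(1) b(1) by (intro exI[of _ la] exI[of _ lb]) simp
  next
    case (Suc k)
    then obtain x y where xy: "0 < x" "x \<le> la" "As (Suc k) = a x" "0 < y" "y \<le> lb" "Bs (Suc k) = b y" by blast
    then obtain x' y' where "0 < x'" "x' \<le> x" "As (Suc k + 1) = a x'" "0 < y'" "y' \<le> y" "Bs (Suc k + 1) = b y'"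
      using step[OF xy] by blast
    then show ?case using xy by (intro exI[of _ x'] exI[of _ y']) simp
  qed
  \<comment> \<open>The norm of the logarithm at \<open>V\<close> recovers the parameter from the
    point, so no choice of parameters is made.\<close>
  define x y where "x k = norm (lg V (As (Suc k)))" and "y k = norm (lg V (Bs (Suc k)))" for k
  have xy: "0 < x k \<and> x k \<le> la \<and> As (Suc k) = a (x k) \<and> 0 < y k \<and> y k \<le> lb \<and> Bs (Suc k) = b (y k)" for k
  proof -
    obtain s t where st: "0 < s" "s \<le> la" "As (Suc k) = a s" "0 < t" "t \<le> lb" "Bs (Suc k) = b t"
      using inv by blast
    then have "x k = s" "y k = t"
      using ray_from_V(4)[OF st(1,2)] sw.ray_from_V(4)[OF st(4,5)] by (auto simp: x_def y_def)
    then show ?thesis using st by simp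
  qed
  have "x (Suc k) \<le> x k \<and> y (Suc k) \<le> y k" for k
  proof -
    obtain x' y' where s: "0 < x'" "x' \<le> x k" "As (Suc k + 1) = a x'" "0 < y'" "y' \<le> y k" "Bs (Suc k + 1) = b y'"
      using step[of "x k" k "y k"] xy[of k] by blast
    have "x' \<le> la" "y' \<le> lb" using s(2,5) xy[of k] by linarith+
    then have "x (Suc k) = x'" "y (Suc k) = y'"
      unfolding x_def[of "Suc k"] y_def[of "Suc k"]
      using ray_from_V(4)[of x'] sw.ray_from_V(4)[of y'] s(1,3,4,6) by simp_all
    then show ?thesis using s(2,5) by simp
  qed
  then show ?thesis using that[of x y] xy by (simp add: decseq_Suc_iff)
qed

text \<open>
  If the points did not tend to \<open>V\<close>, then \<open>\<alpha>\<close> (or \<open>\<beta>\<close>) and the angle that is divided to obtain it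
  would have the same positive limit, although the first is at most half the second.
\<close>

theorem recursive_construction_limits:
  assumes rc: "recursive_construction S \<delta> p q V (a la) (b lb) As Bs \<alpha> \<beta>"
    and p1: "\<And>x. x \<in> S \<Longrightarrow> 1 \<le> p x" and q1: "\<And>x. x \<in> S \<Longrightarrow> 1 \<le> q x"
    and cont: "continuous (at V within S) p" "continuous (at V within S) q"
  shows "\<exists>l m. \<alpha> \<longlonglongrightarrow> l \<and> \<beta> \<longlonglongrightarrow> m \<and> (1 + p V) * l + m = pi - vertex_angle
    \<and> l + (1 + q V) * m = pi - vertex_angle"
proof -
  interpret sw: two_rays S W \<delta> V b b' a a' lb la by (rule swap)
  obtain x y where x: "\<And>k. 0 < x k" "\<And>k. x k \<le> la" "decseq x" "\<And>k. As (Suc k) = a (x k)"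
    and y: "\<And>k. 0 < y k" "\<And>k. y k \<le> lb" "decseq y" "\<And>k. Bs (Suc k) = b (y k)"
    using recursive_construction_parameters[OF rc p1 q1] by metis
  have pts: "a (x k) \<in> W" "a (x k) \<noteq> V" "b (y j) \<in> W" "b (y j) \<noteq> V" "a (x k) \<noteq> b (y j)" for k j
    using ray_from_V[of "x k"] sw.ray_from_V[of "y j"] rays_disjoint[of "x k" "y j"] x(1,2) y(1,2) by auto
  have pq: "1 \<le> p (a (x k))" "1 \<le> q (b (y k))" for k
    using p1 q1 W_subset pts by auto
  \<comment> \<open>Each angle appears twice: as a fraction of the angle before division and as an
    angle of the triangle after it. The two readings converge to the same limit as long as some
    corner stays away from \<open>V\<close>.\<close>
  have r\<beta>: "(1 + q (b (y k))) * \<beta> (Suc k) = geo_angle S \<delta> V (b (y k)) (a (x k))"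
    "\<beta> (Suc k) = geo_angle S \<delta> V (b (y k)) (a (x (Suc k)))"
    and r\<alpha>: "(1 + p (a (x (Suc k)))) * \<alpha> (Suc (Suc k)) = geo_angle S \<delta> V (a (x (Suc k))) (b (y k))"
    "\<alpha> (Suc (Suc k)) = geo_angle S \<delta> V (a (x (Suc k))) (b (y (Suc k)))" for k
  proof -
    have r: "\<beta> (Suc k) = geo_angle S \<delta> V (Bs (Suc k)) (As (Suc k)) / (1 + q (Bs (Suc k)))"
      "geo_angle S \<delta> V (Bs (Suc k)) (As (Suc k + 1)) = \<beta> (Suc k)"
      "\<alpha> (Suc k + 1) = geo_angle S \<delta> V (As (Suc k + 1)) (Bs (Suc k)) / (1 + p (As (Suc k + 1)))"
      "geo_angle S \<delta> V (As (Suc k + 1)) (Bs (Suc k + 1)) = \<alpha> (Suc k + 1)"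
      using rc unfolding recursive_construction_def by auto
    show "(1 + q (b (y k))) * \<beta> (Suc k) = geo_angle S \<delta> V (b (y k)) (a (x k))"
      using r(1) pq(2)[of k] by (simp add: x(4) y(4))
    show "(1 + p (a (x (Suc k)))) * \<alpha> (Suc (Suc k)) = geo_angle S \<delta> V (a (x (Suc k))) (b (y k))"
      using r(3) pq(1)[of "Suc k"] by (simp add: x(4) y(4))
    show "\<beta> (Suc k) = geo_angle S \<delta> V (b (y k)) (a (x (Suc k)))"
      "\<alpha> (Suc (Suc k)) = geo_angle S \<delta> V (a (x (Suc k))) (b (y (Suc k)))"
      using r(2,4) by (simp_all add: x(4) y(4))
  qed
  have \<alpha>_angle: "\<alpha> (Suc k) = geo_angle S \<delta> V (a (x k)) (b (y k))" for k
  proof (cases k)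
    case 0
    then show ?thesis using rc x(4)[of 0] y(4)[of 0] by (simp add: recursive_construction_def)
  next
    case (Suc j)
    then show ?thesis using r\<alpha>(2) by simp
  qed
  have nonneg: "0 \<le> \<beta> (Suc k)" "0 \<le> \<alpha> (Suc k)" for k
    unfolding r\<beta>(2) \<alpha>_angle using pts V_W by (auto intro!: geo_angle_nonneg) metis
  obtain xl where xl: "x \<longlonglongrightarrow> xl" "0 \<le> xl"
    using decseq_convergent[OF x(3), of 0] x(1) LIMSEQ_le_const[of x] by (metis less_imp_le)
  obtain yl where yl: "y \<longlonglongrightarrow> yl" "0 \<le> yl"
    using decseq_convergent[OF y(3), of 0] y(1) LIMSEQ_le_const[of y] by (metis less_imp_le)
  note xs = LIMSEQ_Suc[OF xl(1)] and ys = LIMSEQ_Suc[OF yl(1)]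
  have pos: "0 < pi - vertex_angle" using vertex_angle_less_pi by simp
  have "xl = 0 \<and> yl = 0"
  proof (rule ccontr)
    assume "\<not> (xl = 0 \<and> yl = 0)"
    \<comment> \<open>With both limits positive, continuity gives a nonzero common limit. If only
      one side collapses, the angle divided there tends to the exterior angle, which is positive;
      the third case is the second with the rays exchanged.\<close>
    then consider "0 < xl" "0 < yl" | "xl = 0" "0 < yl" | "0 < xl" "yl = 0" using xl yl by linarith
    then show False
    proof cases
      case 1
      let ?L = "geo_angle S \<delta> V (b yl) (a xl)"
      have "xl \<le> la" "yl \<le> lb" using LIMSEQ_le_const2[OF xl(1)] LIMSEQ_le_const2[OF yl(1)] x(2) y(2) by blast+
      then have "0 < ?L"
        using geo_angle_at_ray_nonzero[OF 1(1) _ 1(2)] geo_angle_nonneg[of "b yl" V "a xl"]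
          ray_from_V[OF 1(1)] sw.ray_from_V[OF 1(2)] rays_disjoint[OF 1(1) _ 1(2)] V_W by force
      moreover have "(\<lambda>k. \<beta> (Suc k)) \<longlonglongrightarrow> ?L"
        unfolding r\<beta>(2) by (rule geo_angle_tendsto_interior[OF _ _ xs 1(1) _ _ yl(1) 1(2)]) (use x y in auto)
      moreover have "(\<lambda>k. geo_angle S \<delta> V (b (y k)) (a (x k))) \<longlonglongrightarrow> ?L"
        by (rule geo_angle_tendsto_interior[OF _ _ xl(1) 1(1) _ _ yl(1) 1(2)]) (use x y in auto)
      ultimately show False
        using halving_limit_nonpos[OF _ _ r\<beta>(1)[symmetric] pq(2) nonneg(1)] by fastforce
    next
      case 2
      have "(\<lambda>k. \<alpha> (Suc (Suc k))) \<longlonglongrightarrow> pi - vertex_angle"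
        unfolding r\<alpha>(2) by (rule geo_angle_tendsto_near_vertex[OF _ _ xs[unfolded 2] _ _ ys 2(2)]) (use x y in auto)
      moreover have "(\<lambda>k. geo_angle S \<delta> V (a (x (Suc k))) (b (y k))) \<longlonglongrightarrow> pi - vertex_angle"
        by (rule geo_angle_tendsto_near_vertex[OF _ _ xs[unfolded 2] _ _ yl(1) 2(2)]) (use x y in auto)
      ultimately show False
        using halving_limit_nonpos[OF _ _ r\<alpha>(1)[symmetric] pq(1) nonneg(2)] pos by fastforce
    next
      case 3
      have sv: "sw.vertex_angle = vertex_angle"
        by (simp add: sw.vertex_angle_def vertex_angle_def inner_commute)
      have "(\<lambda>k. \<beta> (Suc k)) \<longlonglongrightarrow> pi - vertex_angle"
        unfolding r\<beta>(2) sv[symmetric]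
        by (rule sw.geo_angle_tendsto_near_vertex[OF _ _ yl(1)[unfolded 3] _ _ xs 3(1)]) (use x y in auto)
      moreover have "(\<lambda>k. geo_angle S \<delta> V (b (y k)) (a (x k))) \<longlonglongrightarrow> pi - vertex_angle"
        unfolding sv[symmetric]
        by (rule sw.geo_angle_tendsto_near_vertex[OF _ _ yl(1)[unfolded 3] _ _ xl(1) 3(1)]) (use x y in auto)
      ultimately show False
        using halving_limit_nonpos[OF _ _ r\<beta>(1)[symmetric] pq(2) nonneg(1)] pos by fastforce
    qed
  qed
  then have ax: "(\<lambda>k. a (x k)) \<longlonglongrightarrow> V" and bx: "(\<lambda>k. b (y k)) \<longlonglongrightarrow> V"
    using ray_tendsto(1)[OF _ xl(1)] sw.ray_tendsto(1)[OF _ yl(1)] x y a(4) b(4) by (auto simp: less_imp_le)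
  \<comment> \<open>The angle at \<open>V\<close> is constant along the rays, so the other two
    angles of the shrinking triangle must share \<open>pi - vertex_angle\<close> in the
    limit.\<close>
  have sum: "(\<lambda>k. geo_angle S \<delta> V (a (f k)) (b (g k)) + geo_angle S \<delta> V (b (g k)) (a (f k)))
      \<longlonglongrightarrow> pi - vertex_angle"
    if "(\<lambda>k. a (f k)) \<longlonglongrightarrow> V" "(\<lambda>k. b (g k)) \<longlonglongrightarrow> V" "\<And>k. 0 < f k" "\<And>k. f k \<le> la" "\<And>k. 0 < g k" "\<And>k. g k \<le> lb"
    for f g
  proof -
    have m: "a (f k) \<in> W" "V \<noteq> a (f k)" "b (g k) \<in> W" "V \<noteq> b (g k)" "a (f k) \<noteq> b (g k)" for k
      using ray_from_V[of "f k"] sw.ray_from_V[of "g k"] rays_disjoint[of "f k" "g k"] that(3-6) by metis+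
    have "(\<lambda>k. geo_angle S \<delta> (a (f k)) V (b (g k)) + geo_angle S \<delta> V (a (f k)) (b (g k))
        + geo_angle S \<delta> V (b (g k)) (a (f k))) \<longlonglongrightarrow> pi"
      by (rule geo_angle_sum_tendsto[where V = V]) (use m V_W that(1,2) in auto)
    then have "(\<lambda>k. vertex_angle + geo_angle S \<delta> V (a (f k)) (b (g k)) + geo_angle S \<delta> V (b (g k)) (a (f k)) - vertex_angle)
        \<longlonglongrightarrow> pi - vertex_angle"
      by (intro tendsto_diff) (simp_all add: geo_angle_V that)
    then show ?thesis by simp
  qed
  have lim: "(\<lambda>k. h (z k)) \<longlonglongrightarrow> h V" if "continuous (at V within S) h" "z \<longlonglongrightarrow> V" "\<And>k. z k \<in> W"
    for h :: "real^3 \<Rightarrow> real" and z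
    by (rule continuous_within_tendsto_compose[OF that(1) _ that(2)]) (use that(3) W_subset in auto)
  have "\<exists>l m. (\<lambda>k. \<alpha> (Suc k)) \<longlonglongrightarrow> l \<and> (\<lambda>k. \<beta> (Suc k)) \<longlonglongrightarrow> m \<and> (1 + p V) * l + m = pi - vertex_angle
    \<and> l + (1 + q V) * m = pi - vertex_angle"
  \<comment> \<open>The first relation comes from the triangles with corners \<open>a (x k)\<close>
    and \<open>b (y k)\<close>, the second from those with \<open>a (x (Suc k))\<close> and
    \<open>b (y k)\<close>.\<close>
  proof (rule alternating_division_limits[where P = "\<lambda>k. p (a (x k))" and Q = "\<lambda>k. q (b (y k))"])
    show "(\<lambda>k. p (a (x k))) \<longlonglongrightarrow> p V" "(\<lambda>k. q (b (y k))) \<longlonglongrightarrow> q V"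
      using lim[OF cont(1) ax] lim[OF cont(2) bx] pts by auto
    show "(\<lambda>k. \<alpha> (Suc k) + (1 + q (b (y k))) * \<beta> (Suc k)) \<longlonglongrightarrow> pi - vertex_angle"
      unfolding r\<beta>(1) \<alpha>_angle by (rule sum[OF ax bx x(1,2) y(1,2)])
    show "(\<lambda>k. (1 + p (a (x (Suc k)))) * \<alpha> (Suc (Suc k)) + \<beta> (Suc k)) \<longlonglongrightarrow> pi - vertex_angle"
      unfolding r\<alpha>(1) r\<beta>(2) by (rule sum[OF LIMSEQ_Suc[OF ax] bx x(1,2) y(1,2)])
  qed (use pq in auto)
  then show ?thesis by (simp add: filterlim_sequentially_Suc)
qed

end

section \<open>From a small triangle to a pair of rays\<close>

lemma arc_subset_geo_segment: "geodesic_arc S c l P Q \<Longrightarrow> l < \<delta> \<Longrightarrow> c ` {0..l} \<subseteq> geo_segment S \<delta> P Q"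
  unfolding geo_segment_def by blast

text \<open>Opposite initial directions would give angle \<open>pi\<close> at \<open>V\<close>.
  Equal ones would put one of \<open>A\<close> and \<open>B\<close> on the side through the other,
  and there the directions to the remaining corners would be opposite, against
  transversality.\<close>

lemma small_triangle_two_rays:
  assumes "surface_with_normals S" and st: "small_triangle S W \<delta> V A B" and \<mu>: "geo_angle S \<delta> A V B < pi"
  obtains a a' b b' la lb where "two_rays S W \<delta> V a a' b b' la lb" "a la = A" "b lb = B"
proof -
  interpret surface_with_normals S by fact
  have nn: "normal_neighborhood_of_all_points S W \<delta>" using st unfolding small_triangle_def by blast
  interpret normal_neighborhood S W \<delta> by unfold_locales (rule nn)
  have pts: "V \<in> W" "A \<in> W" "B \<in> W" "V \<noteq> A" "V \<noteq> B" "A \<noteq> B"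
    "span {geo_direction S \<delta> A V, geo_direction S \<delta> A B} = tangent_space S A"
    "span {geo_direction S \<delta> B V, geo_direction S \<delta> B A} = tangent_space S B"
    using st unfolding small_triangle_def by auto
  \<comment> \<open>The sides belong to \<open>W\<close> because they make up the boundary of the
    disc \<open>D\<close>.\<close>
  have seg: "geo_segment S \<delta> V A \<subseteq> W" "geo_segment S \<delta> V B \<subseteq> W"
  proof -
    obtain D h g where D: "D \<subseteq> W" "homeomorphism (cball (0 :: real^2) 1) D h g"
      "h ` sphere 0 1 = geo_segment S \<delta> V A \<union> geo_segment S \<delta> V B \<union> geo_segment S \<delta> A B"
      using st unfolding small_triangle_def by (elim conjE exE) (rule that)
    have "h ` sphere 0 1 \<subseteq> h ` cball 0 1" using sphere_cball by (rule image_mono)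
    also have "\<dots> = D" using D(2) unfolding homeomorphism_def by simp
    finally show "geo_segment S \<delta> V A \<subseteq> W" "geo_segment S \<delta> V B \<subseteq> W" using D(1,3) by blast+
  qed
  obtain a a' la where a: "0 < la" "la < \<delta>" "unit_geodesic S {0..la} a a'" "a 0 = V" "a la = A"
    using connecting_geodesic[OF pts(1,2,4)] .
  obtain b b' lb where b: "0 < lb" "lb < \<delta>" "unit_geodesic S {0..lb} b b'" "b 0 = V" "b lb = B"
    using connecting_geodesic[OF pts(1,3,5)] .
  have arcs: "geodesic_arc S a la V A" "geodesic_arc S b lb V B"
    unfolding geodesic_arc_def geodesic_on_iff using a b by blast+
  have img: "a ` {0..la} \<subseteq> W" "b ` {0..lb} \<subseteq> W"
    using order.trans[OF arc_subset_geo_segment seg(1)] order.trans[OF arc_subset_geo_segment seg(2)]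
      arcs a(2) b(2) by simp_all
  have dirs: "geo_direction S \<delta> V A = a' 0" "geo_direction S \<delta> V B = b' 0"
    using geo_direction_initial[OF a(3,1,2)] geo_direction_initial[OF b(3,1,2)] a b pts by auto
  have n: "norm (a' 0) = 1" "norm (b' 0) = 1"
    using unit_geodesicD(3)[OF a(3), of 0] unit_geodesicD(3)[OF b(3), of 0] a(1) b(1) by auto
  have opp: "a' 0 \<noteq> - b' 0"
  proof
    assume "a' 0 = - b' 0"
    then have "geo_angle S \<delta> A V B = arccos (-1)"
      using n by (simp add: geo_angle_def vec_angle_def dirs dot_square_norm)
    then show False using \<mu> by simp
  qed
  have thin: "span {- u, u} \<noteq> tangent_space S P" if "P \<in> W" for u P
  proof
    assume *: "span {- u, u} = tangent_space S P"
    have "span {- u, u} \<subseteq> span {u}" by (rule span_minimal) (auto simp: span_base span_neg)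
    then have "dim (tangent_space S P) \<le> dim (span {u})" unfolding *[symmetric] by (rule dim_subset)
    also have "\<dots> \<le> 1" using dim_le_card'[of "{u}"] by simp
    finally show False using dim_tangent_space[OF W_subset[OF that]] by simp
  qed
  have same: "a' 0 \<noteq> b' 0"
  proof
    assume eq: "a' 0 = b' 0"
    have "la \<noteq> lb"
      using unit_geodesic_unique(1)[OF a(3) b(3)[THEN unit_geodesic_subset], of la] eq a b pts(6) by auto
    then consider "la < lb" | "lb < la" by linarith
    then show False
    proof cases
      case 1
      have g: "unit_geodesic S {0..la} b b'" "unit_geodesic S {la..lb} b b'"
        by (rule unit_geodesic_subset[OF b(3)], use 1 a(1) in auto)+
      have "b la = A" using unit_geodesic_unique(1)[OF a(3) g(1), of la] eq a b by simp
      then show False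
        using geo_direction_backward[OF g(1) a(1)] geo_direction_forward[OF g(2) 1] a b pts thin[of A "b' la"] by simp
    next
      case 2
      have g: "unit_geodesic S {0..lb} a a'" "unit_geodesic S {lb..la} a a'"
        by (rule unit_geodesic_subset[OF a(3)], use 2 b(1) in auto)+
      have "a lb = B" using unit_geodesic_unique(1)[OF b(3) g(1), of lb] eq a b by simp
      then show False
        using geo_direction_backward[OF g(1) b(1)] geo_direction_forward[OF g(2) 2] a b pts thin[of B "a' lb"] by simp
    qed
  qed
  have "two_rays S W \<delta> V a a' b b' la lb"
    by unfold_locales (use a b img same opp in auto)
  then show ?thesis using that a(5) b(5) by blast
qed

section \<open>Curvatures\<close>

lemma orthonormal_triple_expansion:
  fixes e1 e2 e3 v :: "real^3"
  assumes n: "norm e1 = 1" "norm e2 = 1" "norm e3 = 1"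
    and o: "e1 \<bullet> e2 = 0" "e1 \<bullet> e3 = 0" "e2 \<bullet> e3 = 0"
  shows "v = (v \<bullet> e1) *\<^sub>R e1 + (v \<bullet> e2) *\<^sub>R e2 + (v \<bullet> e3) *\<^sub>R e3"
proof (rule ccontr)
  define w where "w = v - ((v \<bullet> e1) *\<^sub>R e1 + (v \<bullet> e2) *\<^sub>R e2 + (v \<bullet> e3) *\<^sub>R e3)"
  assume "\<not> ?thesis"
  then have w0: "w \<noteq> 0" by (simp add: w_def)
  have u: "e1 \<bullet> e1 = 1" "e2 \<bullet> e2 = 1" "e3 \<bullet> e3 = 1" using n by (auto simp: norm_eq_1)
  have o2: "e2 \<bullet> e1 = 0" "e3 \<bullet> e1 = 0" "e3 \<bullet> e2 = 0" using o by (simp_all add: inner_commute)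
  have wo: "w \<bullet> e1 = 0" "w \<bullet> e2 = 0" "w \<bullet> e3 = 0"
    using u o o2 by (simp_all add: w_def inner_diff_left inner_add_left)
  have nz: "e1 \<noteq> 0" "e2 \<noteq> 0" "e3 \<noteq> 0" using n by auto
  have ne: "e1 \<noteq> e2" "e1 \<noteq> e3" "e2 \<noteq> e3" "w \<noteq> e1" "w \<noteq> e2" "w \<noteq> e3" using o wo u by auto
  have "pairwise orthogonal {w, e1, e2, e3}"
    using o wo by (auto simp: pairwise_def orthogonal_def inner_commute)
  then have "independent {w, e1, e2, e3}"
    using w0 nz by (intro pairwise_orthogonal_independent) auto
  then have "card {w, e1, e2, e3} \<le> 3" using independent_card_le[of "{w, e1, e2, e3}"] by simp
  then show False using ne by simp
qed

text \<open>Used with the principal directions and the normal as the triple: the standard basis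
  makes continuity in the point evident, the triple shows the eigenvalues.\<close>

lemma trace_orthonormal_triple:
  fixes A :: "real^3 \<Rightarrow> real^3"
  assumes lin: "linear A" and on: "norm e1 = 1" "norm e2 = 1" "norm e3 = 1"
    "e1 \<bullet> e2 = 0" "e1 \<bullet> e3 = 0" "e2 \<bullet> e3 = 0"
  shows "(\<Sum>b\<in>Basis. A b \<bullet> b) = A e1 \<bullet> e1 + A e2 \<bullet> e2 + A e3 \<bullet> e3"
proof -
  have "A b \<bullet> b = (b \<bullet> e1) * (A e1 \<bullet> b) + (b \<bullet> e2) * (A e2 \<bullet> b) + (b \<bullet> e3) * (A e3 \<bullet> b)" for b
  proof -
    have "A b = (b \<bullet> e1) *\<^sub>R A e1 + (b \<bullet> e2) *\<^sub>R A e2 + (b \<bullet> e3) *\<^sub>R A e3"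
      using arg_cong[OF orthonormal_triple_expansion[OF on, of b], of A]
      by (simp only: linear_add[OF lin] linear_cmul[OF lin])
    then show ?thesis by (simp add: inner_add_left)
  qed
  then have "(\<Sum>b\<in>Basis. A b \<bullet> b)
      = (\<Sum>b\<in>Basis. (b \<bullet> e1) * (A e1 \<bullet> b) + (b \<bullet> e2) * (A e2 \<bullet> b) + (b \<bullet> e3) * (A e3 \<bullet> b))"
    by (rule sum.cong[OF refl])
  moreover have "(\<Sum>b\<in>Basis. (b \<bullet> e) * (z \<bullet> b)) = z \<bullet> e" for e z :: "real^3"
    by (subst euclidean_inner[of z e]) (simp add: inner_commute mult.commute)
  ultimately show ?thesis by (simp only: sum.distrib)
qed

text \<open>
  Minus the derivative of \<open>N\<close> at \<open>x\<close>, precomposed with the projection along \<open>N x\<close>: its eigenvalues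
  are the principal curvatures (up to a common sign) and \<open>0\<close>.
\<close>

definition extended_shape_operator :: "(real^3 \<Rightarrow> real^3) \<Rightarrow> real^3 \<Rightarrow> real^3 \<Rightarrow> real^3" where
  "extended_shape_operator N x v = - frechet_derivative N (at x) (v - (N x \<bullet> v) *\<^sub>R N x)"

lemma linear_extended_shape_operator:
  assumes "linear (frechet_derivative N (at x))"
  shows "linear (extended_shape_operator N x)"
proof -
  have "linear (\<lambda>v. v - (N x \<bullet> v) *\<^sub>R N x)"
    by (rule linearI) (simp_all add: algebra_simps inner_add_right)
  from linear_compose_neg[OF linear_compose[OF this assms]] show ?thesis
    by (simp add: extended_shape_operator_def[abs_def] o_def)
qed

lemma continuous_on_frechet_derivative_apply:
  fixes N :: "'a::euclidean_space \<Rightarrow> 'b::euclidean_space"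
  assumes "smooth_on U N" "continuous_on U w"
  shows "continuous_on U (\<lambda>x. frechet_derivative N (at x) (w x))"
proof -
  have "continuous_on U (\<lambda>x. \<Sum>b\<in>Basis. (w x \<bullet> b) *\<^sub>R frechet_derivative N (at x) b)"
    by (intro continuous_intros assms smooth_on_continuous[OF smooth_on_frechet[OF assms(1)]])
  moreover have "(\<Sum>b\<in>Basis. (w x \<bullet> b) *\<^sub>R frechet_derivative N (at x) b) = frechet_derivative N (at x) (w x)"
    if "x \<in> U" for x
  proof -
    have lin: "linear (frechet_derivative N (at x))" using smooth_on_linear assms that by blast
    show ?thesis
      using arg_cong[OF euclidean_representation[of "w x"], of "frechet_derivative N (at x)"]
      by (simp add: linear_sum[OF lin] linear_cmul[OF lin])
  qed
  ultimately show ?thesis by (simp cong: continuous_on_cong)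
qed

section \<open>Gauss curvature and continuity of the weights\<close>

context surface_with_normals
begin

text \<open>Two unit normals differ by the factor \<open>N y \<bullet> M y\<close>, a sign. By
  continuity it is constant along a short curve through \<open>x\<close>, and such curves determine
  the derivative on tangent vectors.\<close>

lemma derivative_of_unit_normals:
  assumes x: "x \<in> S" and N: "unit_normal_near S x N" and M: "unit_normal_near S x M"
  obtains \<epsilon> where "\<bar>\<epsilon>\<bar> = 1"
    "\<And>v. v \<in> tangent_space S x \<Longrightarrow> frechet_derivative M (at x) v = \<epsilon> *\<^sub>R frechet_derivative N (at x) v"
proof -
  obtain U where U: "open U" "x \<in> U" "smooth_on U N"
    "\<forall>y\<in>S \<inter> U. norm (N y) = 1 \<and> (\<forall>v\<in>tangent_space S y. N y \<bullet> v = 0)"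
    using N unfolding unit_normal_near_def by blast
  obtain U' where U': "open U'" "x \<in> U'" "smooth_on U' M"
    "\<forall>y\<in>S \<inter> U'. norm (M y) = 1 \<and> (\<forall>v\<in>tangent_space S y. M y \<bullet> v = 0)"
    using M unfolding unit_normal_near_def by blast
  have par: "M y = (N y \<bullet> M y) *\<^sub>R N y \<and> \<bar>N y \<bullet> M y\<bar> = 1" if y: "y \<in> S" "y \<in> U" "y \<in> U'" for y
  proof -
    have n: "norm (N y) = 1" "norm (M y) = 1" "\<And>v. v \<in> tangent_space S y \<Longrightarrow> M y \<bullet> v = 0"
      using U U' y by auto
    have "unit_normal_near S y N" unfolding unit_normal_near_def using U(1,3,4) y(2) by blast
    note T = tangent_space_eq[OF y(1) this]
    define w where "w = M y - (N y \<bullet> M y) *\<^sub>R N y"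
    have "N y \<bullet> w = 0" using n by (simp add: w_def inner_diff_right norm_eq_1)
    moreover from this have "M y \<bullet> w = 0" using T n(3) by simp
    ultimately have "w \<bullet> w = 0" by (subst w_def) (simp add: inner_diff_left)
    then have eq: "M y = (N y \<bullet> M y) *\<^sub>R N y" by (simp add: w_def)
    have "norm (M y) = \<bar>N y \<bullet> M y\<bar> * norm (N y)" by (subst (1) eq) simp
    then show ?thesis using eq n by simp
  qed
  have derN: "(N has_derivative frechet_derivative N (at x)) (at x)"
    and derM: "(M has_derivative frechet_derivative M (at x)) (at x)"
    using smooth_on_has_derivative U U' by blast+
  have "frechet_derivative M (at x) v = (N x \<bullet> M x) *\<^sub>R frechet_derivative N (at x) v"
    if v: "v \<in> tangent_space S x" for v
  proof -
    obtain e \<gamma> where \<gamma>: "0 < e" "\<gamma> ` {-e<..<e} \<subseteq> S" "\<gamma> 0 = x" "(\<gamma> has_vector_derivative v) (at (0::real))"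
      using v unfolding tangent_space_def by blast
    have g0: "(\<gamma> \<longlongrightarrow> x) (at 0)"
      using has_vector_derivative_continuous[OF \<gamma>(4)] \<gamma>(3) by (simp add: continuous_within)
    have dN: "((\<lambda>t. N (\<gamma> t)) has_vector_derivative frechet_derivative N (at x) v) (at 0)"
      using vector_derivative_diff_chain_within[of \<gamma> v 0 UNIV N "frechet_derivative N (at x)"] \<gamma>(3,4) derN
      by (auto simp: o_def has_derivative_at_withinI)
    have dM: "((\<lambda>t. M (\<gamma> t)) has_vector_derivative frechet_derivative M (at x) v) (at 0)"
      using vector_derivative_diff_chain_within[of \<gamma> v 0 UNIV M "frechet_derivative M (at x)"] \<gamma>(3,4) derM
      by (auto simp: o_def has_derivative_at_withinI)
    have "((\<lambda>t. N (\<gamma> t) \<bullet> M (\<gamma> t)) \<longlongrightarrow> N (\<gamma> 0) \<bullet> M (\<gamma> 0)) (at 0)"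
      using has_vector_derivative_continuous[OF dN] has_vector_derivative_continuous[OF dM]
      unfolding continuous_within by (rule tendsto_inner)
    then have "\<forall>\<^sub>F t in at 0. dist (N (\<gamma> t) \<bullet> M (\<gamma> t)) (N x \<bullet> M x) < 1"
      unfolding \<gamma>(3) by (rule tendstoD) simp
    moreover have "\<forall>\<^sub>F t in at 0. \<gamma> t \<in> U" "\<forall>\<^sub>F t in at 0. \<gamma> t \<in> U'"
      using topological_tendstoD[OF g0] U(1,2) U'(1,2) by auto
    moreover have "\<forall>\<^sub>F t in at 0. t \<in> {-e<..<e}"
      using \<gamma>(1) by (intro eventually_at_in_open') auto
    ultimately have ev: "\<forall>\<^sub>F t in at 0. (N x \<bullet> M x) *\<^sub>R N (\<gamma> t) = M (\<gamma> t)"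
    proof eventually_elim
      case (elim t)
      then have "\<gamma> t \<in> S" using \<gamma>(2) by blast
      note p = par[OF this elim(2,3)] par[OF x U(2) U'(2)]
      \<comment> \<open>Both numbers are 1 or -1, and they are less than 1 apart.\<close>
      have "N (\<gamma> t) \<bullet> M (\<gamma> t) = N x \<bullet> M x" using elim(1) p by (auto simp: dist_real_def abs_if split: if_splits)
      then show ?case using p by simp
    qed
    have "((\<lambda>t. (N x \<bullet> M x) *\<^sub>R N (\<gamma> t)) has_vector_derivative (N x \<bullet> M x) *\<^sub>R frechet_derivative N (at x) v) (at 0)"
      by (rule bounded_linear.has_vector_derivative[OF bounded_linear_scaleR_right dN])
    then have "((\<lambda>t. M (\<gamma> t)) has_vector_derivative (N x \<bullet> M x) *\<^sub>R frechet_derivative N (at x) v) (at 0)"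
      unfolding has_vector_derivative_def
      by (rule has_derivative_transform_eventually[OF _ ev]) (use par[OF x U(2) U'(2)] \<gamma>(3) in auto)
    then show ?thesis using vector_derivative_unique_at dM by blast
  qed
  then show ?thesis using that par[OF x U(2) U'(2)] by blast
qed

text \<open>Independence of the normal and of the basis makes the description in
  \<open>gauss_curvature\<close> definite: the sign enters squared, and so does the determinant of
  the change of basis.\<close>

lemma gauss_curvature_eq:
  assumes x: "x \<in> S" and pc: "principal_curvatures S x k1 k2"
  shows "gauss_curvature S x = k1 * k2"
proof -
  obtain N e1 e2 where N: "unit_normal_near S x N" and e: "orthonormal_tangent_basis S x e1 e2"
    and k: "shape_operator N x e1 = k1 *\<^sub>R e1" "shape_operator N x e2 = k2 *\<^sub>R e2"
    using pc unfolding principal_curvatures_def by blast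
  note T = tangent_space_eq[OF x N]
  have Nx: "norm (N x) = 1" using N x unfolding unit_normal_near_def by auto
  have lin: "linear (frechet_derivative N (at x))"
    using N smooth_on_linear unfolding unit_normal_near_def by blast
  have on: "norm e1 = 1" "norm e2 = 1" "norm (N x) = 1" "e1 \<bullet> e2 = 0" "e1 \<bullet> N x = 0" "e2 \<bullet> N x = 0"
    using e Nx T unfolding orthonormal_tangent_basis_def by (auto simp: inner_commute)
  have u: "e1 \<bullet> e1 = 1" "e2 \<bullet> e2 = 1" "e2 \<bullet> e1 = 0" using on by (auto simp: norm_eq_1 inner_commute)
  have "K = k1 * k2" if M: "unit_normal_near S x M" and f: "orthonormal_tangent_basis S x f1 f2"
    and K: "K = (shape_operator M x f1 \<bullet> f1) * (shape_operator M x f2 \<bullet> f2)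
          - (shape_operator M x f1 \<bullet> f2) * (shape_operator M x f2 \<bullet> f1)" for K M f1 f2
  proof -
    obtain \<epsilon> where \<epsilon>: "\<bar>\<epsilon>\<bar> = 1"
      "\<And>v. v \<in> tangent_space S x \<Longrightarrow> frechet_derivative M (at x) v = \<epsilon> *\<^sub>R frechet_derivative N (at x) v"
      by (rule derivative_of_unit_normals[OF x N M]) (rule that)
    have fT: "f1 \<in> tangent_space S x" "f2 \<in> tangent_space S x" "f1 \<bullet> f1 = 1" "f2 \<bullet> f2 = 1" "f1 \<bullet> f2 = 0"
      using f unfolding orthonormal_tangent_basis_def by (auto simp: norm_eq_1)
    define a b c d where "a = f1 \<bullet> e1" and "b = f1 \<bullet> e2" and "c = f2 \<bullet> e1" and "d = f2 \<bullet> e2"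
    have f1: "f1 = a *\<^sub>R e1 + b *\<^sub>R e2" and f2: "f2 = c *\<^sub>R e1 + d *\<^sub>R e2"
      using orthonormal_triple_expansion[OF on, of f1] orthonormal_triple_expansion[OF on, of f2] fT(1,2) T
      by (auto simp: a_def b_def c_def d_def inner_commute)
    have s: "shape_operator M x (s *\<^sub>R e1 + t *\<^sub>R e2) = \<epsilon> *\<^sub>R ((s * k1) *\<^sub>R e1 + (t * k2) *\<^sub>R e2)"
      if "s *\<^sub>R e1 + t *\<^sub>R e2 \<in> tangent_space S x" for s t
    proof -
      have "shape_operator M x (s *\<^sub>R e1 + t *\<^sub>R e2)
          = \<epsilon> *\<^sub>R (s *\<^sub>R shape_operator N x e1 + t *\<^sub>R shape_operator N x e2)"
        using \<epsilon>(2)[OF that] by (simp add: shape_operator_def linear_add[OF lin] linear_cmul[OF lin] algebra_simps)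
      then show ?thesis by (simp add: k)
    qed
    have r: "a * a + b * b = 1" "c * c + d * d = 1" "a * c + b * d = 0"
      using fT(3-5) unfolding f1 f2 by (simp_all add: inner_add_left inner_add_right u on(4) mult.commute)
    have "\<epsilon> * \<epsilon> = 1" using \<epsilon>(1) by (metis abs_mult_self_eq mult_1)
    have "K = (\<epsilon> * \<epsilon>) * ((a * k1 * a + b * k2 * b) * (c * k1 * c + d * k2 * d)
        - (a * k1 * c + b * k2 * d) * (c * k1 * a + d * k2 * b))"
      unfolding K s[OF fT(1)[unfolded f1], folded f1] s[OF fT(2)[unfolded f2], folded f2]
      unfolding f1 f2 by (simp add: inner_add_left inner_add_right u on(4) algebra_simps)
    \<comment> \<open>Lagrange's identity: the bracket is \<open>(a * d - b * c)\<^sup>2\<close>,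
      the squared determinant of an orthogonal matrix.\<close>
    also have "\<dots> = k1 * k2 * ((a * a + b * b) * (c * c + d * d) - (a * c + b * d) * (a * c + b * d))"
      unfolding \<open>\<epsilon> * \<epsilon> = 1\<close> by (simp add: algebra_simps)
    finally show ?thesis by (simp add: r)
  qed
  moreover have "k1 * k2 = (shape_operator N x e1 \<bullet> e1) * (shape_operator N x e2 \<bullet> e2)
          - (shape_operator N x e1 \<bullet> e2) * (shape_operator N x e2 \<bullet> e1)"
    unfolding k by (simp add: u on(4))
  ultimately show ?thesis
    unfolding gauss_curvature_def by (intro the_equality) (use N e in blast)+
qed

lemma curvature_traces:
  assumes x: "x \<in> S" and pc: "principal_curvatures S x k1 k2" and N: "unit_normal_near S x N"
  defines "A \<equiv> extended_shape_operator N x"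
  shows "\<bar>\<Sum>b\<in>Basis. A b \<bullet> b\<bar> = \<bar>k1 + k2\<bar>" "(\<Sum>b\<in>Basis. A (A b) \<bullet> b) = k1\<^sup>2 + k2\<^sup>2"
proof -
  obtain M e1 e2 where M: "unit_normal_near S x M" and e: "orthonormal_tangent_basis S x e1 e2"
    and k: "shape_operator M x e1 = k1 *\<^sub>R e1" "shape_operator M x e2 = k2 *\<^sub>R e2"
    using pc unfolding principal_curvatures_def by blast
  note T = tangent_space_eq[OF x N]
  have Nx: "norm (N x) = 1" using N x unfolding unit_normal_near_def by auto
  have lin: "linear (frechet_derivative N (at x))"
    using N smooth_on_linear unfolding unit_normal_near_def by blast
  then have linA: "linear A" unfolding A_def by (rule linear_extended_shape_operator)
  have eT: "e1 \<in> tangent_space S x" "e2 \<in> tangent_space S x"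
    using e unfolding orthonormal_tangent_basis_def by auto
  have on: "norm e1 = 1" "norm e2 = 1" "norm (N x) = 1" "e1 \<bullet> e2 = 0" "e1 \<bullet> N x = 0" "e2 \<bullet> N x = 0"
    using e Nx T unfolding orthonormal_tangent_basis_def by (auto simp: inner_commute)
  have u: "e1 \<bullet> e1 = 1" "e2 \<bullet> e2 = 1" "N x \<bullet> N x = 1" using on by (auto simp: norm_eq_1)
  obtain \<epsilon> where \<epsilon>: "\<bar>\<epsilon>\<bar> = 1"
    "\<And>v. v \<in> tangent_space S x \<Longrightarrow> frechet_derivative N (at x) v = \<epsilon> *\<^sub>R frechet_derivative M (at x) v"
    by (rule derivative_of_unit_normals[OF x M N]) (rule that)
  have AT: "A v = \<epsilon> *\<^sub>R shape_operator M x v" if "v \<in> tangent_space S x" for v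
    using that \<epsilon>(2)[OF that] T by (simp add: A_def extended_shape_operator_def shape_operator_def)
  have A: "A e1 = (\<epsilon> * k1) *\<^sub>R e1" "A e2 = (\<epsilon> * k2) *\<^sub>R e2" "A (N x) = 0"
    using AT[OF eT(1)] AT[OF eT(2)] k u linear_0[OF lin]
    by (auto simp: A_def extended_shape_operator_def)
  have "\<epsilon> * \<epsilon> = 1" using \<epsilon>(1) by (metis abs_mult_self_eq mult_1)
  have "(\<Sum>b\<in>Basis. A b \<bullet> b) = \<epsilon> * (k1 + k2)"
    unfolding trace_orthonormal_triple[OF linA on] by (simp add: A u algebra_simps)
  then show "\<bar>\<Sum>b\<in>Basis. A b \<bullet> b\<bar> = \<bar>k1 + k2\<bar>" using \<epsilon>(1) by (simp add: abs_mult)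
  have "(\<Sum>b\<in>Basis. A (A b) \<bullet> b) = (\<epsilon> * \<epsilon>) * (k1\<^sup>2 + k2\<^sup>2)"
    unfolding trace_orthonormal_triple[OF linear_compose[OF linA linA, unfolded o_def] on]
    by (simp add: A u linear_cmul[OF linA] linear_0[OF linA] algebra_simps power2_eq_square)
  then show "(\<Sum>b\<in>Basis. A (A b) \<bullet> b) = k1\<^sup>2 + k2\<^sup>2" by (simp add: \<open>\<epsilon> * \<epsilon> = 1\<close>)
qed

text \<open>The order and the common sign of \<open>k1\<close>, \<open>k2\<close> may jump from
  point to point. These two expressions are immune to that, being obtained from the traces of one
  operator and of its square, which depend continuously on the point.\<close>

lemma symmetric_curvature_function_continuous:
  assumes V: "V \<in> S" and pc: "\<And>x. x \<in> S \<Longrightarrow> principal_curvatures S x (k1 x) (k2 x)"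
  shows "continuous (at V within S) (\<lambda>x. \<bar>k1 x + k2 x\<bar>)" "continuous (at V within S) (\<lambda>x. (k1 x)\<^sup>2 + (k2 x)\<^sup>2)"
proof -
  obtain N U where U: "open U" "V \<in> U" "smooth_on U N"
    "\<forall>y\<in>S \<inter> U. norm (N y) = 1 \<and> (\<forall>v\<in>tangent_space S y. N y \<bullet> v = 0)"
    using unit_normal_exists[OF V] unfolding unit_normal_near_def by blast
  have N: "unit_normal_near S y N" if "y \<in> U" for y
    unfolding unit_normal_near_def using U(1,3,4) that by blast
  let ?A = "extended_shape_operator N"
  have cA: "continuous_on U (\<lambda>y. ?A y (w y))" if "continuous_on U w" for w
    unfolding extended_shape_operator_def
    by (intro continuous_on_minus continuous_on_frechet_derivative_apply[OF U(3)] continuous_intros that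
        smooth_on_continuous[OF U(3)])
  have transfer: "continuous (at V within S) h" if "continuous_on U g" "\<And>y. y \<in> S \<Longrightarrow> y \<in> U \<Longrightarrow> g y = h y"
    for g h :: "real^3 \<Rightarrow> real"
  proof -
    have "continuous (at V) g" using that(1) U(1,2) continuous_on_eq_continuous_at by blast
    then have "(g \<longlongrightarrow> g V) (at V within S)"
      using continuous_at_imp_continuous_at_within continuous_within by blast
    moreover have "\<forall>\<^sub>F y in at V within S. g y = h y"
      unfolding eventually_at_topological using U(1,2) that(2) by blast
    ultimately have "(h \<longlongrightarrow> g V) (at V within S)" by (rule Lim_transform_eventually)
    then show ?thesis using that(2)[OF V U(2)] by (simp add: continuous_within)
  qed
  show "continuous (at V within S) (\<lambda>x. \<bar>k1 x + k2 x\<bar>)"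
  proof (rule transfer)
    show "continuous_on U (\<lambda>y. \<bar>\<Sum>b\<in>Basis. ?A y b \<bullet> b\<bar>)" by (intro continuous_intros cA)
    show "\<bar>\<Sum>b\<in>Basis. ?A y b \<bullet> b\<bar> = \<bar>k1 y + k2 y\<bar>" if "y \<in> S" "y \<in> U" for y
      using curvature_traces(1)[OF that(1) pc N] that by simp
  qed
  show "continuous (at V within S) (\<lambda>x. (k1 x)\<^sup>2 + (k2 x)\<^sup>2)"
  proof (rule transfer)
    show "continuous_on U (\<lambda>y. \<Sum>b\<in>Basis. ?A y (?A y b) \<bullet> b)" by (intro continuous_intros cA)
    show "(\<Sum>b\<in>Basis. ?A y (?A y b) \<bullet> b) = (k1 y)\<^sup>2 + (k2 y)\<^sup>2" if "y \<in> S" "y \<in> U" for y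
      using curvature_traces(2)[OF that(1) pc N] that by simp
  qed
qed

lemma curvature_weights_continuous:
  assumes V: "V \<in> S" and pc: "\<And>x. x \<in> S \<Longrightarrow> principal_curvatures S x (k1 x) (k2 x)"
    and p: "\<And>x. x \<in> S \<Longrightarrow> p x = 1 + \<bar>gauss_curvature S x * (k1 x + k2 x)\<bar>"
    and q: "\<And>x. x \<in> S \<Longrightarrow> q x = 1 + \<bar>gauss_curvature S x\<bar> * (\<bar>k1 x\<bar> + \<bar>k2 x\<bar>)"
  shows "continuous (at V within S) p" "continuous (at V within S) q"
proof -
  note c = symmetric_curvature_function_continuous[OF V pc]
  let ?h = "\<lambda>x. \<bar>k1 x + k2 x\<bar>" and ?s = "\<lambda>x. (k1 x)\<^sup>2 + (k2 x)\<^sup>2"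
  let ?K = "\<lambda>x. \<bar>((?h x)\<^sup>2 - ?s x) / 2\<bar>"
  have cK: "continuous (at V within S) ?K" 
    by (rule continuous_rabs, rule continuous_divide[OF continuous_diff[OF continuous_power[OF c(1)] c(2)]]) auto
  have K: "\<bar>gauss_curvature S x\<bar> = ?K x" if "x \<in> S" for x
    using gauss_curvature_eq[OF that pc[OF that]] by (simp add: power2_sum)
  \<comment> \<open>Squaring \<open>\<bar>k1 x\<bar> + \<bar>k2 x\<bar>\<close> leaves
    \<open>?s x\<close> and twice the absolute Gauss curvature, both already continuous.\<close>
  have sq: "\<bar>k1 x\<bar> + \<bar>k2 x\<bar> = sqrt (?s x + 2 * ?K x)" if "x \<in> S" for x
  proof -
    have "?s x + 2 * ?K x = (\<bar>k1 x\<bar> + \<bar>k2 x\<bar>)\<^sup>2"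
      unfolding K[OF that, symmetric] gauss_curvature_eq[OF that pc[OF that]]
      by (simp add: power2_sum abs_mult)
    then show ?thesis by simp
  qed
  have transfer: "continuous (at V within S) f" if "continuous (at V within S) g" "\<And>x. x \<in> S \<Longrightarrow> f x = g x"
    for f g :: "real^3 \<Rightarrow> real"
    using that V by (intro continuous_transform_within[of V S g 1 f]) auto
  show "continuous (at V within S) p"
  proof (rule transfer)
    show "continuous (at V within S) (\<lambda>x. 1 + ?K x * ?h x)" by (intro continuous_add continuous_mult continuous_const cK c)
    show "p x = 1 + ?K x * ?h x" if "x \<in> S" for x
      unfolding K[OF that, symmetric] p[OF that] by (simp add: abs_mult)
  qed
  show "continuous (at V within S) q"
  proof (rule transfer)
    show "continuous (at V within S) (\<lambda>x. 1 + ?K x * sqrt (?s x + 2 * ?K x))"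
      by (intro continuous_add continuous_mult continuous_real_sqrt continuous_const cK c)
    show "q x = 1 + ?K x * sqrt (?s x + 2 * ?K x)" if "x \<in> S" for x
      unfolding q[OF that] sq[OF that] K[OF that] ..
  qed
qed

end

section \<open>From the limits back to the type of the vertex\<close>

lemma curvature_sign_from_weights:
  fixes h k :: real
  assumes "p = 1 + \<bar>h * k * (h + k)\<bar>" "q = 1 + \<bar>h * k\<bar> * (\<bar>h\<bar> + \<bar>k\<bar>)"
  shows "h * k > 0 \<longleftrightarrow> p = q \<and> p > 1" "h * k < 0 \<longleftrightarrow> p < q"
proof -
  have pos: "p = q \<and> p > 1" if "h * k > 0"
  proof -
    have "h > 0 \<and> k > 0 \<or> h < 0 \<and> k < 0" using that by (simp add: zero_less_mult_iff)
    then have "\<bar>h + k\<bar> = \<bar>h\<bar> + \<bar>k\<bar>" "h + k \<noteq> 0" by auto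
    moreover from this that have "0 < \<bar>h * k * (h + k)\<bar>" by auto
    ultimately show ?thesis using assms by (simp add: abs_mult)
  qed
  have neg: "p < q" if "h * k < 0"
  proof -
    have "h > 0 \<and> k < 0 \<or> h < 0 \<and> k > 0" using that by (simp add: mult_less_0_iff)
    then have "\<bar>h + k\<bar> < \<bar>h\<bar> + \<bar>k\<bar>" by auto
    moreover have "\<bar>h * k\<bar> > 0" using that by simp
    ultimately show ?thesis using assms by (simp only: abs_mult add_less_cancel_left mult_less_cancel_left_pos)
  qed
  have zero: "p = 1 \<and> q = 1" if "h * k = 0" using that assms by simp
  \<comment> \<open>The three cases are exhaustive and their conclusions exclude one another, so the
    implications can be reversed.\<close>
  show "h * k > 0 \<longleftrightarrow> p = q \<and> p > 1" "h * k < 0 \<longleftrightarrow> p < q"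
    using pos neg zero by (metis linorder_cases order_less_irrefl)+
qed

text \<open>The equations force \<open>p * l = q * m\<close>, so if one limit vanished, both would,
  contrary to \<open>0 < c\<close>. Each weight can then be solved for.\<close>

lemma limit_equations_determine_weights:
  fixes p q c l m :: real
  assumes "(1 + p) * l + m = c" "l + (1 + q) * m = c" "1 \<le> p" "1 \<le> q" "0 < c"
    and "(1 + p') * l + m = c" "l + (1 + q') * m = c" 
  shows "p = p'" "q = q'"
proof -
  have "p * l = q * m" using assms(1,2) by (simp add: algebra_simps)
  then have "l = 0 \<longleftrightarrow> m = 0" using assms(3,4) by auto
  then have nz: "l \<noteq> 0" "m \<noteq> 0" using assms(1,5) by auto
  have "(p - p') * l = ((1 + p) * l + m) - ((1 + p') * l + m)"
    "(q - q') * m = (l + (1 + q) * m) - (l + (1 + q') * m)"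
    by (simp_all add: algebra_simps)
  then have "(p - p') * l = 0" "(q - q') * m = 0" unfolding assms by simp_all
  then show "p = p'" "q = q'" using nz by auto
qed

theorem corollary2:
  fixes S W W' :: "(real^3) set" and k1 k2 p q :: "real^3 \<Rightarrow> real"
    and \<delta> \<delta>' \<mu> :: real and V A B V' A' B' :: "real^3"
    and As Bs As' Bs' :: "nat \<Rightarrow> real^3" and \<alpha> \<beta> \<alpha>' \<beta>' :: "nat \<Rightarrow> real"
  assumes "regular_surface S"
    and "\<And>x. x \<in> S \<Longrightarrow> principal_curvatures S x (k1 x) (k2 x)"
    and "\<And>x. x \<in> S \<Longrightarrow> p x = 1 + \<bar>gauss_curvature S x * (k1 x + k2 x)\<bar>"
    and "\<And>x. x \<in> S \<Longrightarrow> q x = 1 + \<bar>gauss_curvature S x\<bar> * (\<bar>k1 x\<bar> + \<bar>k2 x\<bar>)"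
    and "\<mu> < pi"
    and "small_triangle S W \<delta> V A B" and "geo_angle S \<delta> A V B = \<mu>"
    and "recursive_construction S \<delta> p q V A B As Bs \<alpha> \<beta>"
    and "small_triangle S W' \<delta>' V' A' B'" and "geo_angle S \<delta>' A' V' B' = \<mu>"
    and "recursive_construction S \<delta>' p q V' A' B' As' Bs' \<alpha>' \<beta>'"
    and "type_of_point S V \<noteq> type_of_point S V'"
  shows "\<exists>a b a' b'. \<alpha> \<longlonglongrightarrow> a \<and> \<beta> \<longlonglongrightarrow> b \<and> \<alpha>' \<longlonglongrightarrow> a' \<and> \<beta>' \<longlonglongrightarrow> b' \<and> (a, b) \<noteq> (a', b')"
proof -
  note pc = assms(2) and p = assms(3) and q = assms(4)
  have sn: "surface_with_normals S"
  proof
    show "\<exists>N. unit_normal_near S x N" if "x \<in> S" for x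
      using pc[OF that] unfolding principal_curvatures_def by blast
  qed (rule assms(1))
  then interpret surface_with_normals S .
  have pq1: "1 \<le> p x" "1 \<le> q x" if "x \<in> S" for x using p[OF that] q[OF that] by simp_all
  \<comment> \<open>Stated for arbitrary data, as the two triangles may lie in different normal
    neighborhoods with different radii.\<close>
  have limits: "V \<in> S \<and> (\<exists>l m. \<alpha> \<longlonglongrightarrow> l \<and> \<beta> \<longlonglongrightarrow> m \<and> (1 + p V) * l + m = pi - \<mu> \<and> l + (1 + q V) * m = pi - \<mu>)"
    if st: "small_triangle S W \<delta> V A B" and \<mu>: "geo_angle S \<delta> A V B = \<mu>"
      and rc: "recursive_construction S \<delta> p q V A B As Bs \<alpha> \<beta>"
    for W \<delta> V A B As Bs \<alpha> \<beta>
  proof -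
    obtain a a' b b' la lb where r: "two_rays S W \<delta> V a a' b b' la lb" "a la = A" "b lb = B"
      by (rule small_triangle_two_rays[OF sn st]) (use \<mu> assms(5) in simp, rule that)
    interpret two_rays S W \<delta> V a a' b b' la lb by (rule r(1))
    have VS: "V \<in> S" using W_subset V_W by blast
    have "vertex_angle = \<mu>" using geo_angle_V[of la lb] a(1) b(1) r(2,3) \<mu> by simp
    then show ?thesis
      using recursive_construction_limits[of p q As Bs \<alpha> \<beta>] rc r(2,3) pq1 VS
        curvature_weights_continuous[OF VS pc p q] by simp
  qed
  obtain l m where lm: "\<alpha> \<longlonglongrightarrow> l" "\<beta> \<longlonglongrightarrow> m" "(1 + p V) * l + m = pi - \<mu>" "l + (1 + q V) * m = pi - \<mu>" and V: "V \<in> S"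
    using limits[OF assms(6-8)] by blast
  obtain l' m' where lm': "\<alpha>' \<longlonglongrightarrow> l'" "\<beta>' \<longlonglongrightarrow> m'" "(1 + p V') * l' + m' = pi - \<mu>" "l' + (1 + q V') * m' = pi - \<mu>"
    and V': "V' \<in> S"
    using limits[OF assms(9-11)] by blast
  have "(l, m) \<noteq> (l', m')"
  proof
    assume "(l, m) = (l', m')"
    then have "p V = p V'" "q V = q V'"
      using limit_equations_determine_weights[OF lm(3,4) pq1[OF V]] lm'(3,4) assms(5) by auto
    moreover have "gauss_curvature S x > 0 \<longleftrightarrow> p x = q x \<and> p x > 1" "gauss_curvature S x < 0 \<longleftrightarrow> p x < q x"
      if "x \<in> S" for x
      using curvature_sign_from_weights[OF p[OF that, unfolded gauss_curvature_eq[OF that pc[OF that]]]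
          q[OF that, unfolded gauss_curvature_eq[OF that pc[OF that]]]]
      unfolding gauss_curvature_eq[OF that pc[OF that]] by auto
    ultimately have "type_of_point S V = type_of_point S V'"
      using V V' by (simp add: type_of_point_def)
    then show False using assms(12) by simp
  qed
  then show ?thesis using lm(1,2) lm'(1,2) by blast
qed

end
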